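(* Let $p^*=(x^*,\lambda^*,\mu^* )$ be a KKT point of the central NLP such that Assumptions 1, 2.a, 3 and 4 (listed in the context) hold at $p^*$, and let $\beta>0$. Then there exist an upper bound on the step size $\bar\alpha>0$, a lower bound on the penalty parameter $\bar\gamma<\infty$, and a radius $r>0$ such that if $\alpha<\bar\alpha$ (with $\alpha\in(0,1)$), $\gamma>\bar\gamma$ (with $\gamma\ge 0$) and $p^0\in\mathcal B_r(p^* )$, the sequence $\{p^q\}$ generated by Algorithm 2 (defined in the context) is bounded and converges to $p^*$. Moreover, for all $q=1,2,\dots$ Algorithm 2 is linearly convergent in one of the following (equivalent) senses: for any symmetric $Q\succ0$ the Lyapunov equation $(I-\alpha A(p^* ))^\top\bar P(I-\alpha A(p^* ))-\bar P=-Q$ has a solution $\bar P\succ0$ such that, with $C=\|I-\alpha A(p^* )\|_{\bar P}\in(0,1)$, $$\|p^q-p^*\|_{\bar P}\le C\|p^{q-1}-p^*\|_{\bar P},$$ or there exist constants $C_0>0$, $C_1\in(0,1)$ such that $$\|p^q-p^*\|\le C_0C_1^q\|p^0-p^*\|.$$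
   Context: **Central NLP.** $\mathcal G=(\mathcal V,\mathcal E)$ is an undirected connected graph, $\mathcal V=\{1,\dots,M\}$, and $\mathcal N_i=\{j\in\mathcal V: (i,j)\in\mathcal E,\ j\ne i\}$. Each $i\in\mathcal V$ has a variable $x_i\in\mathbb R^{n_i}$; $x_{\mathcal N_i}=[x_j]_{j\in\mathcal N_i}$. The central NLP is $$\min_{x_1,\dots,x_M}\ \sum_{i\in\mathcal V} f_i(x_i,x_{\mathcal N_i})\quad\text{s.t.}\quad g_i(x_i,x_{\mathcal N_i})=0,\quad h_i(x_i,x_{\mathcal N_i})\le 0,\quad i\in\mathcal V,$$ with multipliers $\lambda_i\in\mathbb R^{n_{gi}}$ for $g_i$ and $\mu_i\in\mathbb R^{n_{hi}}$ for $h_i$; $f_i$ is scalar valued, $g_i,h_i$ take values in $\mathbb R^{n_{gi}},\mathbb R^{n_{hi}}$; all functions are at least three times continuously differentiable. Local Lagrangians: $L_i(x_i,\lambda_i,\mu_i,x_{\mathcal N_i})=f_i+\lambda_i^\top g_i+\mu_i^\top h_i$; central Lagrangian: $L(x,\lambda,\mu)=\sum_{i}L_i$. Stacked quantities: $x=[x_i]_i\in\mathbb R^n$, $\lambda=[\lambda_i]_i\in\mathbb R^{n_g}$, $\mu=[\mu_i]_i\in\mathbb R^{n_h}$, $p=(x,\lambda,\mu)\in\mathbb R^{m}$ with $m=n+n_g+n_h$, $p_i=(x_i,\lambda_i,\mu_i)$, $g(x)=[g_i(x_i,x_{\mathcal N_i})]_i$, $h(x)=[h_i(x_i,x_{\mathcal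 N_i})]_i$. For vector functions, $\nabla$ denotes the Jacobian; $\|\cdot\|$ is the Euclidean/spectral norm; $\mathcal B_r(p^* )$ is the open Euclidean ball; $\|v\|_{\bar P}=\sqrt{v^\top\bar Pv}$, with the induced matrix norm. A KKT point is $p=(x,\lambda,\mu)$ with $\nabla_{x}L(x,\lambda,\mu)=0$, $g(x)=0$, $h(x)\le0$, $\mu\ge0$, $\mathrm{diag}(\mu)h(x)=0$. Active set: $\mathcal A(x)=\{k\in\{1,\dots,n_h\}:[h(x)]_k=0\}$. **Local NLPs.** For given $p$ and $\rho_i\ge0$, the local NLP of agent $i$ is $\min_{s_i\in\mathbb R^{n_i}}\bar f_i(s_i)$ s.t. $\bar g_i(s_i)=0$ (multiplier $\nu_i$), $\bar h_i(s_i)\le0$ (multiplier $\kappa_i$), where $$\bar f_i(s_i)=f_i(x_i+s_i,x_{\mathcal N_i})+\tfrac{\rho_i}{2}\|s_i\|^2+\sum_{j\in\mathcal N_i}\nabla_{x_i}L_j(x_j,\lambda_j,\mu_j,x_{\mathcal N_j})^\top s_i,$$ $\bar g_i(s_i)=g_i(x_i+s_i,x_{\mathcal N_i})$, $\bar h_i(s_i)=h_i(x_i+s_i,x_{\mathcal N_i})$ (all depending on $p$). Let $y_i=(s_i,\nu_i,\kappa_i)$ and $\bar L_i(y_i)=\bar f_i(s_i)+\nu_i^\top\bar g_i(s_i)+\kappa_i^\top\bar h_i(s_i)$. The local KKT conditions are $\nabla_{s_i}\bar L_i(y_i)=0$, $\bar g_i(s_i)=0$, $\bar h_i(s_i)\le0$,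 $\kappa_i\ge0$, $\mathrm{diag}(\kappa_i)\bar h_i(s_i)=0$. $\Phi(p)=(s(p),\nu(p),\kappa(p))$ denotes the stacked solution of all local KKT systems for given $p$; near $p^*$ it is the locally unique solution with $\Phi(p^* )=(0,\lambda^*,\mu^* )$, and $y=\Phi(p)$ is what the algorithm computes. **Algorithm 2 (SBDP+ under SOSC).** With $\alpha\in(0,1)$, $\beta>0$, $\gamma\ge0$, in iteration $q$ each agent computes $y_i^q$ from $y^q=\Phi(p^q)$ and sets $$p_i^{q+1}=p_i^q+\alpha\Big[P_i^q(y_i^q)(y_i^q-d_i(p_i^q))+\sum_{j\in\mathcal N_i\cup\{i\}}P_{ij}^q(y_j^q)\,s_j^q\Big],\qquad d_i(p_i)=(0,\lambda_i,\mu_i),$$ $$P_i^q(y_i)=\begin{bmatrix}\nabla^2_{s_is_i}\bar L_i(y_i)&\nabla_{s_i}\bar g_i(s_i)^\top&\nabla_{s_i}\bar h_i(s_i)^\top\\-\beta\nabla_{s_i}\bar g_i(s_i)&0&0\\-\beta\,\mathrm{diag}(\kappa_i)\nabla_{s_i}\bar h_i(s_i)&0&-\beta\,\mathrm{diag}(\bar h_i(s_i))\end{bmatrix},\qquad P^q_{ij}(y_j)=\gamma\begin{bmatrix}S^q_{ij}(y_j)\\0\\0\end{bmatrix},$$ $$S_{ij}^q(y_j)=(\nabla_{x_i}g_j)^\top\,\nabla_{x_j}g_j+(\nabla_{x_i}h_j)^\top\,\mathrm{diag}(\kappa_j)^2\,\nabla_{x_j}h_j,$$ where the barred functions are formed at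 $p=p^q$, and in $S^q_{ij}$ the partial Jacobians of $g_j,h_j$ are evaluated at $(x_j^q+s_j,\,x^q_{\mathcal N_j})$. **Matrix $A$.** With $J_g(x)=\nabla_xg(x)$, $J_h(x)=\nabla_xh(x)$, $U=\mathrm{diag}(\mu)$, $H(x)=\mathrm{diag}(h(x))$, $R(p)=J_g(x)^\top J_g(x)+J_h(x)^\top U^2J_h(x)$, $$A(p)=\begin{bmatrix}\nabla^2_{xx}L(x,\lambda,\mu)+\gamma R(p)&J_g(x)^\top&J_h(x)^\top\\-\beta J_g(x)&0&0\\-\beta UJ_h(x)&0&-\beta H(x)\end{bmatrix}.$$ **Assumptions at $p^*$.** 1. Strict complementarity: $[\mu^*]_k>0$ for $k\in\mathcal A(x^* )$; and LICQ: the matrix $[\nabla_xg(x^* )^\top,\ [\nabla_xh(x^* )]_{\mathcal A(x^* )}^\top]$ has full column rank ($[\cdot]_{\mathcal A}$ selects rows). 2.a. SOSC: $z^\top\nabla^2_{xx}L(x^*,\lambda^*,\mu^* )z>0$ for all $z\ne0$ with $\nabla_xg(x^* )z=0$ and $[\nabla_xh(x^* )]_{\mathcal A(x^* )}z=0$. 3. $\rho_i\ge0$ is such that $\nabla^2_{x_ix_i}L_i(x_i^*,\lambda_i^*,\mu_i^*,x^*_{\mathcal N_i})+\rho_iI\succ0$ for all $i\in\mathcal V$. 4. Constraint compatible decomposition: for each $i$ the matrix $[\nabla_{x_i}g_i(x_i^*,x^*_{\mathcal N_i})^\top,\ [\nabla_{x_i}h_i(x_i^*,x^*_{\mathcal N_i})]_{\mathcal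 A_i^*}^\top]$ has full column rank, where $\mathcal A_i^*=\{k:[h_i(x_i^*,x^*_{\mathcal N_i})]_k=0\}$.
   Formalization: The step-size bound and radius r may depend on γ (a step bound uniform in γ fails for M=1, f=x²/2, g=x); the two convergence senses are joined by a plain "or" without being equivalent: for f=x²/2+x³/6, ρ=1 the contraction with exactly C fails. *)

theory Defs
  imports "HOL-Analysis.Analysis"
begin

text \<open>
  The stacked vector \<open>p = (x, \<lambda>, \<mu>)\<close> is a vector over one finite index type
  \<open>'k\<close>, so \<open>m = CARD('k)\<close>. Every index carries a kind (a component of \<open>x\<close>, of \<open>\<lambda>\<close>
  or of \<open>\<mu>\<close>) and an owner, the agent \<open>i\<close> whose \<open>x\<^sub>i\<close>, \<open>\<lambda>\<^sub>i\<close> or \<open>\<mu>\<^sub>i\<close> it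
  belongs to. One index type instead of three keeps \<open>n\<^sub>g = 0\<close> and \<open>n\<^sub>h = 0\<close> possible,
  since Isabelle types are nonempty, and lets the dimensions depend on the agent.
  The vector \<open>y = (s, \<nu>, \<kappa>)\<close> of local solutions has the same layout.
  Functions of \<open>x\<close> are functions on the whole space that depend on primal components only, and
  a block matrix with rows and columns in given index sets is padded by zeros.
\<close>

datatype kind = Primal | Equality | Inequality

text \<open>
  \<open>constr N k\<close> is the scalar component of \<open>g\<^sub>i\<close> or \<open>h\<^sub>i\<close> whose multiplier is the
  component \<open>k\<close> of \<open>p\<close>; it has no meaning for a primal index \<open>k\<close>.
\<close>

record ('k::finite, 'v::finite) nlp =
  kind_of :: "'k \<Rightarrow> kind"
  owner :: "'k \<Rightarrow> 'v"
  edges :: "('v \<times> 'v) set"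
  cost :: "'v \<Rightarrow> real ^ 'k \<Rightarrow> real"
  constr :: "'k \<Rightarrow> real ^ 'k \<Rightarrow> real"

definition nbrs :: "('k::finite, 'v::finite) nlp \<Rightarrow> 'v \<Rightarrow> 'v set" where
  "nbrs N i = {j. (i, j) \<in> edges N \<and> j \<noteq> i}"

definition prims :: "('k::finite, 'v::finite) nlp \<Rightarrow> 'k set" where
  "prims N = {k. kind_of N k = Primal}"

definition eqs :: "('k::finite, 'v::finite) nlp \<Rightarrow> 'k set" where
  "eqs N = {k. kind_of N k = Equality}"

definition ineqs :: "('k::finite, 'v::finite) nlp \<Rightarrow> 'k set" where
  "ineqs N = {k. kind_of N k = Inequality}"

definition owned :: "('k::finite, 'v::finite) nlp \<Rightarrow> 'v \<Rightarrow> 'k set" where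
  "owned N i = {k. owner N k = i}"


section \<open>Calculus\<close>

definition partial_d :: "'k::finite \<Rightarrow> (real ^ 'k \<Rightarrow> real) \<Rightarrow> real ^ 'k \<Rightarrow> real" where
  "partial_d k F x = frechet_derivative F (at x) (axis k 1)"

definition hessian :: "(real ^ 'k::finite \<Rightarrow> real) \<Rightarrow> real ^ 'k \<Rightarrow> real ^ 'k ^ 'k" where
  "hessian F x = (\<chi> a b. partial_d a (partial_d b F) x)"

primrec C_k :: "nat \<Rightarrow> (real ^ 'k::finite \<Rightarrow> real) \<Rightarrow> bool" where
  "C_k 0 F = continuous_on UNIV F"
| "C_k (Suc l) F = ((\<forall>x. F differentiable (at x)) \<and> (\<forall>k. C_k l (partial_d k F)))"

definition depends_only_on :: "'k set \<Rightarrow> (real ^ 'k::finite \<Rightarrow> real) \<Rightarrow> bool" where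
  "depends_only_on S F \<longleftrightarrow> (\<forall>x y. (\<forall>k\<in>S. x $ k = y $ k) \<longrightarrow> F x = F y)"


section \<open>The central NLP\<close>

definition nlp_wf :: "('k::finite, 'v::finite) nlp \<Rightarrow> bool" where
  "nlp_wf N \<longleftrightarrow>
     sym (edges N) \<and> (\<forall>i j. (i, j) \<in> (edges N)\<^sup>*) \<and>
     (\<forall>i. C_k 3 (cost N i) \<and>
          depends_only_on {k \<in> prims N. owner N k \<in> insert i (nbrs N i)} (cost N i)) \<and>
     (\<forall>c \<in> eqs N \<union> ineqs N. C_k 3 (constr N c) \<and>
          depends_only_on {k \<in> prims N. owner N k \<in> insert (owner N c) (nbrs N (owner N c))}
            (constr N c))"

definition lagr_loc :: "('k::finite, 'v::finite) nlp \<Rightarrow> 'v \<Rightarrow> real ^ 'k \<Rightarrow> real" where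
  "lagr_loc N i p =
     cost N i p + (\<Sum>k \<in> eqs N \<inter> owned N i. p $ k * constr N k p)
                + (\<Sum>k \<in> ineqs N \<inter> owned N i. p $ k * constr N k p)"

definition lagr :: "('k::finite, 'v::finite) nlp \<Rightarrow> real ^ 'k \<Rightarrow> real" where
  "lagr N p = (\<Sum>i\<in>UNIV. lagr_loc N i p)"

definition kkt_point :: "('k::finite, 'v::finite) nlp \<Rightarrow> real ^ 'k \<Rightarrow> bool" where
  "kkt_point N p \<longleftrightarrow>
     (\<forall>k \<in> prims N. partial_d k (lagr N) p = 0) \<and>
     (\<forall>k \<in> eqs N. constr N k p = 0) \<and>
     (\<forall>k \<in> ineqs N. constr N k p \<le> 0 \<and> p $ k \<ge> 0 \<and> p $ k * constr N k p = 0)"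

definition active :: "('k::finite, 'v::finite) nlp \<Rightarrow> real ^ 'k \<Rightarrow> 'k set" where
  "active N p = {k \<in> ineqs N. constr N k p = 0}"


section \<open>Assumptions\<close>

definition strict_complementarity :: "('k::finite, 'v::finite) nlp \<Rightarrow> real ^ 'k \<Rightarrow> bool" where
  "strict_complementarity N p \<longleftrightarrow> (\<forall>k \<in> active N p. p $ k > 0)"

text \<open>
  The matrix whose columns, indexed by \<open>K\<close>, are the gradients of the constraints in \<open>K\<close> with
  respect to the components in \<open>X\<close>. The zero padding does not change its rank.
\<close>

definition grad_matrix ::
    "('k::finite, 'v::finite) nlp \<Rightarrow> 'k set \<Rightarrow> 'k set \<Rightarrow> real ^ 'k \<Rightarrow> real ^ 'k ^ 'k" where
  "grad_matrix N X K p = (\<chi> a b. if a \<in> X \<and> b \<in> K then partial_d a (constr N b) p else 0)"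

definition licq :: "('k::finite, 'v::finite) nlp \<Rightarrow> real ^ 'k \<Rightarrow> bool" where
  "licq N p \<longleftrightarrow>
     rank (grad_matrix N (prims N) (eqs N \<union> active N p) p) = card (eqs N \<union> active N p)"

definition sosc :: "('k::finite, 'v::finite) nlp \<Rightarrow> real ^ 'k \<Rightarrow> bool" where
  "sosc N p \<longleftrightarrow>
     (\<forall>z. z \<noteq> 0 \<and> (\<forall>k. k \<notin> prims N \<longrightarrow> z $ k = 0) \<and>
          (\<forall>c \<in> eqs N \<union> active N p. (\<Sum>a \<in> prims N. partial_d a (constr N c) p * z $ a) = 0)
        \<longrightarrow> 0 < z \<bullet> (hessian (lagr N) p *v z))"

text \<open>Positivity of the quadratic form of the principal submatrix with index set \<open>S\<close>.\<close>

definition pos_def_on :: "'k set \<Rightarrow> real ^ 'k ^ 'k::finite \<Rightarrow> bool" where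
  "pos_def_on S W \<longleftrightarrow> (\<forall>z. z \<noteq> 0 \<and> (\<forall>k. k \<notin> S \<longrightarrow> z $ k = 0) \<longrightarrow> 0 < z \<bullet> (W *v z))"

definition local_convexity ::
    "('k::finite, 'v::finite) nlp \<Rightarrow> ('v \<Rightarrow> real) \<Rightarrow> real ^ 'k \<Rightarrow> bool" where
  "local_convexity N \<rho> p \<longleftrightarrow>
     (\<forall>i. \<rho> i \<ge> 0 \<and>
          pos_def_on (prims N \<inter> owned N i) (hessian (lagr_loc N i) p + \<rho> i *\<^sub>R mat 1))"

definition compatible_decomposition :: "('k::finite, 'v::finite) nlp \<Rightarrow> real ^ 'k \<Rightarrow> bool" where
  "compatible_decomposition N p \<longleftrightarrow>
     (\<forall>i. rank (grad_matrix N (prims N \<inter> owned N i) ((eqs N \<union> active N p) \<inter> owned N i) p)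
          = card ((eqs N \<union> active N p) \<inter> owned N i))"


section \<open>Local NLPs\<close>

text \<open>The point \<open>(x\<^sub>i + s\<^sub>i, x\<^sub>\<N>\<^sub>i)\<close>.\<close>

definition shift ::
    "('k::finite, 'v::finite) nlp \<Rightarrow> 'v \<Rightarrow> real ^ 'k \<Rightarrow> real ^ 'k \<Rightarrow> real ^ 'k" where
  "shift N i p y = (\<chi> k. if k \<in> prims N \<inter> owned N i then p $ k + y $ k else p $ k)"

definition cost_bar ::
    "('k::finite, 'v::finite) nlp \<Rightarrow> ('v \<Rightarrow> real) \<Rightarrow> 'v \<Rightarrow> real ^ 'k \<Rightarrow> real ^ 'k \<Rightarrow> real" where
  "cost_bar N \<rho> i p y =
     cost N i (shift N i p y)
     + \<rho> i / 2 * (\<Sum>k \<in> prims N \<inter> owned N i. (y $ k)\<^sup>2)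
     + (\<Sum>j \<in> nbrs N i. \<Sum>k \<in> prims N \<inter> owned N i. partial_d k (lagr_loc N j) p * y $ k)"

definition constr_bar ::
    "('k::finite, 'v::finite) nlp \<Rightarrow> 'k \<Rightarrow> real ^ 'k \<Rightarrow> real ^ 'k \<Rightarrow> real" where
  "constr_bar N k p y = constr N k (shift N (owner N k) p y)"

definition lagr_bar ::
    "('k::finite, 'v::finite) nlp \<Rightarrow> ('v \<Rightarrow> real) \<Rightarrow> 'v \<Rightarrow> real ^ 'k \<Rightarrow> real ^ 'k \<Rightarrow> real" where
  "lagr_bar N \<rho> i p y =
     cost_bar N \<rho> i p y + (\<Sum>k \<in> eqs N \<inter> owned N i. y $ k * constr_bar N k p y)
                        + (\<Sum>k \<in> ineqs N \<inter> owned N i. y $ k * constr_bar N k p y)"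

definition local_kkt ::
    "('k::finite, 'v::finite) nlp \<Rightarrow> ('v \<Rightarrow> real) \<Rightarrow> real ^ 'k \<Rightarrow> real ^ 'k \<Rightarrow> bool" where
  "local_kkt N \<rho> p y \<longleftrightarrow>
     (\<forall>k \<in> prims N. partial_d k (lagr_bar N \<rho> (owner N k) p) y = 0) \<and>
     (\<forall>k \<in> eqs N. constr_bar N k p y = 0) \<and>
     (\<forall>k \<in> ineqs N. constr_bar N k p y \<le> 0 \<and> y $ k \<ge> 0 \<and> y $ k * constr_bar N k p y = 0)"

text \<open>\<open>d(p) = (0, \<lambda>, \<mu>)\<close>\<close>

definition dual_part :: "('k::finite, 'v::finite) nlp \<Rightarrow> real ^ 'k \<Rightarrow> real ^ 'k" where
  "dual_part N p = (\<chi> k. if k \<in> prims N then 0 else p $ k)"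

text \<open>
  Near \<open>p\<^sup>*\<close>, the map \<open>\<Phi>\<close> is the locally unique branch of solutions of the local KKT systems
  through \<open>(0, \<lambda>\<^sup>*, \<mu>\<^sup>*)\<close>. Away from \<open>p\<^sup>*\<close> its values are arbitrary.
\<close>

definition local_solution_map ::
    "('k::finite, 'v::finite) nlp \<Rightarrow> ('v \<Rightarrow> real) \<Rightarrow> real ^ 'k \<Rightarrow> (real ^ 'k \<Rightarrow> real ^ 'k) \<Rightarrow> bool"
  where
  "local_solution_map N \<rho> ps \<Phi> \<longleftrightarrow>
     \<Phi> ps = dual_part N ps \<and>
     (\<exists>\<delta>>0. \<exists>\<epsilon>>0. \<forall>p \<in> ball ps \<delta>.
        \<Phi> p \<in> ball (dual_part N ps) \<epsilon> \<and>
        (\<forall>y \<in> ball (dual_part N ps) \<epsilon>. local_kkt N \<rho> p y \<longleftrightarrow> y = \<Phi> p))"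


section \<open>The algorithm\<close>

text \<open>\<open>P\<^sub>i(y\<^sub>i)\<close>, formed at \<open>p\<close>\<close>

definition P_diag :: "('k::finite, 'v::finite) nlp \<Rightarrow> ('v \<Rightarrow> real) \<Rightarrow> real \<Rightarrow> 'v
    \<Rightarrow> real ^ 'k \<Rightarrow> real ^ 'k \<Rightarrow> real ^ 'k ^ 'k" where
  "P_diag N \<rho> \<beta> i p y = (\<chi> a b.
     if a \<in> owned N i \<and> b \<in> owned N i then
       (case (kind_of N a, kind_of N b) of
          (Primal, Primal) \<Rightarrow> partial_d a (partial_d b (lagr_bar N \<rho> i p)) y
        | (Primal, Equality) \<Rightarrow> partial_d a (constr_bar N b p) y
        | (Primal, Inequality) \<Rightarrow> partial_d a (constr_bar N b p) y
        | (Equality, Primal) \<Rightarrow> - \<beta> * partial_d b (constr_bar N a p) y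
        | (Inequality, Primal) \<Rightarrow> - \<beta> * y $ a * partial_d b (constr_bar N a p) y
        | (Inequality, Inequality) \<Rightarrow> if a = b then - \<beta> * constr_bar N a p y else 0
        | _ \<Rightarrow> 0)
     else 0)"

text \<open>\<open>P\<^sub>i\<^sub>j(y\<^sub>j)\<close>, formed at \<open>p\<close>\<close>

definition P_coup :: "('k::finite, 'v::finite) nlp \<Rightarrow> real \<Rightarrow> 'v \<Rightarrow> 'v
    \<Rightarrow> real ^ 'k \<Rightarrow> real ^ 'k \<Rightarrow> real ^ 'k ^ 'k" where
  "P_coup N \<gamma> i j p y = (\<chi> a b.
     if a \<in> prims N \<inter> owned N i \<and> b \<in> prims N \<inter> owned N j then
       \<gamma> * ((\<Sum>k \<in> eqs N \<inter> owned N j.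
               partial_d a (constr N k) (shift N j p y) * partial_d b (constr N k) (shift N j p y))
          + (\<Sum>k \<in> ineqs N \<inter> owned N j.
               partial_d a (constr N k) (shift N j p y) * (y $ k)\<^sup>2
                 * partial_d b (constr N k) (shift N j p y)))
     else 0)"

text \<open>
  Stacked over all agents. The zero padding makes the product of \<open>P\<^sub>i\<close> with the full vector equal
  to its product with agent \<open>i\<close>'s part, and that of \<open>P\<^sub>i\<^sub>j\<close> with \<open>y\<close> equal to its product with
  \<open>s\<^sub>j\<close>.
\<close>

definition sbdp_step :: "('k::finite, 'v::finite) nlp \<Rightarrow> ('v \<Rightarrow> real)
    \<Rightarrow> (real ^ 'k \<Rightarrow> real ^ 'k) \<Rightarrow> real \<Rightarrow> real \<Rightarrow> real \<Rightarrow> real ^ 'k \<Rightarrow> real ^ 'k" where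
  "sbdp_step N \<rho> \<Phi> \<alpha> \<beta> \<gamma> p =
     p + \<alpha> *\<^sub>R (\<Sum>i\<in>UNIV. P_diag N \<rho> \<beta> i p (\<Phi> p) *v (\<Phi> p - dual_part N p)
                        + (\<Sum>j \<in> insert i (nbrs N i). P_coup N \<gamma> i j p (\<Phi> p) *v \<Phi> p))"

definition sbdp :: "('k::finite, 'v::finite) nlp \<Rightarrow> ('v \<Rightarrow> real)
    \<Rightarrow> (real ^ 'k \<Rightarrow> real ^ 'k) \<Rightarrow> real \<Rightarrow> real \<Rightarrow> real \<Rightarrow> real ^ 'k \<Rightarrow> nat \<Rightarrow> real ^ 'k" where
  "sbdp N \<rho> \<Phi> \<alpha> \<beta> \<gamma> p0 q = (sbdp_step N \<rho> \<Phi> \<alpha> \<beta> \<gamma> ^^ q) p0"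


section \<open>The iteration matrix and weighted norms\<close>

definition A_matrix ::
    "('k::finite, 'v::finite) nlp \<Rightarrow> real \<Rightarrow> real \<Rightarrow> real ^ 'k \<Rightarrow> real ^ 'k ^ 'k" where
  "A_matrix N \<beta> \<gamma> p = (\<chi> a b.
     (case (kind_of N a, kind_of N b) of
        (Primal, Primal) \<Rightarrow> partial_d a (partial_d b (lagr N)) p
          + \<gamma> * ((\<Sum>k \<in> eqs N. partial_d a (constr N k) p * partial_d b (constr N k) p)
               + (\<Sum>k \<in> ineqs N. partial_d a (constr N k) p * (p $ k)\<^sup>2 * partial_d b (constr N k) p))
      | (Primal, Equality) \<Rightarrow> partial_d a (constr N b) p
      | (Primal, Inequality) \<Rightarrow> partial_d a (constr N b) p
      | (Equality, Primal) \<Rightarrow> - \<beta> * partial_d b (constr N a) p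
      | (Inequality, Primal) \<Rightarrow> - \<beta> * p $ a * partial_d b (constr N a) p
      | (Inequality, Inequality) \<Rightarrow> if a = b then - \<beta> * constr N a p else 0
      | _ \<Rightarrow> 0))"

definition sym_pos_def :: "real ^ 'k ^ 'k::finite \<Rightarrow> bool" where
  "sym_pos_def W \<longleftrightarrow> transpose W = W \<and> pos_def_on UNIV W"

definition wnorm :: "real ^ 'k ^ 'k::finite \<Rightarrow> real ^ 'k \<Rightarrow> real" where
  "wnorm W v = sqrt (v \<bullet> (W *v v))"

text \<open>Induced matrix norm; the quotient is \<open>0\<close> at \<open>v = 0\<close>, as in \<^const>\<open>onorm\<close>.\<close>

definition wnorm_mat :: "real ^ 'k ^ 'k::finite \<Rightarrow> real ^ 'k ^ 'k \<Rightarrow> real" where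
  "wnorm_mat W B = (SUP v. wnorm W (B *v v) / wnorm W v)"

end

theory Submission
  imports Defs
begin

text \<open>
  One iteration is \<open>p + \<alpha> D(p)\<close> with a direction \<open>D\<close> that does not depend on \<open>\<alpha>\<close>. The theorem
  holds because \<open>D\<close> vanishes at the KKT point \<open>p\<^sup>*\<close>, is differentiable there with derivative
  \<open>-A(p\<^sup>*)\<close> (\<open>direction_derivative\<close>), and \<open>-A(p\<^sup>*)\<close> is stable for large \<open>\<gamma>\<close>. The
  iteration is then an explicit Euler discretization of a locally exponentially stable flow.

  The derivative. Near \<open>p\<^sup>*\<close> strict complementarity turns the stacked local KKT systems into a square
  system \<open>K(p, y) = 0\<close> (\<open>local_kkt_iff_residual\<close>). Its partial derivative in \<open>y\<close> is
  the block diagonal matrix \<open>J\<close> of the \<open>P\<^sub>i\<close>; it is invertible by the local convexity and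
  decomposition assumptions, so that \<open>\<Phi>\<close> is given by the implicit function theorem. Moreover
  \<open>K(p, d(p))\<close> is the central KKT residual, because at zero step the local Lagrangian gradients add up
  to the central one. The first part of \<open>D\<close> has derivative
  \<open>J (\<Phi>' e - d e) = K'(e, \<Phi>' e) - K'(e, d e) = - K'(e, d e)\<close>, that is, \<open>-A\<close> for
  \<open>\<gamma> = 0\<close>. The coupling terms contribute \<open>- \<gamma> R e\<close>, because the linearized local
  constraints express the primal part of \<open>\<Phi>' e\<close> through \<open>e\<close> (\<open>coup_linearized\<close>).

  Stability. Debreu's lemma (\<open>pos_def_penalty\<close>) makes the primal block of \<open>A\<close> positive definite on
  the whole space for large \<open>\<gamma>\<close>. Up to positive row scalings, the rest of \<open>A\<close> is skew in the binding
  constraints and diagonal in the inactive ones, which gives an explicit symmetric positive definite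
  \<open>P\<close> with \<open>v \<bullet> P A v \<ge> c \<bar>v\<bar>\<^sup>2\<close> (\<open>saddle_lyapunov\<close>). The same lemma, applied to \<open>J\<close>,
  yields its invertibility.

  Convergence. In the form \<open>P\<close> a step contracts by \<open>1 - \<alpha> k\<close> (\<open>euler_step\<close>) on a ball whose radius
  is the same for all small \<open>\<alpha>\<close>. The same estimate for \<open>I - \<alpha> A\<close> shows that its powers tend to
  zero, from which the discrete Lyapunov equation is solved (\<open>discrete_lyapunov\<close>).
\<close>

section \<open>Calculus of smooth functions\<close>

lemma partial_d_eq:
  assumes "(F has_derivative F') (at x)"
  shows "partial_d k F x = F' (axis k 1)"
  using assms frechet_derivative_at[OF assms] by (simp add: partial_d_def)

lemma has_derivative_partials:
  assumes "F differentiable (at x)"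
  shows "(F has_derivative (\<lambda>h. \<Sum>k\<in>UNIV. h $ k * partial_d k F x)) (at x)"
proof -
  have D: "(F has_derivative frechet_derivative F (at x)) (at x)"
    using assms by (simp add: frechet_derivative_works)
  then interpret bounded_linear "frechet_derivative F (at x)"
    by (rule has_derivative_bounded_linear)
  have "frechet_derivative F (at x) h = (\<Sum>k\<in>UNIV. h $ k * partial_d k F x)" for h
  proof -
    have "frechet_derivative F (at x) h = frechet_derivative F (at x) (\<Sum>k\<in>UNIV. h $ k *\<^sub>R axis k 1)"
      using basis_expansion[of h] by (simp add: scalar_mult_eq_scaleR)
    also have "\<dots> = (\<Sum>k\<in>UNIV. h $ k * partial_d k F x)"
      by (simp add: sum scaleR partial_d_def)
    finally show ?thesis .
  qed
  then show ?thesis using D by (metis (no_types, lifting) ext)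
qed

lemma C_k_has_derivative:
  "C_k (Suc l) F \<Longrightarrow> (F has_derivative (\<lambda>h. \<Sum>k\<in>UNIV. h $ k * partial_d k F x)) (at x)"
  by (rule has_derivative_partials) simp

lemma C_k_SucD: "C_k (Suc l) F \<Longrightarrow> C_k l F"
proof (induction l arbitrary: F)
  case 0
  then show ?case
    by (auto intro!: differentiable_imp_continuous_on simp: differentiable_on_def
        intro: differentiable_at_imp_differentiable_on)
next
  case (Suc l)
  then show ?case by auto
qed

lemma C_k_mono: "C_k l F \<Longrightarrow> l' \<le> l \<Longrightarrow> C_k l' F"
proof (induction l)
  case (Suc l)
  then show ?case using C_k_SucD by (metis le_Suc_eq)
qed simp

lemma C_k_isCont: "C_k l F \<Longrightarrow> isCont F x"
  using C_k_mono[of l F 0] by (simp add: continuous_on_eq_continuous_at)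

lemma partial_d_const: "partial_d k (\<lambda>x. c) = (\<lambda>x. 0)"
  by (rule ext) (rule partial_d_eq[OF has_derivative_const])

lemma C_k_const: "C_k l (\<lambda>x. c)"
  by (induction l arbitrary: c) (simp_all add: partial_d_const)

lemma has_derivative_nth: "((\<lambda>x::real^'k. x $ k) has_derivative (\<lambda>h. h $ k)) (at x)"
  by (simp add: bounded_linear_imp_has_derivative bounded_linear_vec_nth)

lemma partial_d_nth: "partial_d a (\<lambda>x::real^'k. x $ k) = (\<lambda>x. if a = k then 1 else 0)"
  by (rule ext) (simp add: partial_d_eq[OF has_derivative_nth] axis_def)

lemma C_k_nth: "C_k l (\<lambda>x::real^'k. x $ k)"
proof (cases l)
  case 0
  then show ?thesis by (auto intro: continuous_intros)
next
  case (Suc n)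
  then show ?thesis
    using has_derivative_nth by (auto simp: partial_d_nth C_k_const differentiable_def)
qed

lemma partial_d_add:
  assumes "F differentiable (at x)" "G differentiable (at x)"
  shows "partial_d k (\<lambda>x. F x + G x) x = partial_d k F x + partial_d k G x"
  using partial_d_eq[OF has_derivative_add] assms
  by (simp add: partial_d_def frechet_derivative_works)

lemma partial_d_mult:
  assumes "F differentiable (at x)" "G differentiable (at x)"
  shows "partial_d k (\<lambda>x. F x * G x) x = F x * partial_d k G x + partial_d k F x * G x"
  using partial_d_eq[OF has_derivative_mult] assms
  by (simp add: partial_d_def frechet_derivative_works)

lemma C_k_add: "C_k l F \<Longrightarrow> C_k l G \<Longrightarrow> C_k l (\<lambda>x. F x + G x)"
proof (induction l arbitrary: F G)
  case 0
  then show ?case by (auto intro: continuous_intros)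
next
  case (Suc l)
  then have "partial_d k (\<lambda>x. F x + G x) = (\<lambda>x. partial_d k F x + partial_d k G x)" for k
    by (intro ext partial_d_add) auto
  with Suc show ?case by simp
qed

lemma C_k_mult: "C_k l F \<Longrightarrow> C_k l G \<Longrightarrow> C_k l (\<lambda>x. F x * G x)"
proof (induction l arbitrary: F G)
  case 0
  then show ?case by (auto intro: continuous_intros)
next
  case (Suc l)
  then have "partial_d k (\<lambda>x. F x * G x) = (\<lambda>x. F x * partial_d k G x + partial_d k F x * G x)" for k
    by (intro ext partial_d_mult) auto
  with Suc C_k_SucD[OF Suc.prems(1)] C_k_SucD[OF Suc.prems(2)] show ?case
    by (simp add: C_k_add)
qed

lemma C_k_sum: "(\<And>i. i \<in> I \<Longrightarrow> C_k l (F i)) \<Longrightarrow> C_k l (\<lambda>x. \<Sum>i\<in>I. F i x)"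
  by (induction I rule: infinite_finite_induct) (auto intro: C_k_const C_k_add)

lemma partial_d_sum:
  assumes "\<And>i. i \<in> I \<Longrightarrow> F i differentiable (at x)"
  shows "partial_d k (\<lambda>x. \<Sum>i\<in>I. F i x) x = (\<Sum>i\<in>I. partial_d k (F i) x)"
proof -
  have "((\<lambda>x. \<Sum>i\<in>I. F i x) has_derivative
        (\<lambda>h. \<Sum>i\<in>I. frechet_derivative (F i) (at x) h)) (at x)"
    by (intro has_derivative_sum) (use assms in \<open>simp add: frechet_derivative_works\<close>)
  from partial_d_eq[OF this] show ?thesis by (simp add: partial_d_def)
qed

lemma partial_d_eq_0:
  assumes "depends_only_on S F" "k \<notin> S" and diff: "F differentiable (at x)"
  shows "partial_d k F x = 0"
proof -
  have "((\<lambda>t. F (x + t *\<^sub>R axis k 1)) has_derivative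
      (\<lambda>t. \<Sum>j\<in>UNIV. (t *\<^sub>R axis k (1::real)) $ j * partial_d j F x)) (at (0::real))"
    by (rule has_derivative_compose[where g = F and f = "\<lambda>t. x + t *\<^sub>R axis k 1"])
      (auto intro!: derivative_eq_intros has_derivative_partials diff)
  moreover have "(\<lambda>t. F (x + t *\<^sub>R axis k 1)) = (\<lambda>t. F x)"
  proof
    fix t
    have "\<forall>j\<in>S. (x + t *\<^sub>R axis k 1) $ j = x $ j"
      using assms(2) by (auto simp: axis_def)
    then show "F (x + t *\<^sub>R axis k 1) = F x"
      using assms(1) unfolding depends_only_on_def by blast
  qed
  ultimately have "((\<lambda>t::real. F x) has_derivative
      (\<lambda>t. \<Sum>j\<in>UNIV. (t *\<^sub>R axis k (1::real)) $ j * partial_d j F x)) (at 0)"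
    by simp
  from has_derivative_unique[OF this has_derivative_const] have
    "(\<Sum>j\<in>UNIV. (1 *\<^sub>R axis k (1::real)) $ j * partial_d j F x) = 0"
    by metis
  then show ?thesis by (simp add: axis_def if_distrib[of "\<lambda>z. z * _"] sum.delta cong: if_cong)
qed

text \<open>
  The second difference of \<open>F\<close> in two coordinate directions is symmetric in the directions, and two
  applications of the mean value theorem express it by a mixed second partial derivative nearby.
\<close>

lemma second_difference:
  fixes F :: "real ^ 'k \<Rightarrow> real"
  assumes "C_k 2 F" "t > 0"
  obtains \<xi> where "norm (\<xi> - x) \<le> 2 * t"
    "F (x + t *\<^sub>R axis a 1 + t *\<^sub>R axis b 1) - F (x + t *\<^sub>R axis a 1) - F (x + t *\<^sub>R axis b 1) + F x
      = t * t * partial_d a (partial_d b F) \<xi>"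
proof -
  have line: "((\<lambda>s. G (y + s *\<^sub>R axis k 1)) has_real_derivative partial_d k G (y + s *\<^sub>R axis k 1)) (at s)"
    if "C_k (Suc 0) G" for G :: "real ^ 'k \<Rightarrow> real" and y k s
  proof -
    have "((\<lambda>s. G (y + s *\<^sub>R axis k 1)) has_derivative
        (\<lambda>h. \<Sum>j\<in>UNIV. (h *\<^sub>R axis k (1::real)) $ j * partial_d j G (y + s *\<^sub>R axis k 1))) (at s)"
      by (rule has_derivative_compose[where g = G and f = "\<lambda>t. y + t *\<^sub>R axis k 1"])
        (auto intro!: derivative_eq_intros C_k_has_derivative[OF that])
    moreover have "(\<Sum>j\<in>UNIV. (h *\<^sub>R axis k (1::real)) $ j * partial_d j G (y + s *\<^sub>R axis k 1))
        = partial_d k G (y + s *\<^sub>R axis k 1) * h" for h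
      by (simp add: axis_def if_distrib[of "\<lambda>z. z * _"] if_distrib[of "\<lambda>z. _ * z"] sum.delta cong: if_cong)
    ultimately show ?thesis unfolding has_field_derivative_def by simp
  qed
  have C1: "C_k (Suc 0) F" and C2: "C_k (Suc 0) (partial_d b F)"
    using C_k_mono[OF assms(1), of "Suc 0"] assms(1) by (simp_all add: numeral_2_eq_2)
  let ?\<phi> = "\<lambda>s. F (x + t *\<^sub>R axis a 1 + s *\<^sub>R axis b 1) - F (x + s *\<^sub>R axis b 1)"
  obtain s where s: "0 < s" "s < t" "?\<phi> t - ?\<phi> 0 =
      (t - 0) * (partial_d b F (x + t *\<^sub>R axis a 1 + s *\<^sub>R axis b 1) - partial_d b F (x + s *\<^sub>R axis b 1))"
    using MVT2[of 0 t ?\<phi> "\<lambda>s. partial_d b F (x + t *\<^sub>R axis a 1 + s *\<^sub>R axis b 1)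
        - partial_d b F (x + s *\<^sub>R axis b 1)"]
      assms(2) DERIV_diff[OF line[OF C1] line[OF C1]] by blast
  obtain r where r: "0 < r" "r < t" "partial_d b F (x + s *\<^sub>R axis b 1 + t *\<^sub>R axis a 1)
      - partial_d b F (x + s *\<^sub>R axis b 1 + 0 *\<^sub>R axis a 1)
      = (t - 0) * partial_d a (partial_d b F) (x + s *\<^sub>R axis b 1 + r *\<^sub>R axis a 1)"
    using MVT2[of 0 t "\<lambda>r. partial_d b F (x + s *\<^sub>R axis b 1 + r *\<^sub>R axis a 1)"
        "\<lambda>r. partial_d a (partial_d b F) (x + s *\<^sub>R axis b 1 + r *\<^sub>R axis a 1)"]
      assms(2) line[OF C2] by blast
  show thesis
  proof (rule that[of "x + s *\<^sub>R axis b 1 + r *\<^sub>R axis a 1"])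
    have "norm (s *\<^sub>R axis b 1 + r *\<^sub>R axis a (1::real)) \<le> \<bar>s\<bar> + \<bar>r\<bar>"
      by (rule norm_triangle_le) simp
    then show "norm (x + s *\<^sub>R axis b 1 + r *\<^sub>R axis a 1 - x) \<le> 2 * t"
      using s r by (simp add: algebra_simps)
    have "F (x + t *\<^sub>R axis a 1 + t *\<^sub>R axis b 1) - F (x + t *\<^sub>R axis a 1) - F (x + t *\<^sub>R axis b 1) + F x
        = ?\<phi> t - ?\<phi> 0" by simp
    also have "\<dots> = t * (partial_d b F (x + s *\<^sub>R axis b 1 + t *\<^sub>R axis a 1)
      - partial_d b F (x + s *\<^sub>R axis b 1 + 0 *\<^sub>R axis a 1))"
      using s(3) by (simp add: algebra_simps)
    finally show "F (x + t *\<^sub>R axis a 1 + t *\<^sub>R axis b 1) - F (x + t *\<^sub>R axis a 1) - F (x + t *\<^sub>R axis b 1) + F x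
      = t * t * partial_d a (partial_d b F) (x + s *\<^sub>R axis b 1 + r *\<^sub>R axis a 1)"
      unfolding r(3) by simp
  qed
qed

text \<open>
  Symmetry of second derivatives. It is needed because the Hessians in the definitions list the two
  differentiations in the order opposite to that of a Jacobian of the gradient.
\<close>

lemma partial_d_commute:
  fixes F :: "real ^ 'k \<Rightarrow> real"
  assumes "C_k 2 F"
  shows "partial_d a (partial_d b F) x = partial_d b (partial_d a F) x"
proof -
  let ?t = "\<lambda>n. 1 / real (Suc n)"
  have lim: "\<exists>\<xi>. \<forall>n. norm (\<xi> n - x) \<le> 2 * ?t n \<and>
      F (x + ?t n *\<^sub>R axis a 1 + ?t n *\<^sub>R axis b 1)
      - F (x + ?t n *\<^sub>R axis a 1) - F (x + ?t n *\<^sub>R axis b 1) + F x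
      = ?t n * ?t n * partial_d a (partial_d b F) (\<xi> n)" for a b
    by (rule choice) (metis second_difference[OF assms] of_nat_0_less_iff zero_less_Suc zero_less_divide_1_iff)
  have tends: "\<xi> \<longlonglongrightarrow> x" if "\<forall>n. norm (\<xi> n - x) \<le> 2 * ?t n" for \<xi> :: "nat \<Rightarrow> real ^ 'k"
  proof (rule LIM_zero_cancel, rule tendsto_norm_zero_cancel,
      rule tendsto_sandwich[of "\<lambda>_. 0" _ _ "\<lambda>n. 2 * ?t n"])
    show "(\<lambda>n. 2 * ?t n) \<longlonglongrightarrow> 0"
      using tendsto_mult_left[OF LIMSEQ_inverse_real_of_nat, of 2] by (simp add: divide_inverse)
  qed (use that in auto)
  have cont: "isCont (partial_d a (partial_d b F)) x" for a b
    using assms by (auto simp: numeral_2_eq_2 continuous_on_eq_continuous_at)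
  from lim[of a b] obtain \<xi> where
    \<xi>: "\<And>n. norm (\<xi> n - x) \<le> 2 * ?t n"
      "\<And>n. F (x + ?t n *\<^sub>R axis a 1 + ?t n *\<^sub>R axis b 1)
      - F (x + ?t n *\<^sub>R axis a 1) - F (x + ?t n *\<^sub>R axis b 1) + F x
      = ?t n * ?t n * partial_d a (partial_d b F) (\<xi> n)"
    by blast
  from lim[of b a] obtain \<eta> where
    \<eta>: "\<And>n. norm (\<eta> n - x) \<le> 2 * ?t n"
      "\<And>n. F (x + ?t n *\<^sub>R axis b 1 + ?t n *\<^sub>R axis a 1)
      - F (x + ?t n *\<^sub>R axis b 1) - F (x + ?t n *\<^sub>R axis a 1) + F x
      = ?t n * ?t n * partial_d b (partial_d a F) (\<eta> n)"
    by blast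
  have same: "partial_d a (partial_d b F) (\<xi> n) = partial_d b (partial_d a F) (\<eta> n)" for n
  proof -
    have "x + t *\<^sub>R axis a 1 + t *\<^sub>R axis b 1 = x + t *\<^sub>R axis b 1 + t *\<^sub>R axis a 1" for t :: real
      by (simp add: algebra_simps)
    note comm = this[of "?t n"]
    have
      "?t n * ?t n * partial_d a (partial_d b F) (\<xi> n)
      = ?t n * ?t n * partial_d b (partial_d a F) (\<eta> n)"
      unfolding \<xi>(2)[symmetric] \<eta>(2)[symmetric] by (subst comm) (simp only: add.commute diff_diff_eq)
    then show ?thesis by simp
  qed
  have "(\<lambda>n. partial_d a (partial_d b F) (\<xi> n)) \<longlonglongrightarrow> partial_d a (partial_d b F) x"
    by (rule isCont_tendsto_compose[OF cont tends]) (use \<xi>(1) in blast)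
  moreover have "(\<lambda>n. partial_d a (partial_d b F) (\<xi> n)) \<longlonglongrightarrow> partial_d b (partial_d a F) x"
    unfolding same by (rule isCont_tendsto_compose[OF cont tends]) (use \<eta>(1) in blast)
  ultimately show ?thesis by (rule LIMSEQ_unique)
qed

section \<open>Strict differentiability and implicit functions\<close>

text \<open>
  Strict differentiability at a point: the increment between any two nearby points is linear up to a
  small relative error. It follows from continuity of the partial derivatives, passes to sums and to
  compositions with linear maps, and is the estimate that makes Newton-like maps contractions.
\<close>

definition strict_derivative ::
    "('a::real_normed_vector \<Rightarrow> 'b::real_normed_vector) \<Rightarrow> ('a \<Rightarrow> 'b) \<Rightarrow> 'a \<Rightarrow> bool" where
  "strict_derivative F F' a \<longleftrightarrow> bounded_linear F' \<and>
     (\<forall>c>0. \<forall>\<^sub>F (u, v) in nhds (a, a). norm (F u - F v - F' (u - v)) \<le> c * norm (u - v))"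

lemma strict_derivativeD:
  "strict_derivative F F' a \<Longrightarrow> c > 0 \<Longrightarrow>
    \<forall>\<^sub>F (u, v) in nhds (a, a). norm (F u - F v - F' (u - v)) \<le> c * norm (u - v)"
  by (simp add: strict_derivative_def)

lemma dist_Pair_le: "dist (u, v) (a, b) \<le> dist u a + dist v b"
  unfolding dist_Pair_Pair by (rule order_trans[OF sqrt_add_le_add_sqrt]) auto

lemma strict_derivative_ball:
  assumes "strict_derivative F F' a" "c > 0"
  obtains d where "d > 0"
    "\<And>u v. dist u a < d \<Longrightarrow> dist v a < d \<Longrightarrow> norm (F u - F v - F' (u - v)) \<le> c * norm (u - v)"
proof -
  from strict_derivativeD[OF assms] obtain d where d: "d > 0"
    "\<And>u v. dist (u, v) (a, a) < d \<Longrightarrow> norm (F u - F v - F' (u - v)) \<le> c * norm (u - v)"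
    unfolding eventually_nhds_metric by auto
  show thesis
  proof (rule that[of "d / 2"])
    fix u v assume "dist u a < d / 2" "dist v a < d / 2"
    moreover have "dist (u, v) (a, a) \<le> dist u a + dist v a"
      by (rule dist_Pair_le)
    ultimately show "norm (F u - F v - F' (u - v)) \<le> c * norm (u - v)" by (intro d) simp
  qed (use d in simp)
qed

lemma strict_derivative_imp_has_derivative:
  assumes "strict_derivative F F' a"
  shows "(F has_derivative F') (at a)"
  unfolding has_derivative_at_alt
proof (intro conjI allI impI)
  show "bounded_linear F'" using assms by (simp add: strict_derivative_def)
  fix e :: real assume "e > 0"
  from strict_derivative_ball[OF assms this] obtain d where "d > 0"
    "\<And>u v. dist u a < d \<Longrightarrow> dist v a < d \<Longrightarrow> norm (F u - F v - F' (u - v)) \<le> e * norm (u - v)"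
    by blast
  then show "\<exists>d>0. \<forall>y. norm (y - a) < d \<longrightarrow> norm (F y - F a - F' (y - a)) \<le> e * norm (y - a)"
    by (intro exI[of _ d]) (auto simp: dist_norm)
qed

lemma strict_derivative_linear: "bounded_linear F \<Longrightarrow> strict_derivative F F a"
  by (auto simp: strict_derivative_def linear_simps intro!: always_eventually)

lemma strict_derivative_add:
  assumes "strict_derivative F F' a" "strict_derivative G G' a"
  shows "strict_derivative (\<lambda>x. F x + G x) (\<lambda>h. F' h + G' h) a"
  unfolding strict_derivative_def
proof (intro conjI allI impI)
  show "bounded_linear (\<lambda>h. F' h + G' h)"
    using assms by (simp add: strict_derivative_def bounded_linear_add)
  fix c :: real assume "c > 0"
  then have "c / 2 > 0" by simp
  show "\<forall>\<^sub>F (u, v) in nhds (a, a). norm (F u + G u - (F v + G v) - (F' (u - v) + G' (u - v))) \<le> c * norm (u - v)"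
    using strict_derivativeD[OF assms(1) \<open>c / 2 > 0\<close>] strict_derivativeD[OF assms(2) \<open>c / 2 > 0\<close>]
  proof eventually_elim
    case (elim uv)
    obtain u v where [simp]: "uv = (u, v)" by fastforce
    have "norm (F u + G u - (F v + G v) - (F' (u - v) + G' (u - v)))
        = norm ((F u - F v - F' (u - v)) + (G u - G v - G' (u - v)))"
      by (simp add: algebra_simps)
    also have "\<dots> \<le> c / 2 * norm (u - v) + c / 2 * norm (u - v)"
      using elim by (intro norm_triangle_le add_mono) auto
    finally show ?case by (simp add: algebra_simps)
  qed
qed

lemma strict_derivative_sum:
  assumes "\<And>i. i \<in> I \<Longrightarrow> strict_derivative (F i) (F' i) a"
  shows "strict_derivative (\<lambda>x. \<Sum>i\<in>I. F i x) (\<lambda>h. \<Sum>i\<in>I. F' i h) a"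
  using assms
  by (induction I rule: infinite_finite_induct)
    (auto intro: strict_derivative_add strict_derivative_linear bounded_linear_zero)

lemma strict_derivative_compose_linear:
  assumes "bounded_linear L" "strict_derivative F F' (L a)"
  shows "strict_derivative (\<lambda>x. F (L x)) (\<lambda>h. F' (L h)) a"
  unfolding strict_derivative_def
proof (intro conjI allI impI)
  interpret L: bounded_linear L by fact
  show "bounded_linear (\<lambda>h. F' (L h))"
    using assms by (auto simp: strict_derivative_def intro: bounded_linear_compose)
  fix c :: real assume "c > 0"
  obtain B where B: "B > 0" "\<And>x. norm (L x) \<le> norm x * B" using L.pos_bounded by blast
  have "c / B > 0" using \<open>c > 0\<close> B by simp
  have "LIM x nhds (a, a). (L (fst x), L (snd x)) :> nhds (L a, L a)"
    by (intro tendsto_intros L.tendsto filterlim_ident[of "nhds (a, a)", THEN tendsto_fst, simplified]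
        filterlim_ident[of "nhds (a, a)", THEN tendsto_snd, simplified])
  from eventually_compose_filterlim[OF strict_derivativeD[OF assms(2) \<open>c / B > 0\<close>] this]
  show "\<forall>\<^sub>F (u, v) in nhds (a, a). norm (F (L u) - F (L v) - F' (L (u - v))) \<le> c * norm (u - v)"
  proof eventually_elim
    case (elim uv)
    obtain u v where [simp]: "uv = (u, v)" by fastforce
    have "norm (F (L u) - F (L v) - F' (L (u - v))) \<le> c / B * norm (L (u - v))"
      using elim by (simp add: L.diff)
    also have "\<dots> \<le> c / B * (norm (u - v) * B)"
      using B \<open>c > 0\<close> by (intro mult_left_mono) auto
    finally show ?case using B by simp
  qed
qed

lemma strict_derivative_vec:
  fixes F :: "'a::real_normed_vector \<Rightarrow> real ^ 'k"
  assumes "\<And>k. strict_derivative (\<lambda>x. F x $ k) (\<lambda>h. F' h $ k) a"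
  shows "strict_derivative F F' a"
  unfolding strict_derivative_def
proof (intro conjI allI impI)
  show "bounded_linear F'"
  proof -
    have "bounded_linear (\<lambda>h. \<Sum>k\<in>UNIV. F' h $ k *\<^sub>R axis k (1::real))"
      using assms by (auto simp: strict_derivative_def
          intro!: bounded_linear_sum bounded_linear_compose[OF bounded_linear_scaleR_left])
    then show ?thesis by (simp add: basis_expansion flip: scalar_mult_eq_scaleR)
  qed
  fix c :: real assume "c > 0"
  then have c: "c / CARD('k) > 0" by simp
  have "\<forall>\<^sub>F x in nhds (a, a). \<forall>k\<in>UNIV.
      (case x of (u, v) \<Rightarrow> norm (F u $ k - F v $ k - F' (u - v) $ k) \<le> c / CARD('k) * norm (u - v))"
    by (rule eventually_ball_finite) (use strict_derivativeD[OF assms c] in auto)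
  then show "\<forall>\<^sub>F (u, v) in nhds (a, a). norm (F u - F v - F' (u - v)) \<le> c * norm (u - v)"
  proof eventually_elim
    case (elim uv)
    obtain u v where [simp]: "uv = (u, v)" by fastforce
    have "norm (F u - F v - F' (u - v)) \<le> (\<Sum>k\<in>UNIV. \<bar>(F u - F v - F' (u - v)) $ k\<bar>)"
      by (rule norm_le_l1_cart)
    also have "\<dots> \<le> (\<Sum>k\<in>(UNIV::'k set). c / CARD('k) * norm (u - v))"
      using elim by (intro sum_mono) auto
    finally show ?case by simp
  qed
qed

lemma C_k_strict_derivative:
  fixes F :: "real ^ 'k \<Rightarrow> real"
  assumes "C_k (Suc 0) F"
  shows "strict_derivative F (\<lambda>h. \<Sum>k\<in>UNIV. h $ k * partial_d k F a) a"
  unfolding strict_derivative_def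
proof (intro conjI allI impI)
  let ?D = "\<lambda>x h. \<Sum>k\<in>UNIV. h $ k * partial_d k F x"
  have D: "(F has_derivative ?D x) (at x)" for x by (rule C_k_has_derivative[OF assms])
  show lin: "bounded_linear (?D a)" using D by (rule has_derivative_bounded_linear)
  fix c :: real assume "c > 0"
  then have c: "c / CARD('k) > 0" by simp
  have "\<forall>\<^sub>F x in nhds a. \<forall>k\<in>UNIV. dist (partial_d k F x) (partial_d k F a) < c / CARD('k)"
  proof (rule eventually_ball_finite)
    have "((\<lambda>x. partial_d k F x) \<longlongrightarrow> partial_d k F a) (nhds a)" for k
      using assms by (simp add: continuous_on_eq_continuous_at isCont_def tendsto_at_iff_tendsto_nhds)
    then show "\<forall>k\<in>UNIV. \<forall>\<^sub>F x in nhds a. dist (partial_d k F x) (partial_d k F a) < c / CARD('k)"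
      using c by (auto simp: tendsto_iff)
  qed simp
  then obtain d where d: "d > 0"
    "\<And>x k. dist x a < d \<Longrightarrow> dist (partial_d k F x) (partial_d k F a) < c / CARD('k)"
    unfolding eventually_nhds_metric by auto
  have est: "norm (F u - F v - ?D a (u - v)) \<le> c * norm (u - v)"
    if "u \<in> ball a d" "v \<in> ball a d" for u v
  proof -
    have "norm ((F u - ?D a u) - (F v - ?D a v)) \<le> c * norm (u - v)"
    proof (rule differentiable_bound[OF convex_ball[of a d] _ _ that])
      fix x assume x: "x \<in> ball a d"
      show "((\<lambda>x. F x - ?D a x) has_derivative (\<lambda>h. ?D x h - ?D a h)) (at x within ball a d)"
        by (intro has_derivative_diff has_derivative_at_withinI[OF D]
            bounded_linear_imp_has_derivative lin)
      show "onorm (\<lambda>h. ?D x h - ?D a h) \<le> c"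
      proof (rule onorm_le)
        fix h :: "real ^ 'k"
        have "norm (?D x h - ?D a h) = \<bar>\<Sum>k\<in>UNIV. h $ k * (partial_d k F x - partial_d k F a)\<bar>"
          by (simp add: sum_subtractf algebra_simps)
        also have "\<dots> \<le> (\<Sum>k\<in>(UNIV::'k set). norm h * (c / CARD('k)))"
        proof (rule sum_abs[THEN order_trans], rule sum_mono)
          fix k
          have "\<bar>partial_d k F x - partial_d k F a\<bar> \<le> c / CARD('k)"
            using d(2)[of x k] x by (simp add: dist_real_def dist_commute)
          then show "\<bar>h $ k * (partial_d k F x - partial_d k F a)\<bar> \<le> norm h * (c / CARD('k))"
            unfolding abs_mult by (intro mult_mono component_le_norm_cart) auto
        qed
        finally show "norm (?D x h - ?D a h) \<le> c * norm h" by (simp add: mult.commute)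
      qed
    qed
    moreover have "?D a (u - v) = ?D a u - ?D a v" by (rule linear_simps[OF lin])
    ultimately show ?thesis by (simp add: algebra_simps)
  qed
  have "\<forall>\<^sub>F x in nhds (a, a). x \<in> ball a d \<times> ball a d"
    by (rule eventually_nhds_in_open) (use d in \<open>auto intro: open_Times\<close>)
  then show "\<forall>\<^sub>F (u, v) in nhds (a, a). norm (F u - F v - ?D a (u - v)) \<le> c * norm (u - v)"
    by eventually_elim (use est in auto)
qed

text \<open>
  Implicit function theorem. The solution for given \<open>p\<close> is the fixed point of the chord Newton map
  \<open>y \<mapsto> y - J\<inverse> K(p, y)\<close>, where \<open>J\<close> is the partial derivative in \<open>y\<close> at the base point: strict
  differentiability makes this a contraction of a small ball, uniformly in \<open>p\<close>.
\<close>

lemma implicit_function: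
  fixes K :: "'a::real_normed_vector \<times> 'b::euclidean_space \<Rightarrow> 'b"
  assumes strict: "strict_derivative K K' (a, b)" and zero: "K (a, b) = 0"
    and inj: "\<And>h. K' (0, h) = 0 \<Longrightarrow> h = 0"
  obtains \<phi> \<phi>' \<delta> \<epsilon> where "\<delta> > 0" "\<epsilon> > 0" "\<phi> a = b" "(\<phi> has_derivative \<phi>') (at a)"
    "\<And>e. K' (e, \<phi>' e) = 0"
    "\<And>p y. p \<in> ball a \<delta> \<Longrightarrow> y \<in> ball b \<epsilon> \<Longrightarrow> K (p, y) = 0 \<longleftrightarrow> y = \<phi> p"
    "\<And>p. p \<in> ball a \<delta> \<Longrightarrow> \<phi> p \<in> ball b \<epsilon>"
proof -
  have blK: "bounded_linear K'" using strict by (simp add: strict_derivative_def)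
  interpret K': bounded_linear K' by (rule blK)
  define J where "J h = K' (0, h)" for h
  have linJ: "linear J"
    unfolding J_def
    by (rule bounded_linear.linear[OF bounded_linear_compose[OF blK]])
      (intro bounded_linear_Pair bounded_linear_zero bounded_linear_ident)
  have "inj J" using inj by (simp add: linear_injective_0[OF linJ] J_def)
  then obtain Ji where linJi: "linear Ji" and Ji: "\<And>x. Ji (J x) = x" "\<And>x. J (Ji x) = x"
    using linear_injective_isomorphism[OF linJ] by auto
  obtain B where B: "B > 0" "\<And>x. norm (Ji x) \<le> B * norm x"
    using linear_bounded_pos[OF linJi] by blast
  obtain M where M: "M > 0" "\<And>x. norm (K' x) \<le> norm x * M" using K'.pos_bounded by blast
  have split: "K' (h, k) = K' (h, 0) + J k" for h k
    using K'.add[of "(h, 0)" "(0, k)"] by (simp add: J_def)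
  \<comment> \<open>This linearization error gives the chord Newton map the contraction factor \<open>1 / 2\<close>.\<close>
  define c where "c = 1 / (2 * B)"
  have c: "c > 0" using B by (simp add: c_def)
  obtain d where d: "d > 0" "\<And>u v. dist u (a, b) < d \<Longrightarrow> dist v (a, b) < d
      \<Longrightarrow> norm (K u - K v - K' (u - v)) \<le> c * norm (u - v)"
    using strict_derivative_ball[OF strict c] by blast
  define \<epsilon> where "\<epsilon> = d / 4"
  define L where "L = 2 * B * (M + c)"
  have L: "L > 0" using B M c by (simp add: L_def)
  define \<delta> where "\<delta> = min (d / 4) (\<epsilon> / L)"
  have \<epsilon>: "\<epsilon> > 0" and \<delta>: "\<delta> > 0" using d L by (auto simp: \<epsilon>_def \<delta>_def)
  have near: "dist (p, y) (a, b) < d" if "p \<in> ball a \<delta>" "y \<in> cball b \<epsilon>" for p y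
  proof -
    have "dist (p, y) (a, b) \<le> dist p a + dist y b"
      by (rule dist_Pair_le)
    also have "\<dots> < d" using that d by (auto simp: \<delta>_def \<epsilon>_def dist_commute)
    finally show ?thesis .
  qed
  define T where "T p y = y - Ji (K (p, y))" for p y
  have fixT: "T p y = y \<longleftrightarrow> K (p, y) = 0" for p y
    using Ji(2)[of "K (p, y)"] linear_0[OF linJi] linear_0[OF linJ] by (auto simp: T_def)
  have contr: "norm (T p y - T p z) \<le> norm (y - z) / 2"
    if "p \<in> ball a \<delta>" "y \<in> cball b \<epsilon>" "z \<in> cball b \<epsilon>" for p y z
  proof -
    have "norm (K (p, y) - K (p, z) - J (y - z)) \<le> c * norm (y - z)"
      using d(2)[OF near[OF that(1,2)] near[OF that(1,3)]] by (simp add: J_def norm_Pair)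
    moreover have "T p y - T p z = - Ji (K (p, y) - K (p, z) - J (y - z))"
      by (simp add: T_def linear_diff[OF linJi] Ji)
    ultimately have "norm (T p y - T p z) \<le> B * (c * norm (y - z))"
      using B(2)[of "K (p, y) - K (p, z) - J (y - z)"] B(1)
      by (smt (verit) mult_left_mono norm_minus_cancel)
    then show ?thesis using B by (simp add: c_def)
  qed
  have base: "norm (T p b - b) \<le> L / 2 * norm (p - a)" if "p \<in> ball a \<delta>" for p
  proof -
    have "norm (K (p, b) - K (a, b) - K' (p - a, 0)) \<le> c * norm (p - a)"
      using d(2)[OF near[OF that, of b] near[of a b]] \<epsilon> \<delta> by (simp add: norm_Pair)
    moreover have "norm (K' (p - a, 0)) \<le> norm (p - a) * M"
      using M(2)[of "(p - a, 0)"] by (simp add: norm_Pair)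
    ultimately have "norm (K (p, b)) \<le> (M + c) * norm (p - a)"
      using zero norm_triangle_sub[of "K (p, b)" "K' (p - a, 0)"] by (simp add: algebra_simps)
    then have "norm (Ji (K (p, b))) \<le> B * ((M + c) * norm (p - a))"
      using B by (meson order_trans mult_left_mono less_imp_le)
    then show ?thesis by (simp add: T_def L_def algebra_simps)
  qed
  have small: "L * norm (p - a) < \<epsilon>" if "p \<in> ball a \<delta>" for p
  proof -
    have "norm (p - a) < \<epsilon> / L" using that by (simp add: \<delta>_def dist_norm norm_minus_commute)
    then show ?thesis using L by (simp add: field_simps)
  qed
  have loc: "norm (y - b) \<le> L * norm (p - a)"
    if "p \<in> ball a \<delta>" "y \<in> cball b \<epsilon>" "K (p, y) = 0" for p y
  proof -
    have "norm (y - b) \<le> norm (T p y - T p b) + norm (T p b - b)"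
      using fixT[of p y] that(3) norm_triangle_ineq[of "T p y - T p b" "T p b - b"] by simp
    also have "\<dots> \<le> norm (y - b) / 2 + L / 2 * norm (p - a)"
      using contr[OF that(1,2), of b] base[OF that(1)] \<epsilon> by (intro add_mono) auto
    finally show ?thesis by simp
  qed
  have ex: "\<exists>!y. y \<in> cball b \<epsilon> \<and> K (p, y) = 0" if p: "p \<in> ball a \<delta>" for p
  proof -
    have "\<exists>!y\<in>cball b \<epsilon>. T p y = y"
    proof (rule Banach_fix[where c = "1/2"])
      show "complete (cball b \<epsilon>)" by (simp add: complete_eq_closed)
      show "cball b \<epsilon> \<noteq> {}" using \<epsilon> by simp
      show "T p ` cball b \<epsilon> \<subseteq> cball b \<epsilon>"
      proof (rule image_subsetI)
        fix y assume y: "y \<in> cball b \<epsilon>"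
        have "norm (T p y - b) \<le> norm (T p y - T p b) + norm (T p b - b)"
          using norm_triangle_ineq[of "T p y - T p b" "T p b - b"] by simp
        also have "\<dots> \<le> norm (y - b) / 2 + L / 2 * norm (p - a)"
          using contr[OF p y, of b] base[OF p] \<epsilon> by (intro add_mono) auto
        also have "\<dots> \<le> \<epsilon>"
          using y small[OF p] by (simp add: dist_norm norm_minus_commute)
        finally show "T p y \<in> cball b \<epsilon>" by (simp add: dist_norm norm_minus_commute)
      qed
      show "dist (T p y) (T p z) \<le> 1 / 2 * dist y z" if "y \<in> cball b \<epsilon>" "z \<in> cball b \<epsilon>" for y z
        using contr[OF p that] by (simp add: dist_norm)
    qed auto
    then show ?thesis by (simp add: fixT)
  qed
  define \<phi> where "\<phi> p = (THE y. y \<in> cball b \<epsilon> \<and> K (p, y) = 0)" for p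
  have \<phi>: "\<phi> p \<in> cball b \<epsilon>" "K (p, \<phi> p) = 0" if "p \<in> ball a \<delta>" for p
    using theI'[OF ex[OF that]] by (auto simp: \<phi>_def)
  have uniq: "K (p, y) = 0 \<longleftrightarrow> y = \<phi> p" if "p \<in> ball a \<delta>" "y \<in> cball b \<epsilon>" for p y
    using ex[OF that(1)] \<phi>[OF that(1)] that(2) by blast
  have lip: "norm (\<phi> p - b) \<le> L * norm (p - a)" if "p \<in> ball a \<delta>" for p
    using loc[OF that] \<phi>[OF that] by blast
  define \<phi>' where "\<phi>' e = - Ji (K' (e, 0))" for e
  have bl: "bounded_linear \<phi>'"
    unfolding \<phi>'_def
    by (rule bounded_linear_minus[OF bounded_linear_compose[OF linJi[unfolded linear_conv_bounded_linear]
          bounded_linear_compose[OF blK bounded_linear_Pair[OF bounded_linear_ident bounded_linear_zero]]]])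
  have \<phi>a: "\<phi> a = b" using uniq[of a b] \<delta> \<epsilon> zero by simp
  show thesis
  proof (rule that[where \<delta> = \<delta> and \<epsilon> = \<epsilon> and \<phi> = \<phi> and \<phi>' = \<phi>', OF \<delta> \<epsilon> \<phi>a])
    show "K' (e, \<phi>' e) = 0" for e
      by (subst split) (simp add: \<phi>'_def linear_neg[OF linJ] Ji)
    show "\<phi> p \<in> ball b \<epsilon>" if "p \<in> ball a \<delta>" for p
      using lip[OF that] small[OF that] by (simp add: dist_norm norm_minus_commute)
    show "K (p, y) = 0 \<longleftrightarrow> y = \<phi> p" if "p \<in> ball a \<delta>" "y \<in> ball b \<epsilon>" for p y
      using uniq that by simp
    show "(\<phi> has_derivative \<phi>') (at a)"
      unfolding has_derivative_at_alt
    proof (intro conjI bl allI impI)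
      fix e :: real assume "e > 0"
      define c1 where "c1 = e / (B * (1 + L))"
      have "c1 > 0" using \<open>e > 0\<close> B L by (simp add: c1_def)
      with strict_derivative_imp_has_derivative[OF strict] obtain d1 where d1: "d1 > 0"
        "\<And>y. norm (y - (a, b)) < d1 \<Longrightarrow> norm (K y - K (a, b) - K' (y - (a, b))) \<le> c1 * norm (y - (a, b))"
        unfolding has_derivative_at_alt by blast
      show "\<exists>d>0. \<forall>p. norm (p - a) < d \<longrightarrow> norm (\<phi> p - \<phi> a - \<phi>' (p - a)) \<le> e * norm (p - a)"
      proof (intro exI[of _ "min \<delta> (d1 / (1 + L))"] conjI allI impI)
        show "0 < min \<delta> (d1 / (1 + L))" using \<delta> d1 L by simp
        fix p assume p: "norm (p - a) < min \<delta> (d1 / (1 + L))"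
        then have p': "p \<in> ball a \<delta>" by (simp add: dist_norm norm_minus_commute)
        have n: "norm ((p, \<phi> p) - (a, b)) \<le> (1 + L) * norm (p - a)"
          using norm_Pair_le[of "p - a" "\<phi> p - b"] lip[OF p'] by (simp add: algebra_simps)
        also have "\<dots> < d1" using p L by (simp add: field_simps)
        finally have "norm (K' (p - a, \<phi> p - b)) \<le> c1 * norm ((p, \<phi> p) - (a, b))"
          using d1(2)[of "(p, \<phi> p)"] \<phi>(2)[OF p'] zero by simp
        also have "\<dots> \<le> c1 * ((1 + L) * norm (p - a))"
          using n \<open>c1 > 0\<close> by (intro mult_left_mono) auto
        finally have "B * norm (K' (p - a, \<phi> p - b)) \<le> B * (c1 * ((1 + L) * norm (p - a)))"
          using B by (intro mult_left_mono) auto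
        moreover have "\<phi> p - \<phi> a - \<phi>' (p - a) = Ji (K' (p - a, \<phi> p - b))"
          by (subst split) (simp add: \<phi>a \<phi>'_def linear_add[OF linJi] Ji)
        ultimately have "norm (\<phi> p - \<phi> a - \<phi>' (p - a)) \<le> B * (c1 * ((1 + L) * norm (p - a)))"
          using B(2)[of "K' (p - a, \<phi> p - b)"] by simp
        also have "\<dots> = e * norm (p - a)" using B L by (simp add: c1_def)
        finally show "norm (\<phi> p - \<phi> a - \<phi>' (p - a)) \<le> e * norm (p - a)" .
      qed
    qed
  qed
qed

section \<open>Quadratic forms and Lyapunov matrices\<close>

text \<open>
  Compactness of the unit sphere turns positivity of a form into a quadratic lower bound.
\<close>

lemma homogeneous_pos_bound:
  fixes f :: "real ^ 'k \<Rightarrow> real"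
  assumes cont: "continuous_on UNIV f" and hom: "\<And>c z. f (c *\<^sub>R z) = c\<^sup>2 * f z"
    and pos: "\<And>z. z \<noteq> 0 \<Longrightarrow> \<forall>k. k \<notin> S \<longrightarrow> z $ k = 0 \<Longrightarrow> f z > 0"
  obtains w where "w > 0" "\<And>z. \<forall>k. k \<notin> S \<longrightarrow> z $ k = 0 \<Longrightarrow> w * (norm z)\<^sup>2 \<le> f z"
proof -
  let ?U = "{z :: real ^ 'k. \<forall>k. k \<notin> S \<longrightarrow> z $ k = 0}"
  let ?K = "sphere 0 1 \<inter> ?U"
  have "closed ?U"
    by (intro closed_Collect_all closed_Collect_imp closed_Collect_eq continuous_intros) auto
  then have "compact ?K" by (intro compact_Int_closed) auto
  obtain w where w: "w > 0" "\<And>z. z \<in> ?K \<Longrightarrow> w \<le> f z"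
  proof (cases "?K = {}")
    case True
    then show ?thesis using that[of 1] by auto
  next
    case False
    have "continuous_on ?K f" using cont continuous_on_subset by blast
    from continuous_attains_inf[OF \<open>compact ?K\<close> False this]
    obtain z where "z \<in> ?K" "\<forall>y\<in>?K. f z \<le> f y" by blast
    then show ?thesis using that[of "f z"] pos[of z] by fastforce
  qed
  show thesis
  proof (rule that[OF w(1)])
    fix z :: "real ^ 'k" assume z: "\<forall>k. k \<notin> S \<longrightarrow> z $ k = 0"
    show "w * (norm z)\<^sup>2 \<le> f z"
    proof (cases "z = 0")
      case True
      then show ?thesis using hom[of 0 0] by simp
    next
      case False
      have "w \<le> f ((1 / norm z) *\<^sub>R z)" using z False by (intro w) auto
      then show ?thesis using False by (simp add: hom power_divide field_simps)
    qed
  qed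
qed

lemma quadratic_form_sum:
  fixes M :: "real ^ 'n ^ 'n"
  shows "z \<bullet> (M *v z) = (\<Sum>a\<in>UNIV. \<Sum>b\<in>UNIV. z $ a * M $ a $ b * z $ b)"
  by (simp add: inner_vec_def matrix_vector_mult_def sum_distrib_left mult.assoc)

lemma pos_def_on_bound:
  assumes "pos_def_on S W"
  obtains w where "w > 0" "\<And>z. \<forall>k. k \<notin> S \<longrightarrow> z $ k = 0 \<Longrightarrow> w * (norm z)\<^sup>2 \<le> z \<bullet> (W *v z)"
proof (rule homogeneous_pos_bound[of "\<lambda>z. z \<bullet> (W *v z)" S])
  show "continuous_on UNIV (\<lambda>z. z \<bullet> (W *v z))"
    by (intro continuous_intros linear_continuous_on matrix_vector_mul_bounded_linear)
  show "c *\<^sub>R z \<bullet> (W *v (c *\<^sub>R z)) = c\<^sup>2 * (z \<bullet> (W *v z))" for c z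
    by (simp add: matrix_vector_mult_scaleR power2_eq_square)
  show "z \<noteq> 0 \<Longrightarrow> \<forall>k. k \<notin> S \<longrightarrow> z $ k = 0 \<Longrightarrow> 0 < z \<bullet> (W *v z)" for z
    using assms unfolding pos_def_on_def by blast
qed (use that in blast)

text \<open>
  Debreu's lemma: a form that is positive on the zero set of a nonnegative form \<open>q\<close> becomes
  positive after adding a large multiple of \<open>q\<close>, because \<open>q\<close> is bounded away from zero on the
  compact part of the sphere where the first form is not positive.
\<close>

lemma pos_def_penalty:
  fixes q :: "real ^ 'k \<Rightarrow> real"
  assumes cont: "continuous_on UNIV q" and hom: "\<And>c z. q (c *\<^sub>R z) = c\<^sup>2 * q z"
    and nonneg: "\<And>z. q z \<ge> 0"
    and pos: "\<And>z. z \<noteq> 0 \<Longrightarrow> \<forall>k. k \<notin> S \<longrightarrow> z $ k = 0 \<Longrightarrow> q z = 0 \<Longrightarrow> z \<bullet> (H *v z) > 0"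
  obtains \<gamma>0 where "\<And>\<gamma> z. \<gamma> > \<gamma>0 \<Longrightarrow> z \<noteq> 0 \<Longrightarrow> \<forall>k. k \<notin> S \<longrightarrow> z $ k = 0
      \<Longrightarrow> z \<bullet> (H *v z) + \<gamma> * q z > 0"
proof -
  let ?U = "{z :: real ^ 'k. \<forall>k. k \<notin> S \<longrightarrow> z $ k = 0}"
  let ?K = "sphere 0 1 \<inter> (?U \<inter> {z. z \<bullet> (H *v z) \<le> 0})"
  have contH: "continuous_on UNIV (\<lambda>z. z \<bullet> (H *v z))"
    by (intro continuous_intros linear_continuous_on matrix_vector_mul_bounded_linear)
  have "closed ?U"
    by (intro closed_Collect_all closed_Collect_imp closed_Collect_eq continuous_intros) auto
  moreover have "closed {z. z \<bullet> (H *v z) \<le> 0}"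
    by (intro closed_Collect_le contH continuous_intros)
  ultimately have "compact ?K" by (intro compact_Int_closed closed_Int) auto
  obtain w where w: "w > 0" "\<And>z. z \<in> ?K \<Longrightarrow> w \<le> q z"
  proof (cases "?K = {}")
    case True
    then show ?thesis using that[of 1] by auto
  next
    case False
    have "continuous_on ?K q" using cont continuous_on_subset by blast
    from continuous_attains_inf[OF \<open>compact ?K\<close> False this]
    obtain z where z: "z \<in> ?K" "\<forall>y\<in>?K. q z \<le> q y" by blast
    then have "z \<noteq> 0" by auto
    then have "q z > 0" using z(1) pos[of z] nonneg[of z] by fastforce
    then show ?thesis using that[of "q z"] z(2) by blast
  qed
  obtain B where B: "B > 0" "\<And>z. norm (H *v z) \<le> norm z * B"
    using bounded_linear.pos_bounded[OF matrix_vector_mul_bounded_linear[of H]] by blast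
  show thesis
  proof (rule that[of "B / w"])
    fix \<gamma> :: real and z :: "real ^ 'k" assume \<gamma>: "B / w < \<gamma>" and z: "z \<noteq> 0" "\<forall>k. k \<notin> S \<longrightarrow> z $ k = 0"
    have "\<gamma> > 0" using \<gamma> B w by (smt (verit) divide_pos_pos)
    define y where "y = (1 / norm z) *\<^sub>R z"
    have y: "norm y = 1" "y \<in> ?U" using z by (auto simp: y_def)
    have "y \<bullet> (H *v y) + \<gamma> * q y > 0"
    proof (cases "y \<bullet> (H *v y) > 0")
      case True
      then show ?thesis using nonneg[of y] \<open>\<gamma> > 0\<close> by (simp add: add_pos_nonneg)
    next
      case False
      with y have "w \<le> q y" by (intro w) auto
      have "\<bar>y \<bullet> (H *v y)\<bar> \<le> norm y * norm (H *v y)" by (rule Cauchy_Schwarz_ineq2)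
      also have "\<dots> \<le> B" using B(2)[of y] y by simp
      also have "B < \<gamma> * w" using \<gamma> w by (simp add: field_simps)
      also have "\<gamma> * w \<le> \<gamma> * q y" using \<open>w \<le> q y\<close> \<open>\<gamma> > 0\<close> by simp
      finally show ?thesis by linarith
    qed
    moreover have "y \<bullet> (H *v y) + \<gamma> * q y = (1 / norm z)\<^sup>2 * (z \<bullet> (H *v z) + \<gamma> * q z)"
      by (simp add: y_def hom matrix_vector_mult_scaleR power2_eq_square algebra_simps)
    ultimately show "z \<bullet> (H *v z) + \<gamma> * q z > 0"
      using z(1) by (simp add: zero_less_mult_iff)
  qed
qed

definition restr :: "'k set \<Rightarrow> real ^ 'k \<Rightarrow> real ^ 'k" where
  "restr S v = (\<chi> k. if k \<in> S then v $ k else 0)"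

lemma restr_nth [simp]: "restr S v $ k = (if k \<in> S then v $ k else 0)"
  by (simp add: restr_def)

lemma inner_restr: "restr S u \<bullet> v = (\<Sum>k\<in>S. u $ k * v $ k)"
  by (simp add: inner_vec_def if_distrib[of "\<lambda>z. z * _"] sum.If_cases cong: if_cong)

lemma bounded_linear_restr: "bounded_linear (restr S :: real ^ 'k \<Rightarrow> real ^ 'k)"
  by (intro linear_conv_bounded_linear[THEN iffD1] linearI) (auto simp: vec_eq_iff)

lemma norm_restr_le: "norm (restr S v) \<le> norm v"
  by (rule norm_le_componentwise_cart) simp

text \<open>
  The weights of the Lyapunov function below: \<open>x\<close>, \<open>y\<close> and \<open>w\<close> are the norms of the primal part, the
  binding multipliers and the inactive multipliers. Young's inequality splits the mixed terms into
  squares; those in \<open>x\<close> are absorbed for small \<open>\<epsilon>\<close>, and those in \<open>w\<close> for large \<open>\<kappa>\<close>.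
\<close>

lemma saddle_choice:
  fixes w0 g L h0 D t0 :: real
  assumes pos: "w0 > 0" "g > 0" "L > 0" "h0 > 0" "D > 0" "t0 > 0"
  obtains \<epsilon> \<kappa> c where "\<epsilon> > 0" "\<kappa> \<ge> 1" "c > 0" "2 * \<epsilon> * L \<le> t0 / 2"
    "\<And>x y w. w0 * x\<^sup>2 - L * x * w + \<kappa> * h0 * w\<^sup>2
        + \<epsilon> * (- (D * (L\<^sup>2 * x\<^sup>2)) + (g * y\<^sup>2 - L * y * (L * x + L * w))) \<ge> c * (x\<^sup>2 + y\<^sup>2 + w\<^sup>2)"
proof -
  define N where "N = L^4 / g"
  define \<epsilon> where "\<epsilon> = min (t0 / (4 * L)) (w0 / (4 * (D * L\<^sup>2 + N)))"
  define \<kappa> where "\<kappa> = max 1 ((L\<^sup>2 / w0 + \<epsilon> * N + 1) / h0)"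
  have N: "N > 0" using pos by (simp add: N_def)
  then have \<epsilon>: "\<epsilon> > 0" using pos by (auto simp: \<epsilon>_def intro!: divide_pos_pos add_pos_pos mult_pos_pos)
  have e1: "2 * \<epsilon> * L \<le> t0 / 2"
  proof -
    have "\<epsilon> \<le> t0 / (4 * L)" by (simp add: \<epsilon>_def)
    then show ?thesis using pos by (simp add: field_simps)
  qed
  have e2: "\<epsilon> * (D * L\<^sup>2 + N) \<le> w0 / 4"
  proof -
    have "D * L\<^sup>2 + N > 0" using pos N by (simp add: add_pos_pos)
    moreover have "\<epsilon> \<le> w0 / (4 * (D * L\<^sup>2 + N))" by (simp add: \<epsilon>_def)
    ultimately show ?thesis by (simp add: field_simps)
  qed
  have k: "\<kappa> * h0 \<ge> L\<^sup>2 / w0 + \<epsilon> * N + 1"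
  proof -
    have "(L\<^sup>2 / w0 + \<epsilon> * N + 1) / h0 \<le> \<kappa>" by (simp add: \<kappa>_def)
    then show ?thesis using pos by (simp add: pos_divide_le_eq)
  qed
  define c where "c = min (w0 / 2) (min (\<epsilon> * g / 2) 1)"
  show thesis
  proof (rule that[OF \<epsilon> _ _ e1, of \<kappa> c])
    show "\<kappa> \<ge> 1" by (simp add: \<kappa>_def)
    show "c > 0" using pos \<epsilon> by (simp add: c_def)
    fix x y w :: real
    have young: "a * b \<le> s / 4 * a\<^sup>2 + b\<^sup>2 / s" if "s > 0" for a b s :: real
    proof -
      have "s / 4 * a\<^sup>2 + b\<^sup>2 / s - a * b = (s / 2 * a - b)\<^sup>2 / s"
        using that by (simp add: power2_eq_square field_simps)
      also have "\<dots> \<ge> 0" using that by simp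
      finally show ?thesis by simp
    qed
    have 1: "L * x * w \<le> w0 / 4 * x\<^sup>2 + L\<^sup>2 / w0 * w\<^sup>2"
      using young[OF pos(1), of x "L * w"] by (simp add: power_mult_distrib algebra_simps)
    have 2: "y * (L\<^sup>2 * x) \<le> g / 4 * y\<^sup>2 + N * x\<^sup>2"
      using young[OF pos(2), of y "L\<^sup>2 * x"] by (simp add: power_mult_distrib N_def flip: power_mult)
    have 3: "y * (L\<^sup>2 * w) \<le> g / 4 * y\<^sup>2 + N * w\<^sup>2"
      using young[OF pos(2), of y "L\<^sup>2 * w"] by (simp add: power_mult_distrib N_def flip: power_mult)
    have "\<epsilon> * (y * (L\<^sup>2 * x) + y * (L\<^sup>2 * w)) \<le> \<epsilon> * (g / 4 * y\<^sup>2 + N * x\<^sup>2 + (g / 4 * y\<^sup>2 + N * w\<^sup>2))"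
      using 2 3 \<epsilon> by (intro mult_left_mono add_mono) auto
    moreover have "\<epsilon> * (D * L\<^sup>2 + N) * x\<^sup>2 \<le> w0 / 4 * x\<^sup>2"
      by (rule mult_right_mono[OF e2]) simp
    moreover have "(L\<^sup>2 / w0 + \<epsilon> * N + 1) * w\<^sup>2 \<le> \<kappa> * h0 * w\<^sup>2"
      by (rule mult_right_mono[OF k]) simp
    moreover have "c * x\<^sup>2 \<le> w0 / 2 * x\<^sup>2" "c * y\<^sup>2 \<le> \<epsilon> * g / 2 * y\<^sup>2" "c * w\<^sup>2 \<le> 1 * w\<^sup>2"
      by (rule mult_right_mono; simp add: c_def)+
    ultimately show "w0 * x\<^sup>2 - L * x * w + \<kappa> * h0 * w\<^sup>2
        + \<epsilon> * (- (D * (L\<^sup>2 * x\<^sup>2)) + (g * y\<^sup>2 - L * y * (L * x + L * w))) \<ge> c * (x\<^sup>2 + y\<^sup>2 + w\<^sup>2)"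
      using 1 by (simp add: algebra_simps power2_eq_square)
  qed
qed

lemma finite_pos_bounds:
  fixes f :: "'a \<Rightarrow> real"
  assumes "finite S" "\<And>k. k \<in> S \<Longrightarrow> f k > 0"
  obtains m M where "0 < m" "0 < M" "\<And>k. k \<in> S \<Longrightarrow> m \<le> f k \<and> f k \<le> M"
proof (rule that[of "Min (insert 1 (f ` S))" "Max (insert 1 (f ` S))"])
  show "Min (insert 1 (f ` S)) > 0" using assms by simp
  have "1 \<le> Max (insert 1 (f ` S))" using assms by (intro Max_ge) auto
  then show "0 < Max (insert 1 (f ` S))" by simp
  show "Min (insert 1 (f ` S)) \<le> f k \<and> f k \<le> Max (insert 1 (f ` S))" if "k \<in> S" for k
    using assms that by (auto intro: Min_le Max_ge)
qed

text \<open>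
  Write \<open>v = z + a + b\<close> along \<open>X\<close>, \<open>Y\<close>, \<open>Z\<close>. With the diagonal scaling \<open>T\<close> that divides row \<open>k\<close>
  of \<open>Y\<close> by \<open>d k\<close>, the coupling of \<open>z\<close> and \<open>a\<close> becomes skew and cancels from \<open>v \<bullet> T M v\<close>. What
  remains controls \<open>z\<close> and, by a large weight on \<open>Z\<close>, also \<open>b\<close>, but not \<open>a\<close>. The perturbation \<open>\<epsilon> (G + G\<^sup>T)\<close>, with \<open>G\<close> the block of
  \<open>M\<close> with rows in \<open>X\<close> and columns in \<open>Y\<close>, adds \<open>\<epsilon> \<bar>G a\<bar>\<^sup>2\<close>, which controls \<open>a\<close> because \<open>G\<close> has
  full column rank; its other contributions are absorbed for small \<open>\<epsilon>\<close>.
\<close>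

lemma saddle_lyapunov:
  fixes M :: "real ^ 'k ^ 'k"
  assumes part: "X \<union> Y \<union> Z = UNIV" "X \<inter> Y = {}" "X \<inter> Z = {}" "Y \<inter> Z = {}"
    and d: "\<And>k. k \<in> Y \<Longrightarrow> d k > 0"
    and rowY: "\<And>a b. a \<in> Y \<Longrightarrow> M $ a $ b = (if b \<in> X then - d a * M $ b $ a else 0)"
    and rowZ: "\<And>a b. a \<in> Z \<Longrightarrow> a \<noteq> b \<Longrightarrow> M $ a $ b = 0"
    and diagZ: "\<And>a. a \<in> Z \<Longrightarrow> M $ a $ a > 0"
    and pd: "pos_def_on X M"
    and rank: "\<And>v. \<forall>k. k \<notin> Y \<longrightarrow> v $ k = 0 \<Longrightarrow> \<forall>a\<in>X. (M *v v) $ a = 0 \<Longrightarrow> v = 0"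
  obtains P c where "transpose P = P" "c > 0" "\<And>v. c * (norm v)\<^sup>2 \<le> v \<bullet> (P *v v)"
    "\<And>v. c * (norm v)\<^sup>2 \<le> v \<bullet> (P *v (M *v v))"
proof -
  obtain w0 where w0: "w0 > 0" "\<And>z. \<forall>k. k \<notin> X \<longrightarrow> z $ k = 0 \<Longrightarrow> w0 * (norm z)\<^sup>2 \<le> z \<bullet> (M *v z)"
    using pos_def_on_bound[OF pd] by blast
  have contM: "continuous_on UNIV (\<lambda>v. restr X (M *v v))"
    by (rule linear_continuous_on[OF bounded_linear_compose[OF bounded_linear_restr
          matrix_vector_mul_bounded_linear]])
  obtain g where g: "g > 0"
    "\<And>v. \<forall>k. k \<notin> Y \<longrightarrow> v $ k = 0 \<Longrightarrow> g * (norm v)\<^sup>2 \<le> (norm (restr X (M *v v)))\<^sup>2"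
  proof (rule homogeneous_pos_bound[of "\<lambda>v. (norm (restr X (M *v v)))\<^sup>2" Y])
    show "continuous_on UNIV (\<lambda>v. (norm (restr X (M *v v)))\<^sup>2)"
      by (intro continuous_intros contM)
    show "(norm (restr X (M *v (c *\<^sub>R z))))\<^sup>2 = c\<^sup>2 * (norm (restr X (M *v z)))\<^sup>2" for c z
    proof -
      have "restr X (M *v (c *\<^sub>R z)) = c *\<^sub>R restr X (M *v z)"
        by (simp add: vec_eq_iff matrix_vector_mult_scaleR)
      then show ?thesis by (simp add: power_mult_distrib)
    qed
    show "0 < (norm (restr X (M *v z)))\<^sup>2" if "z \<noteq> 0" "\<forall>k. k \<notin> Y \<longrightarrow> z $ k = 0" for z
    proof -
      have "restr X (M *v z) \<noteq> 0" using rank[OF that(2)] that(1) by (auto simp: vec_eq_iff)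
      then show ?thesis by simp
    qed
  qed (use that in blast)
  obtain L1 where L1: "L1 > 0" "\<And>x. norm (M *v x) \<le> norm x * L1"
    using bounded_linear.pos_bounded[OF matrix_vector_mul_bounded_linear[of M]] by blast
  obtain L2 where L2: "L2 > 0" "\<And>x. norm (transpose M *v x) \<le> norm x * L2"
    using bounded_linear.pos_bounded[OF matrix_vector_mul_bounded_linear[of "transpose M"]] by blast
  define L where "L = max L1 L2"
  have L: "L > 0" "norm (M *v x) \<le> L * norm x" "norm (transpose M *v x) \<le> L * norm x" for x
  proof -
    show "L > 0" using L1 by (simp add: L_def)
    have "norm x * L1 \<le> L * norm x" "norm x * L2 \<le> L * norm x"
      unfolding mult.commute[of L] by (rule mult_left_mono; simp add: L_def)+
    then show "norm (M *v x) \<le> L * norm x" "norm (transpose M *v x) \<le> L * norm x"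
      using L1(2)[of x] L2(2)[of x] by linarith+
  qed
  obtain h0 where h0: "h0 > 0" "\<And>k. k \<in> Z \<Longrightarrow> h0 \<le> M $ k $ k"
    using finite_pos_bounds[of Z "\<lambda>k. M $ k $ k"] diagZ by (metis finite)
  obtain D0 D where D: "D0 > 0" "D > 0" "\<And>k. k \<in> Y \<Longrightarrow> D0 \<le> d k \<and> d k \<le> D"
    using finite_pos_bounds[of Y d] d by (metis finite)
  define t0 where "t0 = min 1 (1 / D)"
  have t0: "t0 > 0" using D by (simp add: t0_def)
  obtain \<epsilon> \<kappa> c where choice: "\<epsilon> > 0" "\<kappa> \<ge> 1" "c > 0" "2 * \<epsilon> * L \<le> t0 / 2"
    "\<And>x y w. w0 * x\<^sup>2 - L * x * w + \<kappa> * h0 * w\<^sup>2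
        + \<epsilon> * (- (D * (L\<^sup>2 * x\<^sup>2)) + (g * y\<^sup>2 - L * y * (L * x + L * w))) \<ge> c * (x\<^sup>2 + y\<^sup>2 + w\<^sup>2)"
    using saddle_choice[OF w0(1) g(1) L(1) h0(1) D(2) t0] by blast
  define t where "t k = (if k \<in> X then 1 else if k \<in> Y then 1 / d k else \<kappa>)" for k
  define T :: "real ^ 'k ^ 'k" where "T = (\<chi> a b. if a = b then t a else 0)"
  define G :: "real ^ 'k ^ 'k" where "G = (\<chi> a b. if a \<in> X \<and> b \<in> Y then M $ a $ b else 0)"
  define P where "P = T + \<epsilon> *\<^sub>R (G + transpose G)"
  have Tv: "T *v v = (\<chi> k. t k * v $ k)" for v
    by (simp add: T_def matrix_vector_mult_def vec_eq_iff if_distrib[of "\<lambda>z. z * _"] cong: if_cong)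
  have Gv: "G *v v = restr X (M *v restr Y v)" for v
    by (auto simp: G_def matrix_vector_mult_def vec_eq_iff intro!: sum.cong)
  have Gtv: "transpose G *v v = restr Y (transpose M *v restr X v)" for v
    by (auto simp: G_def transpose_def matrix_vector_mult_def vec_eq_iff intro!: sum.cong)
  have quad: "u \<bullet> (P *v v) = u \<bullet> (T *v v) + \<epsilon> * ((transpose G *v u) \<bullet> v + (G *v u) \<bullet> v)" for u v
  proof -
    have "u \<bullet> (G *v v) = (transpose G *v u) \<bullet> v" "u \<bullet> (transpose G *v v) = (G *v u) \<bullet> v"
      using dot_lmul_matrix[of u G v] dot_lmul_matrix[of u "transpose G" v] by simp_all
    then show ?thesis
      by (simp add: P_def matrix_vector_mult_add_rdistrib inner_add_right flip: scaleR_matrix_vector_assoc)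
  qed
  have tbound: "t k \<ge> t0" for k
    using D(3)[of k] D(1) choice(2) by (auto simp: t_def t0_def min_le_iff_disj intro!: frac_le)
  have nv: "(norm v)\<^sup>2 = (norm (restr X v))\<^sup>2 + (norm (restr Y v))\<^sup>2 + (norm (restr Z v))\<^sup>2" for v :: "real ^ 'k"
  proof -
    have "(norm v)\<^sup>2 = (\<Sum>k\<in>X \<union> Y \<union> Z. v $ k * v $ k)"
      by (simp add: part power2_norm_eq_inner inner_vec_def)
    also have "\<dots> = (\<Sum>k\<in>X. v $ k * v $ k) + (\<Sum>k\<in>Y. v $ k * v $ k) + (\<Sum>k\<in>Z. v $ k * v $ k)"
      using part by (subst sum.union_disjoint; (subst sum.union_disjoint)?) auto
    finally show ?thesis by (simp add: power2_norm_eq_inner inner_restr)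
  qed
  have sumsplit: "(\<Sum>k\<in>UNIV. f k) = (\<Sum>k\<in>X. f k) + (\<Sum>k\<in>Y. f k) + (\<Sum>k\<in>Z. f k)" for f :: "'k \<Rightarrow> real"
    unfolding part(1)[symmetric] using part(2-) by (subst sum.union_disjoint; (subst sum.union_disjoint)?) auto
  show thesis
  proof (rule that[of P "min (t0 / 2) c"])
    show "transpose P = P"
      by (simp add: P_def T_def transpose_def vec_eq_iff)
    show "0 < min (t0 / 2) c" using t0 choice by simp
    fix v :: "real ^ 'k"
    define z a b where "z = restr X v" and "a = restr Y v" and "b = restr Z v"
    have vsum: "v = z + a + b"
      using part by (auto simp: vec_eq_iff z_def a_def b_def)
    have supp: "\<forall>k. k \<notin> X \<longrightarrow> z $ k = 0" "\<forall>k. k \<notin> Y \<longrightarrow> a $ k = 0"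
      by (auto simp: z_def a_def)
    have n: "(norm v)\<^sup>2 = (norm z)\<^sup>2 + (norm a)\<^sup>2 + (norm b)\<^sup>2" unfolding z_def a_def b_def by (rule nv)
    have "t0 * (norm v)\<^sup>2 \<le> v \<bullet> (T *v v)"
    proof -
      have "t0 * (norm v)\<^sup>2 = (\<Sum>k\<in>UNIV. t0 * (v $ k * v $ k))"
        by (simp add: power2_norm_eq_inner inner_vec_def sum_distrib_left)
      also have "\<dots> \<le> (\<Sum>k\<in>UNIV. t k * (v $ k * v $ k))"
        by (intro sum_mono mult_right_mono tbound) simp
      finally show ?thesis by (simp add: Tv inner_vec_def mult.left_commute)
    qed
    moreover have "\<bar>(transpose G *v v) \<bullet> v\<bar> \<le> L * (norm v)\<^sup>2"
    proof -
      have "\<bar>(transpose G *v v) \<bullet> v\<bar> \<le> norm (transpose G *v v) * norm v" by (rule Cauchy_Schwarz_ineq2)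
      also have "norm (transpose G *v v) \<le> norm (transpose M *v restr X v)"
        unfolding Gtv by (rule norm_restr_le)
      also have "\<dots> \<le> L * norm v"
        using L(3)[of "restr X v"] mult_left_mono[OF norm_restr_le[of X v], of L] L(1) by linarith
      finally show ?thesis by (simp add: power2_eq_square mult_right_mono)
    qed
    moreover have "\<bar>(G *v v) \<bullet> v\<bar> \<le> L * (norm v)\<^sup>2"
    proof -
      have "\<bar>(G *v v) \<bullet> v\<bar> \<le> norm (G *v v) * norm v" by (rule Cauchy_Schwarz_ineq2)
      also have "norm (G *v v) \<le> norm (M *v restr Y v)"
        unfolding Gv by (rule norm_restr_le)
      also have "\<dots> \<le> L * norm v"
        using L(2)[of "restr Y v"] mult_left_mono[OF norm_restr_le[of Y v], of L] L(1) by linarith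
      finally show ?thesis by (simp add: power2_eq_square mult_right_mono)
    qed
    ultimately have "v \<bullet> (P *v v) \<ge> t0 * (norm v)\<^sup>2 - \<epsilon> * (L * (norm v)\<^sup>2 + L * (norm v)\<^sup>2)"
      unfolding quad using mult_left_mono[of "- (L * (norm v)\<^sup>2 + L * (norm v)\<^sup>2)"
        "(transpose G *v v) \<bullet> v + (G *v v) \<bullet> v" \<epsilon>] choice(1) by (simp add: abs_le_iff)
    moreover have "(2 * \<epsilon> * L) * (norm v)\<^sup>2 \<le> t0 / 2 * (norm v)\<^sup>2"
      by (rule mult_right_mono[OF choice(4)]) simp
    moreover have "min (t0 / 2) c * (norm v)\<^sup>2 \<le> t0 / 2 * (norm v)\<^sup>2"
      by (rule mult_right_mono) auto
    ultimately show "min (t0 / 2) c * (norm v)\<^sup>2 \<le> v \<bullet> (P *v v)" by (simp add: algebra_simps)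
    have Mv: "M *v v = M *v z + M *v a + M *v b" by (simp add: vsum matrix_vector_right_distrib)
    have MvY: "(M *v v) $ k = - d k * (transpose M *v z) $ k" if "k \<in> Y" for k
    proof -
      have "(M *v v) $ k = (\<Sum>j\<in>UNIV. - d k * (M $ j $ k * z $ j))"
        unfolding matrix_vector_mult_def using rowY[OF that]
        by (auto simp: z_def intro!: sum.cong)
      then show ?thesis by (simp add: matrix_vector_mult_def transpose_def sum_distrib_left)
    qed
    have MvZ: "(M *v v) $ k = M $ k $ k * v $ k" if "k \<in> Z" for k
    proof -
      have "(M *v v) $ k = (\<Sum>j\<in>UNIV. M $ k $ j * v $ j)" by (simp add: matrix_vector_mult_def)
      also have "\<dots> = (\<Sum>j\<in>UNIV. if j = k then M $ k $ k * v $ k else 0)"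
        by (rule sum.cong) (use rowZ[OF that] in auto)
      finally show ?thesis by simp
    qed
    have TM: "v \<bullet> (T *v (M *v v)) \<ge> w0 * (norm z)\<^sup>2 - L * norm z * norm b + \<kappa> * h0 * (norm b)\<^sup>2"
    proof -
      have "v \<bullet> (T *v (M *v v)) = (\<Sum>k\<in>X. v $ k * (M *v v) $ k)
          + (\<Sum>k\<in>Y. v $ k * (1 / d k * (M *v v) $ k)) + (\<Sum>k\<in>Z. v $ k * (\<kappa> * (M *v v) $ k))"
        unfolding Tv inner_vec_def sumsplit using part(2-)
        by (intro arg_cong2[where f = "(+)"] sum.cong) (auto simp: t_def)
      also have "(\<Sum>k\<in>X. v $ k * (M *v v) $ k) = z \<bullet> (M *v v)"
        by (simp add: z_def inner_restr)
      also have "(\<Sum>k\<in>Y. v $ k * (1 / d k * (M *v v) $ k)) = - (a \<bullet> (transpose M *v z))"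
        unfolding a_def inner_restr sum_negf[symmetric]
        by (rule sum.cong) (use d in \<open>auto simp: MvY less_imp_neq[THEN not_sym]\<close>)
      also have "a \<bullet> (transpose M *v z) = z \<bullet> (M *v a)"
        using dot_lmul_matrix[of z M a] by (simp add: inner_commute)
      also have "(\<Sum>k\<in>Z. v $ k * (\<kappa> * (M *v v) $ k)) = \<kappa> * (\<Sum>k\<in>Z. M $ k $ k * (v $ k * v $ k))"
        by (simp add: MvZ sum_distrib_left algebra_simps)
      finally have "v \<bullet> (T *v (M *v v)) = z \<bullet> (M *v z) + z \<bullet> (M *v b)
          + \<kappa> * (\<Sum>k\<in>Z. M $ k $ k * (v $ k * v $ k))"
        by (simp add: Mv inner_add_right)
      moreover have "z \<bullet> (M *v z) \<ge> w0 * (norm z)\<^sup>2" by (rule w0(2)[OF supp(1)])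
      moreover have "\<bar>z \<bullet> (M *v b)\<bar> \<le> L * norm z * norm b"
      proof -
        have "\<bar>z \<bullet> (M *v b)\<bar> \<le> norm z * norm (M *v b)" by (rule Cauchy_Schwarz_ineq2)
        also have "\<dots> \<le> norm z * (L * norm b)" by (intro mult_left_mono L) simp
        finally show ?thesis by (simp add: algebra_simps)
      qed
      moreover have "\<kappa> * h0 * (norm b)\<^sup>2 \<le> \<kappa> * (\<Sum>k\<in>Z. M $ k $ k * (v $ k * v $ k))"
      proof -
        have "h0 * (norm b)\<^sup>2 = (\<Sum>k\<in>Z. h0 * (v $ k * v $ k))"
          by (simp add: power2_norm_eq_inner b_def inner_restr sum_distrib_left)
        also have "\<dots> \<le> (\<Sum>k\<in>Z. M $ k $ k * (v $ k * v $ k))"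
          by (intro sum_mono mult_right_mono h0(2)) auto
        finally show ?thesis using choice(2) by simp
      qed
      ultimately show ?thesis by linarith
    qed
    have cross1: "(transpose G *v v) \<bullet> (M *v v) \<ge> - (D * (L\<^sup>2 * (norm z)\<^sup>2))"
    proof -
      have "(transpose G *v v) \<bullet> (M *v v) = (\<Sum>k\<in>Y. - (d k * ((transpose M *v z) $ k)\<^sup>2))"
        unfolding Gtv inner_restr by (rule sum.cong) (auto simp: MvY z_def power2_eq_square)
      moreover have "(\<Sum>k\<in>Y. d k * ((transpose M *v z) $ k)\<^sup>2) \<le> (\<Sum>k\<in>Y. D * ((transpose M *v z) $ k)\<^sup>2)"
        by (intro sum_mono mult_right_mono) (use D(3) in auto)
      moreover have "(\<Sum>k\<in>Y. D * ((transpose M *v z) $ k)\<^sup>2) = D * (norm (restr Y (transpose M *v z)))\<^sup>2"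
        by (simp add: power2_norm_eq_inner inner_restr sum_distrib_left) (simp add: power2_eq_square)
      moreover have "(norm (restr Y (transpose M *v z)))\<^sup>2 \<le> (L * norm z)\<^sup>2"
        by (intro power_mono order_trans[OF norm_restr_le] L) simp
      then have "D * (norm (restr Y (transpose M *v z)))\<^sup>2 \<le> D * (L\<^sup>2 * (norm z)\<^sup>2)"
        using D(2) by (simp add: power_mult_distrib)
      ultimately show ?thesis by (simp add: sum_negf)
    qed
    have cross2: "(G *v v) \<bullet> (M *v v) \<ge> g * (norm a)\<^sup>2 - L * norm a * (L * norm z + L * norm b)"
    proof -
      let ?u = "restr X (M *v a)"
      have "?u \<bullet> (M *v a) = (norm ?u)\<^sup>2" by (simp add: power2_norm_eq_inner inner_restr)
      then have "(G *v v) \<bullet> (M *v v) = (norm ?u)\<^sup>2 + ?u \<bullet> (M *v z + M *v b)"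
        unfolding Gv a_def[symmetric] Mv by (simp add: inner_add_right)
      moreover have "(norm ?u)\<^sup>2 \<ge> g * (norm a)\<^sup>2" by (rule g(2)[OF supp(2)])
      moreover have "\<bar>?u \<bullet> (M *v z + M *v b)\<bar> \<le> L * norm a * (L * norm z + L * norm b)"
      proof -
        have "\<bar>?u \<bullet> (M *v z + M *v b)\<bar> \<le> norm ?u * norm (M *v z + M *v b)" by (rule Cauchy_Schwarz_ineq2)
        also have "\<dots> \<le> (L * norm a) * (L * norm z + L * norm b)"
          by (intro mult_mono order_trans[OF norm_restr_le] norm_triangle_le add_mono L(2))
            (use L(1) in auto)
        finally show ?thesis .
      qed
      ultimately show ?thesis by linarith
    qed
    have "c * (norm v)\<^sup>2 \<le> w0 * (norm z)\<^sup>2 - L * norm z * norm b + \<kappa> * h0 * (norm b)\<^sup>2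
        + \<epsilon> * (- (D * (L\<^sup>2 * (norm z)\<^sup>2)) + (g * (norm a)\<^sup>2 - L * norm a * (L * norm z + L * norm b)))"
      unfolding n by (rule choice(5))
    also have "\<dots> \<le> v \<bullet> (T *v (M *v v)) + \<epsilon> * ((transpose G *v v) \<bullet> (M *v v) + (G *v v) \<bullet> (M *v v))"
      using TM cross1 cross2 choice(1) by (intro add_mono mult_left_mono) auto
    also have "\<dots> = v \<bullet> (P *v (M *v v))" by (simp add: quad)
    finally have "c * (norm v)\<^sup>2 \<le> v \<bullet> (P *v (M *v v))" .
    moreover have "min (t0 / 2) c * (norm v)\<^sup>2 \<le> c * (norm v)\<^sup>2"
      by (rule mult_right_mono) auto
    ultimately show "min (t0 / 2) c * (norm v)\<^sup>2 \<le> v \<bullet> (P *v (M *v v))" by linarith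
  qed
qed

text \<open>
  If \<open>P\<close> is a Lyapunov matrix for the flow of \<open>-A\<close>, a step of length \<open>\<alpha>\<close> in a direction close
  to \<open>-A e\<close> decreases \<open>e \<bullet> P e\<close> by a factor \<open>1 - \<alpha> k\<close>. Both the linear term of the decrease and the
  error of the direction are proportional to \<open>\<alpha>\<close>, so the admissible error \<open>\<eta>\<close>, and with it the
  radius of convergence, does not shrink with \<open>\<alpha>\<close>.
\<close>

lemma euler_step:
  fixes P A :: "real ^ 'k ^ 'k"
  assumes symP: "transpose P = P" and c: "c > 0" "\<And>v. c * (norm v)\<^sup>2 \<le> v \<bullet> (P *v v)"
    "\<And>v. c * (norm v)\<^sup>2 \<le> v \<bullet> (P *v (A *v v))"
  obtains \<alpha>0 \<eta> k where "\<alpha>0 > 0" "\<eta> > 0" "k > 0" "\<And>\<alpha>. \<alpha> < \<alpha>0 \<Longrightarrow> 0 < 1 - \<alpha> * k"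
    "\<And>\<alpha> e f. 0 < \<alpha> \<Longrightarrow> \<alpha> < \<alpha>0 \<Longrightarrow> norm (f + A *v e) \<le> \<eta> * norm e \<Longrightarrow>
      (e + \<alpha> *\<^sub>R f) \<bullet> (P *v (e + \<alpha> *\<^sub>R f)) \<le> (1 - \<alpha> * k) * (e \<bullet> (P *v e))"
proof -
  obtain L1 where L1: "L1 > 0" "\<And>x. norm (P *v x) \<le> norm x * L1"
    using bounded_linear.pos_bounded[OF matrix_vector_mul_bounded_linear[of P]] by blast
  obtain L2 where L2: "L2 > 0" "\<And>x. norm (A *v x) \<le> norm x * L2"
    using bounded_linear.pos_bounded[OF matrix_vector_mul_bounded_linear[of A]] by blast
  \<comment> \<open>The error \<open>\<eta>\<close> of the direction uses up half of the decrease \<open>2 c\<close>, and the bound on \<open>\<alpha>\<close> lets the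
    quadratic term use up half of the rest.\<close>
  define \<eta> where "\<eta> = c / (2 * L1)"
  define k where "k = c / (2 * L1)"
  define N where "N = L1 * (L2 + \<eta>)\<^sup>2"
  have pos: "\<eta> > 0" "k > 0" using c L1 by (auto simp: \<eta>_def k_def)
  then have N: "N > 0" using L1 L2 by (simp add: N_def)
  define \<alpha>0 where "\<alpha>0 = min (1 / k) (c / (2 * N))"
  show thesis
  proof (rule that[of \<alpha>0 \<eta> k])
    show "\<alpha>0 > 0" using pos N c by (simp add: \<alpha>0_def)
    show "0 < 1 - \<alpha> * k" if "\<alpha> < \<alpha>0" for \<alpha>
      using that pos by (simp add: \<alpha>0_def field_simps)
    fix \<alpha> :: real and e f :: "real ^ 'k"
    assume \<alpha>: "0 < \<alpha>" "\<alpha> < \<alpha>0" and f: "norm (f + A *v e) \<le> \<eta> * norm e"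
    have symdot: "f \<bullet> (P *v e) = e \<bullet> (P *v f)"
      using dot_lmul_matrix[of f P e] transpose_matrix_vector[of P f] symP by (simp add: inner_commute)
    have "\<bar>e \<bullet> (P *v (f + A *v e))\<bar> \<le> norm e * norm (P *v (f + A *v e))"
      by (rule Cauchy_Schwarz_ineq2)
    also have "\<dots> \<le> norm e * ((\<eta> * norm e) * L1)"
      using L1 by (intro mult_left_mono order_trans[OF L1(2)] mult_right_mono f) auto
    also have "\<dots> = c / 2 * (norm e)\<^sup>2" using L1 by (simp add: \<eta>_def power2_eq_square)
    finally have "\<bar>e \<bullet> (P *v f) + e \<bullet> (P *v (A *v e))\<bar> \<le> c / 2 * (norm e)\<^sup>2"
      by (simp only: matrix_vector_right_distrib inner_add_right)
    then have lin: "e \<bullet> (P *v f) \<le> - (c / 2) * (norm e)\<^sup>2"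
      using c(3)[of e] unfolding abs_le_iff by (simp add: field_simps)
    have "norm f \<le> norm (f + A *v e) + norm (A *v e)"
      using norm_triangle_ineq4[of "f + A *v e" "A *v e"] by simp
    also have "\<dots> \<le> (L2 + \<eta>) * norm e" using f L2(2)[of e] by (simp add: algebra_simps)
    finally have nf: "norm f \<le> (L2 + \<eta>) * norm e" .
    have "f \<bullet> (P *v f) \<le> norm f * norm (P *v f)" by (rule norm_cauchy_schwarz)
    also have "\<dots> \<le> norm f * (norm f * L1)" by (intro mult_left_mono L1) simp
    also have "\<dots> = L1 * (norm f)\<^sup>2" by (simp add: power2_eq_square)
    also have "\<dots> \<le> L1 * ((L2 + \<eta>) * norm e)\<^sup>2"
      using L1 nf by (intro mult_left_mono power_mono) auto
    finally have quad: "f \<bullet> (P *v f) \<le> N * (norm e)\<^sup>2" by (simp add: N_def power_mult_distrib)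
    have "e \<bullet> (P *v e) \<le> norm e * norm (P *v e)" by (rule norm_cauchy_schwarz)
    also have "\<dots> \<le> norm e * (norm e * L1)" by (intro mult_left_mono L1) simp
    finally have up: "e \<bullet> (P *v e) \<le> L1 * (norm e)\<^sup>2" by (simp add: power2_eq_square ac_simps)
    have "(e + \<alpha> *\<^sub>R f) \<bullet> (P *v (e + \<alpha> *\<^sub>R f))
        = e \<bullet> (P *v e) + 2 * \<alpha> * (e \<bullet> (P *v f)) + \<alpha> * \<alpha> * (f \<bullet> (P *v f))"
      by (simp add: matrix_vector_right_distrib matrix_vector_mult_scaleR inner_add_left inner_add_right
          symdot algebra_simps)
    also have "\<dots> \<le> e \<bullet> (P *v e) + 2 * \<alpha> * (- (c / 2) * (norm e)\<^sup>2) + \<alpha> * \<alpha> * (N * (norm e)\<^sup>2)"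
      using lin quad \<alpha> by (intro add_mono mult_left_mono) auto
    also have "\<alpha> * \<alpha> * (N * (norm e)\<^sup>2) \<le> \<alpha> * (c / 2 * (norm e)\<^sup>2)"
    proof -
      have "\<alpha> \<le> c / (2 * N)" using \<alpha> by (simp add: \<alpha>0_def)
      then have "\<alpha> * N \<le> c / 2" using N by (simp add: field_simps)
      then have "\<alpha> * N * (\<alpha> * (norm e)\<^sup>2) \<le> c / 2 * (\<alpha> * (norm e)\<^sup>2)"
        using \<alpha> by (intro mult_right_mono) auto
      then show ?thesis by (simp add: algebra_simps)
    qed
    also have "e \<bullet> (P *v e) + 2 * \<alpha> * (- (c / 2) * (norm e)\<^sup>2) + \<alpha> * (c / 2 * (norm e)\<^sup>2)
        = e \<bullet> (P *v e) - \<alpha> * k * (L1 * (norm e)\<^sup>2)"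
      using L1 by (simp add: k_def field_simps)
    also have "\<dots> \<le> (1 - \<alpha> * k) * (e \<bullet> (P *v e))"
      using mult_left_mono[OF up, of "\<alpha> * k"] \<alpha> pos by (simp add: algebra_simps)
    finally show "(e + \<alpha> *\<^sub>R f) \<bullet> (P *v (e + \<alpha> *\<^sub>R f)) \<le> (1 - \<alpha> * k) * (e \<bullet> (P *v e))" by simp
  qed (use pos in auto)
qed

lemma matrix_eq_iff_bilinear:
  fixes X Y :: "real ^ 'k ^ 'k"
  shows "X = Y \<longleftrightarrow> (\<forall>u v. u \<bullet> (X *v v) = u \<bullet> (Y *v v))"
  by (metis matrix_eq vector_eq_ldot)

lemma congruence_bilinear:
  fixes M X :: "real ^ 'k ^ 'k"
  shows "u \<bullet> ((transpose M ** X ** M) *v v) = (M *v u) \<bullet> (X *v (M *v v))"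
  using dot_lmul_matrix[of u "transpose M" "X *v (M *v v)"]
  by (simp flip: matrix_vector_mul_assoc)

text \<open>
  The Stein operator \<open>X \<mapsto> X - M\<^sup>T X M\<close> is injective when the powers of \<open>M\<close> tend to zero, since
  a matrix in its kernel satisfies \<open>u \<bullet> X v = (M\<^sup>n u) \<bullet> X (M\<^sup>n v)\<close> for all \<open>n\<close>. An injective
  endomorphism of the finite-dimensional space of matrices is onto, which solves the equation; the
  same telescoping shows that the solution is positive definite.
\<close>

lemma discrete_lyapunov:
  fixes M :: "real ^ 'k ^ 'k"
  assumes lim: "\<And>v. (\<lambda>n. ((\<lambda>x. M *v x) ^^ n) v) \<longlonglongrightarrow> 0"
    and Q: "sym_pos_def Q"
  obtains Pbar where "sym_pos_def Pbar" "transpose M ** Pbar ** M - Pbar = - Q"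
proof -
  define S :: "real ^ 'k ^ 'k \<Rightarrow> real ^ 'k ^ 'k" where "S X = X - transpose M ** X ** M" for X
  have Sbil: "u \<bullet> (S X *v v) = u \<bullet> (X *v v) - (M *v u) \<bullet> (X *v (M *v v))" for X u v
    by (simp add: S_def matrix_vector_mult_diff_rdistrib inner_diff_right congruence_bilinear)
  have "linear S"
  proof (rule linearI)
    show "S (X + Y) = S X + S Y" for X Y
      by (simp add: matrix_eq_iff_bilinear Sbil matrix_vector_mult_add_rdistrib inner_add_right)
    show "S (r *\<^sub>R X) = r *\<^sub>R S X" for r X
      by (simp add: matrix_eq_iff_bilinear Sbil scaleR_matrix_vector_assoc[symmetric] algebra_simps)
  qed
  have limX: "(\<lambda>n. ((\<lambda>x. M *v x) ^^ n) u \<bullet> (X *v ((\<lambda>x. M *v x) ^^ n) v)) \<longlonglongrightarrow> 0" for X u v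
  proof -
    have "(\<lambda>n. X *v ((\<lambda>x. M *v x) ^^ n) v) \<longlonglongrightarrow> X *v 0"
      by (intro bounded_linear.tendsto[OF matrix_vector_mul_bounded_linear] lim)
    from tendsto_inner[OF lim[of u] this] show ?thesis by simp
  qed
  have "inj S"
    unfolding linear_injective_0[OF \<open>linear S\<close>]
  proof (intro allI impI)
    fix X assume "S X = 0"
    then have step: "u \<bullet> (X *v v) = (M *v u) \<bullet> (X *v (M *v v))" for u v
      using Sbil[of u X v] by simp
    have "u \<bullet> (X *v v) = ((\<lambda>x. M *v x) ^^ n) u \<bullet> (X *v ((\<lambda>x. M *v x) ^^ n) v)" for u v n
      by (induction n) (use step in auto)
    then have "(\<lambda>n::nat. u \<bullet> (X *v v)) = (\<lambda>n. ((\<lambda>x. M *v x) ^^ n) u \<bullet> (X *v ((\<lambda>x. M *v x) ^^ n) v))" for u v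
      by blast
    then have "(\<lambda>n::nat. u \<bullet> (X *v v)) \<longlonglongrightarrow> 0" for u v
      using limX[of u X v] by simp
    then have "u \<bullet> (X *v v) = 0" for u v
      by (simp add: LIMSEQ_const_iff)
    then show "X = 0" by (simp add: matrix_eq_iff_bilinear)
  qed
  then have "surj S" using linear_injective_imp_surjective[OF \<open>linear S\<close>] by blast
  then obtain X where X: "S X = Q" by (metis surjD)
  have tr: "u \<bullet> (transpose Y *v v) = v \<bullet> (Y *v u)" for Y :: "real ^ 'k ^ 'k" and u v
    using dot_lmul_matrix[of v Y u] by (simp add: inner_commute)
  have "S (transpose X) = transpose (S X)"
    by (simp add: matrix_eq_iff_bilinear Sbil tr del: transpose_matrix_vector)
  also have "\<dots> = S X" using X Q by (simp add: sym_pos_def_def)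
  finally have "transpose X = X" using \<open>inj S\<close> by (simp add: inj_eq)
  moreover have "pos_def_on UNIV X"
    unfolding pos_def_on_def
  proof (intro allI impI)
    fix v :: "real ^ 'k" assume "v \<noteq> 0 \<and> (\<forall>k. k \<notin> UNIV \<longrightarrow> v $ k = 0)"
    then have Qv: "v \<bullet> (Q *v v) > 0" using Q by (auto simp: sym_pos_def_def pos_def_on_def)
    have Q0: "0 \<le> w \<bullet> (Q *v w)" for w
      using Q by (cases "w = 0") (auto simp: sym_pos_def_def pos_def_on_def less_imp_le)
    have step: "w \<bullet> (X *v w) = w \<bullet> (Q *v w) + (M *v w) \<bullet> (X *v (M *v w))" for w
      using Sbil[of w X w] X by simp
    have "((\<lambda>x. M *v x) ^^ n) (M *v v) \<bullet> (X *v ((\<lambda>x. M *v x) ^^ n) (M *v v))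
        \<le> (M *v v) \<bullet> (X *v (M *v v))" for n
    proof (induction n)
      case (Suc n)
      then show ?case
        using step[of "((\<lambda>x. M *v x) ^^ n) (M *v v)"] Q0[of "((\<lambda>x. M *v x) ^^ n) (M *v v)"] by simp
    qed simp
    then have "0 \<le> (M *v v) \<bullet> (X *v (M *v v))"
      by (intro LIMSEQ_le_const2[OF limX[of "M *v v" X "M *v v"]]) auto
    then show "0 < v \<bullet> (X *v v)" using step[of v] Qv by simp
  qed
  ultimately have "sym_pos_def X" by (simp add: sym_pos_def_def)
  moreover have "transpose M ** X ** M - X = - Q" using X by (simp add: S_def algebra_simps)
  ultimately show thesis by (rule that)
qed

text \<open>
  By the Lyapunov equation \<open>\<bar>M v\<bar>\<^sub>P\<^sup>2 = \<bar>v\<bar>\<^sub>P\<^sup>2 - v \<bullet> Q v\<close>, and \<open>v \<bullet> Q v\<close> is at least a fixed fraction of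
  \<open>\<bar>v\<bar>\<^sub>P\<^sup>2\<close>.
\<close>

lemma wnorm_mat_lyapunov:
  fixes M :: "real ^ 'k ^ 'k"
  assumes P: "sym_pos_def P" and Q: "sym_pos_def Q" and eq: "transpose M ** P ** M - P = - Q"
    and "M \<noteq> 0"
  shows "0 < wnorm_mat P M" "wnorm_mat P M < 1"
proof -
  obtain q where q: "q > 0" "\<And>v. q * (norm v)\<^sup>2 \<le> v \<bullet> (Q *v v)"
    using pos_def_on_bound[of UNIV Q] Q unfolding sym_pos_def_def by (metis UNIV_I)
  have Ppos: "v \<noteq> 0 \<Longrightarrow> 0 < v \<bullet> (P *v v)" for v
    using P by (auto simp: sym_pos_def_def pos_def_on_def)
  then have P0: "0 \<le> v \<bullet> (P *v v)" for v by (cases "v = 0") (auto simp: less_imp_le)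
  obtain L where L: "L > 0" "\<And>x. norm (P *v x) \<le> norm x * L"
    using bounded_linear.pos_bounded[OF matrix_vector_mul_bounded_linear[of P]] by blast
  define \<theta> where "\<theta> = max 0 (1 - q / L)"
  have \<theta>: "0 \<le> \<theta>" "\<theta> < 1" using q L by (auto simp: \<theta>_def)
  have contr: "(M *v v) \<bullet> (P *v (M *v v)) \<le> \<theta> * (v \<bullet> (P *v v))" for v
  proof -
    have "v \<bullet> (P *v v) \<le> norm v * (norm v * L)"
      by (rule order_trans[OF norm_cauchy_schwarz]) (intro mult_left_mono L, simp)
    then have "q / L * (v \<bullet> (P *v v)) \<le> q / L * (norm v * (norm v * L))"
      using q L by (intro mult_left_mono) auto
    also have "\<dots> = q * (norm v)\<^sup>2" using L by (simp add: power2_eq_square)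
    also have "\<dots> \<le> v \<bullet> (Q *v v)" by (rule q)
    finally have "q / L * (v \<bullet> (P *v v)) \<le> v \<bullet> (Q *v v)" .
    moreover have "(M *v v) \<bullet> (P *v (M *v v)) - v \<bullet> (P *v v) = - (v \<bullet> (Q *v v))"
    proof -
      have "v \<bullet> ((transpose M ** P ** M - P) *v v) = v \<bullet> ((- Q) *v v)" by (simp add: eq)
      moreover have "(- Q) *v v = - (Q *v v)"
        by (simp add: matrix_vector_mult_def vec_eq_iff sum_negf)
      ultimately show ?thesis
        by (simp add: matrix_vector_mult_diff_rdistrib inner_diff_right congruence_bilinear)
    qed
    ultimately have "(M *v v) \<bullet> (P *v (M *v v)) \<le> (1 - q / L) * (v \<bullet> (P *v v))"
      by (simp add: algebra_simps)
    also have "\<dots> \<le> \<theta> * (v \<bullet> (P *v v))" by (intro mult_right_mono P0) (simp add: \<theta>_def)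
    finally show ?thesis .
  qed
  have ratio: "wnorm P (M *v v) / wnorm P v \<le> sqrt \<theta>" for v
  proof (cases "v = 0")
    case True
    then show ?thesis using \<theta> by (simp add: wnorm_def)
  next
    case False
    have "wnorm P (M *v v) \<le> sqrt (\<theta> * (v \<bullet> (P *v v)))"
      unfolding wnorm_def by (intro real_sqrt_le_mono contr)
    then show ?thesis using Ppos[OF False] by (simp add: wnorm_def real_sqrt_mult pos_divide_le_eq)
  qed
  have "wnorm_mat P M \<le> sqrt \<theta>"
    unfolding wnorm_mat_def by (rule cSUP_least) (use ratio in auto)
  also have "\<dots> < 1" using \<theta> by simp
  finally show "wnorm_mat P M < 1" .
  obtain v where v: "M *v v \<noteq> 0" using \<open>M \<noteq> 0\<close> by (metis matrix_eq matrix_vector_mult_0)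
  then have "v \<noteq> 0" by auto
  have "0 < wnorm P (M *v v) / wnorm P v"
    using Ppos[OF v] Ppos[OF \<open>v \<noteq> 0\<close>] by (simp add: wnorm_def)
  also have "\<dots> \<le> wnorm_mat P M"
    unfolding wnorm_mat_def by (rule cSUP_upper) (use ratio in \<open>auto intro!: bdd_aboveI\<close>)
  finally show "0 < wnorm_mat P M" .
qed

text \<open>
  A nonzero kernel vector supported on \<open>S\<close> could be extended to a basis of the vectors supported on \<open>S\<close>,
  and the remaining \<open>card S - 1\<close> basis vectors would span the range.
\<close>

lemma full_column_rank_injective:
  fixes G :: "real ^ 'k ^ 'k"
  assumes rank: "rank G = card S" and cols: "\<And>a b. b \<notin> S \<Longrightarrow> G $ a $ b = 0"
    and v: "\<forall>k. k \<notin> S \<longrightarrow> v $ k = 0" and ker: "G *v v = 0"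
  shows "v = 0"
proof (rule ccontr)
  assume "v \<noteq> 0"
  let ?U = "{x :: real ^ 'k. \<forall>k. k \<notin> S \<longrightarrow> x $ k = 0}"
  have "independent {v}" using \<open>v \<noteq> 0\<close> by simp
  moreover have "{v} \<subseteq> ?U" using v by simp
  ultimately obtain B where B: "{v} \<subseteq> B" "B \<subseteq> ?U" "independent B" "?U \<subseteq> span B"
    using maximal_independent_subset_extend[of "{v}" ?U] by blast
  have fB: "finite B" using B(3) by (rule independent_imp_finite)
  have "card B = dim ?U" using B by (intro basis_card_eq_dim)
  also have "\<dots> = card S" using dim_substandard_cart[of S] by (simp flip: dim_vec_eq)
  finally have cB: "card B = card S" .
  have "range (\<lambda>x. G *v x) \<subseteq> span ((\<lambda>x. G *v x) ` (B - {v}))"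
  proof (rule image_subsetI)
    fix x :: "real ^ 'k"
    have "G *v x = G *v (restr S x)"
      using cols by (auto simp: vec_eq_iff matrix_vector_mult_def intro!: sum.cong)
    moreover have "restr S x \<in> span B" using B(4) by auto
    ultimately have "G *v x \<in> (\<lambda>x. G *v x) ` span B" by auto
    also have "(\<lambda>x. G *v x) ` span B = span ((\<lambda>x. G *v x) ` B)"
      by (rule linear_span_image[symmetric]) (rule matrix_vector_mul_linear)
    also have "(\<lambda>x. G *v x) ` B = insert 0 ((\<lambda>x. G *v x) ` (B - {v}))"
      using B(1) ker by auto
    finally show "G *v x \<in> span ((\<lambda>x. G *v x) ` (B - {v}))" by simp
  qed
  then have "dim (range (\<lambda>x. G *v x)) \<le> card ((\<lambda>x. G *v x) ` (B - {v}))"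
    using fB by (intro dim_le_card) auto
  also have "\<dots> \<le> card (B - {v})" using fB by (intro card_image_le) auto
  also have "\<dots> < card B" using fB B(1) by (intro psubset_card_mono) auto
  finally show False using rank cB by (simp add: rank_dim_range)
qed

section \<open>Derivatives of the Lagrangians and constraints\<close>

locale nlp_setting =
  fixes N :: "('k::finite, 'v::finite) nlp"
  assumes wf: "nlp_wf N"
begin

abbreviation "duals \<equiv> eqs N \<union> ineqs N"

lemma index_partition:
  "prims N \<union> duals = UNIV" "prims N \<inter> duals = {}" "eqs N \<inter> ineqs N = {}" "prims N \<inter> eqs N = {}"
  "prims N \<inter> ineqs N = {}"
proof -
  have "kind_of N k = Primal \<or> kind_of N k = Equality \<or> kind_of N k = Inequality" for k
    by (cases "kind_of N k") auto
  then show "prims N \<union> duals = UNIV" by (auto simp: prims_def eqs_def ineqs_def)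
qed (auto simp: prims_def eqs_def ineqs_def)

lemma not_prim: "k \<notin> prims N \<longleftrightarrow> k \<in> duals"
  using index_partition by blast

lemma C_k_cost: "C_k 3 (cost N i)"
  and C_k_constr: "c \<in> duals \<Longrightarrow> C_k 3 (constr N c)"
  using wf by (auto simp: nlp_wf_def)

lemma nbrs_sym: "j \<in> nbrs N i \<longleftrightarrow> i \<in> nbrs N j"
  using wf by (auto simp: nlp_wf_def nbrs_def sym_def)

abbreviation "stencil i \<equiv> {k \<in> prims N. owner N k \<in> insert i (nbrs N i)}"

lemma cost_depends: "depends_only_on (stencil i) (cost N i)"
  and constr_depends: "c \<in> duals \<Longrightarrow> depends_only_on (stencil (owner N c)) (constr N c)"
  using wf by (auto simp: nlp_wf_def)

lemma cost_cong: "(\<And>k. k \<in> stencil i \<Longrightarrow> x $ k = y $ k) \<Longrightarrow> cost N i x = cost N i y"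
  using cost_depends[of i] unfolding depends_only_on_def by blast

lemma constr_cong:
  "c \<in> duals \<Longrightarrow> (\<And>k. k \<in> stencil (owner N c) \<Longrightarrow> x $ k = y $ k) \<Longrightarrow> constr N c x = constr N c y"
  using constr_depends[of c] unfolding depends_only_on_def by blast

lemma constr_differentiable: "c \<in> duals \<Longrightarrow> constr N c differentiable (at x)"
  using C_k_constr[of c] by (simp add: numeral_3_eq_3)

lemma cost_differentiable: "cost N i differentiable (at x)"
  using C_k_cost[of i] by (simp add: numeral_3_eq_3)

lemma partial_d_constr_far:
  assumes "c \<in> duals" "b \<notin> prims N \<or> owner N b \<notin> insert (owner N c) (nbrs N (owner N c))"
  shows "partial_d b (constr N c) x = 0"
  by (rule partial_d_eq_0[OF constr_depends[OF assms(1)] _ constr_differentiable[OF assms(1)]])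
    (use assms(2) in blast)

lemma partial_d_constr_nonprim: "c \<in> duals \<Longrightarrow> b \<notin> prims N \<Longrightarrow> partial_d b (constr N c) x = 0"
  by (rule partial_d_constr_far) auto

lemma lagr_loc_alt:
  "lagr_loc N i = (\<lambda>p. cost N i p + (\<Sum>c \<in> duals \<inter> owned N i. p $ c * constr N c p))"
proof
  fix p
  have "duals \<inter> owned N i = (eqs N \<inter> owned N i) \<union> (ineqs N \<inter> owned N i)" by auto
  moreover have "(eqs N \<inter> owned N i) \<inter> (ineqs N \<inter> owned N i) = {}" using index_partition by blast
  ultimately show "lagr_loc N i p = cost N i p + (\<Sum>c \<in> duals \<inter> owned N i. p $ c * constr N c p)"
    by (simp add: lagr_loc_def sum.union_disjoint)
qed

lemma C_k_lagr_loc: "C_k 3 (lagr_loc N i)"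
  unfolding lagr_loc_alt by (intro C_k_add C_k_cost C_k_sum C_k_mult C_k_nth C_k_constr) auto

lemma C_k_partial_lagr_loc: "C_k 2 (partial_d a (lagr_loc N i))"
  using C_k_lagr_loc[of i] by (simp add: numeral_3_eq_3 numeral_2_eq_2)

lemma lagr_loc_differentiable: "lagr_loc N i differentiable (at x)"
  using C_k_lagr_loc[of i] by (simp add: numeral_3_eq_3)

lemma partial_lagr_loc_differentiable: "partial_d a (lagr_loc N i) differentiable (at x)"
  using C_k_partial_lagr_loc[of a i] by (simp add: numeral_2_eq_2)

lemma partial_d_lagr_loc_far:
  assumes "b \<in> prims N" "owner N b \<notin> insert i (nbrs N i)"
  shows "partial_d b (lagr_loc N i) x = 0"
proof (rule partial_d_eq_0[of "- {b}"])
  show "depends_only_on (- {b}) (lagr_loc N i)"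
    unfolding depends_only_on_def
  proof (intro allI impI)
    fix x y :: "real ^ 'k" assume xy: "\<forall>k\<in>- {b}. x $ k = y $ k"
    have "cost N i x = cost N i y"
      by (rule cost_cong) (use assms(2) xy in auto)
    moreover have "constr N c x = constr N c y" if "c \<in> duals" "owner N c = i" for c
      by (rule constr_cong[OF that(1)]) (use that(2) assms(2) xy in auto)
    moreover have "x $ c = y $ c" if "c \<in> duals" for c
      using xy assms(1) that index_partition by auto
    ultimately show "lagr_loc N i x = lagr_loc N i y"
      unfolding lagr_loc_alt by (auto simp: owned_def intro!: sum.cong)
  qed
qed (simp_all add: lagr_loc_differentiable)

text \<open>
  The Lagrangians are linear in the multipliers. As the stacked variable contains them, mixed second
  derivatives of a Lagrangian in a primal and a dual index are constraint gradients.
\<close>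

lemma partial_d_lagr_loc_dual:
  assumes b: "b \<in> duals"
  shows "partial_d b (lagr_loc N i) x = (if owner N b = i then constr N b x else 0)"
proof -
  have diff: "(\<lambda>p. p $ c * constr N c p) differentiable (at x)" if "c \<in> duals" for c
    using C_k_mult[OF C_k_nth C_k_constr[OF that], of c] by (simp add: numeral_3_eq_3)
  have pc: "partial_d b (cost N i) x = 0"
    by (rule partial_d_eq_0[OF cost_depends _ cost_differentiable]) (use b not_prim in blast)
  have pm: "partial_d b (\<lambda>p. p $ c * constr N c p) x = (if b = c then constr N c x else 0)"
    if "c \<in> duals" for c
  proof -
    have "partial_d b (constr N c) x = 0"
      by (rule partial_d_constr_far[OF that]) (use b not_prim in blast)
    moreover have "(\<lambda>p. p $ c) differentiable (at x)"
      using has_derivative_nth differentiableI by blast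
    ultimately show ?thesis
      using constr_differentiable[OF that] by (subst partial_d_mult) (simp_all add: partial_d_nth)
  qed
  have "partial_d b (lagr_loc N i) x = (\<Sum>c \<in> duals \<inter> owned N i. if b = c then constr N c x else 0)"
  proof -
    have "(\<lambda>p. \<Sum>c \<in> duals \<inter> owned N i. p $ c * constr N c p) differentiable (at x)"
      by (rule differentiable_sum) (simp, blast intro: diff)
    moreover have "partial_d b (\<lambda>p. \<Sum>c \<in> duals \<inter> owned N i. p $ c * constr N c p) x
        = (\<Sum>c \<in> duals \<inter> owned N i. partial_d b (\<lambda>p. p $ c * constr N c p) x)"
      by (rule partial_d_sum) (blast intro: diff)
    ultimately show ?thesis
      unfolding lagr_loc_alt using pc pm by (simp add: partial_d_add cost_differentiable)
  qed
  then show ?thesis using b by (auto simp: owned_def sum.delta')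
qed

lemma partial_d_lagr: "partial_d a (lagr N) x = (\<Sum>i\<in>UNIV. partial_d a (lagr_loc N i) x)"
proof -
  have "lagr N = (\<lambda>p. \<Sum>i\<in>UNIV. lagr_loc N i p)" by (simp add: lagr_def fun_eq_iff)
  then show ?thesis by (simp add: partial_d_sum lagr_loc_differentiable)
qed

text \<open>
  Only the agent that owns the variable and its neighbors contribute to a primal derivative of the
  central Lagrangian. This is why the linear terms of the local costs complete the local gradients.
\<close>

lemma partial_d_lagr_nbrs:
  assumes "a \<in> prims N"
  shows "partial_d a (lagr N) x = (\<Sum>j\<in>insert (owner N a) (nbrs N (owner N a)). partial_d a (lagr_loc N j) x)"
  unfolding partial_d_lagr
proof (rule sum.mono_neutral_right)
  show "\<forall>i \<in> UNIV - insert (owner N a) (nbrs N (owner N a)). partial_d a (lagr_loc N i) x = 0"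
  proof
    fix i assume "i \<in> UNIV - insert (owner N a) (nbrs N (owner N a))"
    then have "owner N a \<notin> insert i (nbrs N i)" using nbrs_sym[of i "owner N a"] by auto
    then show "partial_d a (lagr_loc N i) x = 0" by (rule partial_d_lagr_loc_far[OF assms])
  qed
qed auto

lemma partial_d2_lagr:
  assumes "a \<in> prims N"
  shows "partial_d b (partial_d a (lagr N)) x =
    (\<Sum>j\<in>insert (owner N a) (nbrs N (owner N a)). partial_d b (partial_d a (lagr_loc N j)) x)"
proof -
  have "partial_d a (lagr N) = (\<lambda>x. \<Sum>j\<in>insert (owner N a) (nbrs N (owner N a)). partial_d a (lagr_loc N j) x)"
    using partial_d_lagr_nbrs[OF assms] by blast
  then show ?thesis by (simp add: partial_d_sum partial_lagr_loc_differentiable del: sum.insert)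
qed

lemma partial_d2_commute:
  "partial_d a (partial_d b (lagr_loc N i)) x = partial_d b (partial_d a (lagr_loc N i)) x"
  by (rule partial_d_commute[OF C_k_mono[OF C_k_lagr_loc]]) simp

lemma partial_d2_lagr_loc_dual:
  assumes "b \<in> duals"
  shows "partial_d b (partial_d a (lagr_loc N i)) x
      = (if owner N b = i then partial_d a (constr N b) x else 0)"
proof -
  have "partial_d b (lagr_loc N i) = (\<lambda>x. if owner N b = i then constr N b x else 0)"
    using partial_d_lagr_loc_dual[OF assms] by blast
  then show ?thesis
    by (subst partial_d2_commute) (simp add: partial_d_const)
qed

end

section \<open>The stacked KKT system of the local problems\<close>

context nlp_setting
begin

text \<open>
  The point \<open>(x\<^sub>i + s\<^sub>i, x\<^sub>\<N>\<^sub>i)\<close> of agent \<open>i\<close>, extended by the local multipliers \<open>(\<nu>\<^sub>i, \<kappa>\<^sub>i)\<close>. It differs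
  from \<open>shift\<close> in dual indices only and is linear in the pair \<open>(p, y)\<close>; the local Lagrangian is the
  agent's own Lagrangian at this point plus quadratic and linear terms.
\<close>

definition mix :: "'v \<Rightarrow> (real ^ 'k) \<times> (real ^ 'k) \<Rightarrow> real ^ 'k" where
  "mix i z = (\<chi> k. if k \<in> owned N i then (if k \<in> prims N then fst z $ k + snd z $ k else snd z $ k)
                   else fst z $ k)"

lemma bounded_linear_mix: "bounded_linear (mix i)"
  unfolding linear_conv_bounded_linear[symmetric]
  by (rule linearI) (auto simp: mix_def vec_eq_iff algebra_simps)

lemma mix_dual_part [simp]: "mix i (p, dual_part N p) = p"
  by (auto simp: mix_def dual_part_def vec_eq_iff)

lemma mix_0 [simp]: "mix i (0, h) = restr (owned N i) h"
  by (auto simp: mix_def vec_eq_iff)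

lemma mix_affine: "mix i (p, y) = mix i (p, 0) + restr (owned N i) y"
  by (auto simp: mix_def vec_eq_iff)

lemma has_derivative_mix: "((\<lambda>y. mix i (p, y)) has_derivative restr (owned N i)) (at y)"
proof -
  have "(\<lambda>y. mix i (p, y)) = (\<lambda>y. mix i (p, 0) + restr (owned N i) y)"
    by (rule ext) (rule mix_affine)
  moreover have "((\<lambda>y. mix i (p, 0) + restr (owned N i) y) has_derivative (\<lambda>h. 0 + restr (owned N i) h)) (at y)"
    by (intro has_derivative_add has_derivative_const bounded_linear_imp_has_derivative bounded_linear_restr)
  ultimately show ?thesis by simp
qed

lemma mix_differentiable: "(\<lambda>y. mix i (p, y)) differentiable (at y)"
  using has_derivative_mix differentiableI by blast

lemma mix_owned: "k \<in> owned N i \<Longrightarrow> k \<notin> prims N \<Longrightarrow> mix i z $ k = snd z $ k"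
  by (simp add: mix_def)

lemma constr_bar_mix: "c \<in> duals \<Longrightarrow> constr_bar N c p y = constr N c (mix (owner N c) (p, y))"
  unfolding constr_bar_def by (rule constr_cong) (auto simp: shift_def mix_def)

lemma cost_shift_mix: "cost N i (shift N i p y) = cost N i (mix i (p, y))"
  by (rule cost_cong) (auto simp: shift_def mix_def)

lemma lagr_bar_mix:
  "lagr_bar N \<rho> i p y = lagr_loc N i (mix i (p, y))
     + (\<rho> i / 2 * (\<Sum>k \<in> prims N \<inter> owned N i. (y $ k)\<^sup>2)
     + (\<Sum>j \<in> nbrs N i. \<Sum>k \<in> prims N \<inter> owned N i. partial_d k (lagr_loc N j) p * y $ k))"
proof -
  have "y $ k * constr_bar N k p y = mix i (p, y) $ k * constr N k (mix i (p, y))"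
    if "k \<in> duals" "k \<in> owned N i" for k
    using that not_prim by (auto simp: constr_bar_mix mix_owned owned_def)
  then show ?thesis
    by (simp add: lagr_bar_def cost_bar_def lagr_loc_def cost_shift_mix)
qed

lemma partial_d_compose_mix:
  assumes "F differentiable (at (mix i (p, y)))"
  shows "partial_d k (\<lambda>y. F (mix i (p, y))) y = (if k \<in> owned N i then partial_d k F (mix i (p, y)) else 0)"
proof -
  from partial_d_eq[OF has_derivative_compose[OF has_derivative_mix has_derivative_partials[OF assms]], of k]
  have "partial_d k (\<lambda>y. F (mix i (p, y))) y
      = (\<Sum>j\<in>UNIV. restr (owned N i) (axis k 1) $ j * partial_d j F (mix i (p, y)))" .
  also have "\<dots> = (\<Sum>j\<in>UNIV. if j = k then (if k \<in> owned N i then partial_d k F (mix i (p, y)) else 0) else 0)"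
    by (rule sum.cong) (auto simp: axis_def)
  finally show ?thesis by simp
qed

lemma partial_d_lagr_bar:
  assumes "a \<in> prims N" "a \<in> owned N i"
  shows "partial_d a (lagr_bar N \<rho> i p) y = partial_d a (lagr_loc N i) (mix i (p, y)) + \<rho> i * y $ a
      + (\<Sum>j \<in> nbrs N i. partial_d a (lagr_loc N j) p)"
proof -
  let ?S = "prims N \<inter> owned N i"
  have D: "((\<lambda>y. \<rho> i / 2 * (\<Sum>k \<in> ?S. (y $ k)\<^sup>2)
      + (\<Sum>j \<in> nbrs N i. \<Sum>k \<in> ?S. partial_d k (lagr_loc N j) p * y $ k)) has_derivative
      (\<lambda>h. \<rho> i / 2 * (\<Sum>k \<in> ?S. 2 * y $ k * h $ k)
      + (\<Sum>j \<in> nbrs N i. \<Sum>k \<in> ?S. partial_d k (lagr_loc N j) p * h $ k))) (at y)"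
    by (auto intro!: derivative_eq_intros has_derivative_nth simp: algebra_simps power2_eq_square)
  have ax: "(\<Sum>k \<in> ?S. f k * axis a (1::real) $ k) = f a" for f
  proof -
    have "(\<Sum>k \<in> ?S. f k * axis a (1::real) $ k) = (\<Sum>k \<in> ?S. if k = a then f a else 0)"
      by (rule sum.cong) (auto simp: axis_def)
    then show ?thesis using assms by simp
  qed
  have "(\<lambda>y. lagr_loc N i (mix i (p, y))) differentiable (at y)"
    by (rule differentiable_compose[OF lagr_loc_differentiable mix_differentiable])
  then have "partial_d a (\<lambda>y. lagr_bar N \<rho> i p y) y = partial_d a (\<lambda>y. lagr_loc N i (mix i (p, y))) y
      + partial_d a (\<lambda>y. \<rho> i / 2 * (\<Sum>k \<in> ?S. (y $ k)\<^sup>2)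
      + (\<Sum>j \<in> nbrs N i. \<Sum>k \<in> ?S. partial_d k (lagr_loc N j) p * y $ k)) y"
    unfolding lagr_bar_mix using D by (intro partial_d_add) (auto simp: differentiable_def)
  then show ?thesis
    unfolding partial_d_eq[OF D] using assms
    by (simp add: partial_d_compose_mix lagr_loc_differentiable ax)
qed

lemma partial_d2_lagr_bar:
  assumes "a \<in> prims N" "a \<in> owned N i" "b \<in> prims N" "b \<in> owned N i"
  shows "partial_d a (partial_d b (lagr_bar N \<rho> i p)) y
      = partial_d a (partial_d b (lagr_loc N i)) (mix i (p, y)) + (if a = b then \<rho> i else 0)"
proof -
  have "partial_d b (lagr_bar N \<rho> i p) = (\<lambda>y. partial_d b (lagr_loc N i) (mix i (p, y)) + (\<rho> i * y $ b
      + (\<Sum>j \<in> nbrs N i. partial_d b (lagr_loc N j) p)))"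
    using partial_d_lagr_bar[OF assms(3,4)] by (simp add: fun_eq_iff)
  moreover have D: "((\<lambda>y. \<rho> i * y $ b + (\<Sum>j \<in> nbrs N i. partial_d b (lagr_loc N j) p))
      has_derivative (\<lambda>h. \<rho> i * h $ b)) (at y)"
    by (auto intro!: derivative_eq_intros has_derivative_nth)
  moreover have "(\<lambda>y. partial_d b (lagr_loc N i) (mix i (p, y))) differentiable (at y)"
    by (rule differentiable_compose[OF partial_lagr_loc_differentiable mix_differentiable])
  moreover have "(\<lambda>y. \<rho> i * y $ b + (\<Sum>j \<in> nbrs N i. partial_d b (lagr_loc N j) p)) differentiable (at y)"
    using D differentiableI by blast
  ultimately show ?thesis
    using assms partial_d_eq[OF D, of a]
    by (simp add: partial_d_add partial_d_compose_mix partial_lagr_loc_differentiable axis_def)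
qed

lemma partial_d_constr_bar:
  assumes "c \<in> duals"
  shows "partial_d a (constr_bar N c p) y
      = (if owner N a = owner N c then partial_d a (constr N c) (mix (owner N c) (p, y)) else 0)"
proof -
  have "constr_bar N c p = (\<lambda>y. constr N c (mix (owner N c) (p, y)))"
    using constr_bar_mix[OF assms] by blast
  then show ?thesis
    by (simp add: partial_d_compose_mix constr_differentiable[OF assms] owned_def)
qed

text \<open>
  The scalar functions whose compositions with \<open>mix\<close> make up the KKT residual: gradient of the
  agent's Lagrangian, equality constraints, and complementarity products. The factor \<open>- \<beta>\<close> makes
  the Jacobian of the residual in \<open>y\<close> equal to the matrices \<open>P\<^sub>i\<close> of the algorithm.
\<close>

definition res_fun :: "real \<Rightarrow> 'k \<Rightarrow> real ^ 'k \<Rightarrow> real" where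
  "res_fun \<beta> a = (case kind_of N a of
     Primal \<Rightarrow> partial_d a (lagr_loc N (owner N a))
   | Equality \<Rightarrow> (\<lambda>w. - \<beta> * constr N a w)
   | Inequality \<Rightarrow> (\<lambda>w. - \<beta> * (w $ a * constr N a w)))"

text \<open>
  The left-hand sides of the stacked local KKT equations, and their derivative at \<open>(ps, d(ps))\<close>.
\<close>

definition residual :: "('v \<Rightarrow> real) \<Rightarrow> real \<Rightarrow> (real ^ 'k) \<times> (real ^ 'k) \<Rightarrow> real ^ 'k" where
  "residual \<rho> \<beta> z = (\<chi> a. res_fun \<beta> a (mix (owner N a) z)
     + (if a \<in> prims N then \<rho> (owner N a) * snd z $ a
          + (\<Sum>j \<in> nbrs N (owner N a). partial_d a (lagr_loc N j) (fst z)) else 0))"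

definition residual' :: "('v \<Rightarrow> real) \<Rightarrow> real \<Rightarrow> real ^ 'k \<Rightarrow> (real ^ 'k) \<times> (real ^ 'k) \<Rightarrow> real ^ 'k" where
  "residual' \<rho> \<beta> ps z = (\<chi> a. (\<Sum>b\<in>UNIV. mix (owner N a) z $ b * partial_d b (res_fun \<beta> a) ps)
     + (if a \<in> prims N then \<rho> (owner N a) * snd z $ a
          + (\<Sum>j \<in> nbrs N (owner N a). \<Sum>b\<in>UNIV. fst z $ b * partial_d b (partial_d a (lagr_loc N j)) ps) else 0))"

lemma C_k_res_fun: "C_k 2 (res_fun \<beta> a)"
proof -
  have *: "C_k 2 (constr N a)" if "a \<in> duals" using C_k_mono[OF C_k_constr[OF that], of 2] by simp
  have "C_k 2 (\<lambda>w. - \<beta> * constr N a w)" "C_k 2 (\<lambda>w. - \<beta> * (w $ a * constr N a w))" if "a \<in> duals"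
    by (intro C_k_mult C_k_const C_k_nth *[OF that])+
  then show ?thesis
    by (cases "kind_of N a") (simp_all add: res_fun_def eqs_def ineqs_def C_k_partial_lagr_loc)
qed

lemma residual_strict_derivative:
  "strict_derivative (residual \<rho> \<beta>) (residual' \<rho> \<beta> ps) (ps, dual_part N ps)"
proof (rule strict_derivative_vec)
  fix a
  have C1: "C_k (Suc 0) (res_fun \<beta> a)" "C_k (Suc 0) (partial_d a (lagr_loc N j))" for j
    by (rule C_k_mono[OF C_k_res_fun] C_k_mono[OF C_k_partial_lagr_loc]; simp)+
  have 1: "strict_derivative (\<lambda>z. res_fun \<beta> a (mix (owner N a) z))
      (\<lambda>z. \<Sum>b\<in>UNIV. mix (owner N a) z $ b * partial_d b (res_fun \<beta> a) ps) (ps, dual_part N ps)"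
    by (rule strict_derivative_compose_linear[OF bounded_linear_mix])
      (use C_k_strict_derivative[OF C1(1)] in simp)
  have 2: "strict_derivative (\<lambda>z. partial_d a (lagr_loc N j) (fst z))
      (\<lambda>z. \<Sum>b\<in>UNIV. fst z $ b * partial_d b (partial_d a (lagr_loc N j)) ps) (ps, dual_part N ps)" for j
    by (rule strict_derivative_compose_linear[OF bounded_linear_fst])
      (use C_k_strict_derivative[OF C1(2)] in simp)
  have 3: "strict_derivative (\<lambda>z :: (real ^ 'k) \<times> (real ^ 'k). \<rho> (owner N a) * snd z $ a)
      (\<lambda>z. \<rho> (owner N a) * snd z $ a) (ps, dual_part N ps)"
    by (rule strict_derivative_linear)
      (rule bounded_linear_const_mult[OF bounded_linear_compose[OF bounded_linear_vec_nth bounded_linear_snd]])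
  show "strict_derivative (\<lambda>z. residual \<rho> \<beta> z $ a) (\<lambda>h. residual' \<rho> \<beta> ps h $ a) (ps, dual_part N ps)"
    using strict_derivative_add[OF 1 strict_derivative_add[OF 3
          strict_derivative_sum[of "nbrs N (owner N a)", OF 2]]] 1
    by (cases "a \<in> prims N") (simp_all add: residual_def residual'_def)
qed

lemma kinds: "kind_of N a = Primal \<longleftrightarrow> a \<in> prims N" "kind_of N a = Equality \<longleftrightarrow> a \<in> eqs N"
  "kind_of N a = Inequality \<longleftrightarrow> a \<in> ineqs N"
  by (auto simp: prims_def eqs_def ineqs_def)

lemma res_fun_simps:
  "a \<in> prims N \<Longrightarrow> res_fun \<beta> a = partial_d a (lagr_loc N (owner N a))"
  "a \<in> eqs N \<Longrightarrow> res_fun \<beta> a = (\<lambda>w. - \<beta> * constr N a w)"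
  "a \<in> ineqs N \<Longrightarrow> res_fun \<beta> a = (\<lambda>w. - \<beta> * (w $ a * constr N a w))"
  by (simp_all add: res_fun_def flip: kinds)

lemma residual_simps:
  "a \<in> prims N \<Longrightarrow> residual \<rho> \<beta> (p, y) $ a = partial_d a (lagr_bar N \<rho> (owner N a) p) y"
  "a \<in> eqs N \<Longrightarrow> residual \<rho> \<beta> (p, y) $ a = - \<beta> * constr_bar N a p y"
  "a \<in> ineqs N \<Longrightarrow> residual \<rho> \<beta> (p, y) $ a = - \<beta> * (y $ a * constr_bar N a p y)"
  using index_partition not_prim[of a]
  by (auto simp: residual_def res_fun_simps partial_d_lagr_bar constr_bar_mix mix_owned owned_def)

lemma partial_d_res_fun:
  assumes "a \<in> duals"
  shows "partial_d b (res_fun \<beta> a) x = (if a \<in> eqs N then - \<beta> * partial_d b (constr N a) x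
    else - \<beta> * (x $ a * partial_d b (constr N a) x + (if a = b then constr N a x else 0)))"
proof (cases "a \<in> eqs N")
  case True
  then show ?thesis
    using partial_d_mult[of "\<lambda>_. - \<beta>" x "constr N a" b] constr_differentiable[OF assms]
    by (simp add: res_fun_simps partial_d_const)
next
  case False
  have "(\<lambda>p. p $ a) differentiable (at x)"
    using has_derivative_nth differentiableI by blast
  moreover from this have "(\<lambda>p. p $ a * constr N a p) differentiable (at x)"
    by (rule differentiable_mult) (rule constr_differentiable[OF assms])
  ultimately show ?thesis
    using partial_d_mult[of "\<lambda>_. - \<beta>" x "\<lambda>p. p $ a * constr N a p" b]
      partial_d_mult[of "\<lambda>p. p $ a" x "constr N a" b]
      constr_differentiable[OF assms] False assms
    by (simp add: res_fun_simps partial_d_const partial_d_nth)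
qed

text \<open>The block diagonal matrix of the \<open>P\<^sub>i\<close>; it is the Jacobian of the residual in \<open>y\<close>.\<close>

definition jac :: "('v \<Rightarrow> real) \<Rightarrow> real \<Rightarrow> real ^ 'k \<Rightarrow> real ^ 'k \<Rightarrow> real ^ 'k ^ 'k" where
  "jac \<rho> \<beta> p y = (\<Sum>i\<in>UNIV. P_diag N \<rho> \<beta> i p y)"

lemma jac_nth: "jac \<rho> \<beta> p y $ a $ b = P_diag N \<rho> \<beta> (owner N a) p y $ a $ b"
proof -
  have "jac \<rho> \<beta> p y $ a $ b = (\<Sum>i\<in>UNIV. P_diag N \<rho> \<beta> i p y $ a $ b)"
    by (simp add: jac_def)
  also have "\<dots> = (\<Sum>i\<in>UNIV. if i = owner N a then P_diag N \<rho> \<beta> (owner N a) p y $ a $ b else 0)"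
    by (rule sum.cong) (auto simp: P_diag_def owned_def)
  finally show ?thesis by simp
qed

lemma jac_entry:
  fixes p y :: "real ^ 'k"
  defines "w \<equiv> \<lambda>a. mix (owner N a) (p, y)"
  shows "jac \<rho> \<beta> p y $ a $ b = (if owner N b = owner N a then
      partial_d b (res_fun \<beta> a) (w a) + (if a \<in> prims N \<and> a = b then \<rho> (owner N a) else 0) else 0)"
proof -
  have own: "mix (owner N a) (p, y) $ a = y $ a" if "a \<in> duals"
    using that not_prim by (intro mix_owned[of a "owner N a" "(p, y)", simplified]) (auto simp: owned_def)
  have far: "partial_d b (constr N a) x = 0" if "a \<in> duals" "b \<in> duals" for x
    by (rule partial_d_constr_far[OF that(1)]) (use that not_prim in blast)
  consider "a \<in> prims N" "b \<in> prims N" | "a \<in> prims N" "b \<in> duals" | "a \<in> duals" "b \<in> prims N"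
    | "a \<in> duals" "b \<in> duals" using index_partition by blast
  then show ?thesis
  proof cases
    case 1
    then show ?thesis
      using partial_d2_lagr_bar[of a "owner N a" b \<rho> p y]
      by (auto simp: jac_nth P_diag_def kinds[THEN iffD2] owned_def res_fun_simps w_def partial_d2_commute)
  next
    case 2
    then show ?thesis
      using index_partition(2)
      by (cases "kind_of N b") (auto simp: jac_nth P_diag_def kinds owned_def res_fun_simps w_def
          partial_d2_lagr_loc_dual partial_d_constr_bar kinds[THEN iffD2])
  next
    case 3
    then show ?thesis
      using index_partition own
      by (auto simp: jac_nth P_diag_def kinds[THEN iffD2] owned_def w_def
          partial_d_res_fun partial_d_constr_bar)
  next
    case 4
    then show ?thesis
      using index_partition own far
      by (auto simp: jac_nth P_diag_def kinds[THEN iffD2] owned_def w_def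
          partial_d_res_fun constr_bar_mix)
  qed
qed

lemma residual'_snd: "residual' \<rho> \<beta> ps (0, h) = jac \<rho> \<beta> ps (dual_part N ps) *v h"
proof (subst vec_eq_iff, intro allI)
  fix a
  have "(jac \<rho> \<beta> ps (dual_part N ps) *v h) $ a
      = (\<Sum>b\<in>UNIV. restr (owned N (owner N a)) h $ b * partial_d b (res_fun \<beta> a) ps
        + (if b = a then (if a \<in> prims N then \<rho> (owner N a) * h $ a else 0) else 0))"
    unfolding matrix_vector_mult_def
    by (auto simp: jac_entry owned_def algebra_simps intro!: sum.cong)
  then show "residual' \<rho> \<beta> ps (0, h) $ a = (jac \<rho> \<beta> ps (dual_part N ps) *v h) $ a"
    by (simp add: residual'_def sum.distrib)
qed

lemma A_matrix_entry:
  "A_matrix N \<beta> \<gamma> ps $ a $ b = partial_d b (res_fun \<beta> a) ps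
    + (if a \<in> prims N then \<Sum>j\<in>nbrs N (owner N a). partial_d b (partial_d a (lagr_loc N j)) ps else 0)
    + (if a \<in> prims N \<and> b \<in> prims N then
        \<gamma> * (\<Sum>c\<in>duals. (if c \<in> eqs N then 1 else (ps $ c)\<^sup>2)
          * (partial_d a (constr N c) ps * partial_d b (constr N c) ps)) else 0)"
proof -
  have far: "partial_d b (constr N a) x = 0" if "a \<in> duals" "b \<in> duals" for x
    by (rule partial_d_constr_far[OF that(1)]) (use that not_prim in blast)
  have lagr: "partial_d a (partial_d b (lagr N)) ps = partial_d b (res_fun \<beta> a) ps
    + (\<Sum>j\<in>nbrs N (owner N a). partial_d b (partial_d a (lagr_loc N j)) ps)"
    if "a \<in> prims N" "b \<in> prims N"
  proof -
    have "C_k 2 (lagr N)"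
      unfolding lagr_def[abs_def] by (intro C_k_sum C_k_mono[OF C_k_lagr_loc]) simp
    then have "partial_d a (partial_d b (lagr N)) ps = partial_d b (partial_d a (lagr N)) ps"
      by (rule partial_d_commute)
    moreover have "owner N a \<notin> nbrs N (owner N a)" by (simp add: nbrs_def)
    ultimately show ?thesis using that by (simp add: partial_d2_lagr res_fun_simps)
  qed
  have dual: "partial_d a (constr N b) ps = partial_d b (res_fun \<beta> a) ps
    + (\<Sum>j\<in>nbrs N (owner N a). partial_d b (partial_d a (lagr_loc N j)) ps)"
    if "a \<in> prims N" "b \<in> duals"
  proof -
    have "partial_d b (res_fun \<beta> a) ps + (\<Sum>j\<in>nbrs N (owner N a). partial_d b (partial_d a (lagr_loc N j)) ps)
        = (\<Sum>j\<in>insert (owner N a) (nbrs N (owner N a)). partial_d b (partial_d a (lagr_loc N j)) ps)"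
      using that by (simp add: res_fun_simps nbrs_def)
    also have "\<dots> = (\<Sum>j\<in>insert (owner N a) (nbrs N (owner N a)).
        if owner N b = j then partial_d a (constr N b) ps else 0)"
      using that by (simp only: partial_d2_lagr_loc_dual)
    also have "\<dots> = partial_d a (constr N b) ps"
    proof (cases "owner N b \<in> insert (owner N a) (nbrs N (owner N a))")
      case True
      then show ?thesis by (simp add: sum.delta')
    next
      case False
      then have "partial_d a (constr N b) ps = 0"
        using that nbrs_sym[of "owner N a" "owner N b"] by (intro partial_d_constr_far) auto
      then show ?thesis by simp
    qed
    finally show ?thesis by simp
  qed
  have R: "(\<Sum>k\<in>eqs N. partial_d a (constr N k) ps * partial_d b (constr N k) ps)
      + (\<Sum>k\<in>ineqs N. partial_d a (constr N k) ps * (ps $ k)\<^sup>2 * partial_d b (constr N k) ps)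
    = (\<Sum>c\<in>duals. (if c \<in> eqs N then 1 else (ps $ c)\<^sup>2)
          * (partial_d a (constr N c) ps * partial_d b (constr N c) ps))"
    using index_partition(3) by (subst sum.union_disjoint) (auto simp: ac_simps intro!: sum.cong)
  consider "a \<in> prims N" "b \<in> prims N" | "a \<in> prims N" "b \<in> duals" | "a \<in> duals" "b \<in> prims N"
    | "a \<in> duals" "b \<in> duals" using index_partition by blast
  then show ?thesis
  proof cases
    case 1
    then show ?thesis using lagr R by (simp add: A_matrix_def kinds[THEN iffD2])
  next
    case 2
    then have "b \<notin> prims N" using not_prim by blast
    then show ?thesis
      using dual 2 by (auto simp: A_matrix_def kinds[THEN iffD2])
  next
    case 3
    then have "a \<notin> prims N" using not_prim by blast
    then show ?thesis
      using 3 index_partition by (auto simp: A_matrix_def kinds[THEN iffD2] partial_d_res_fun)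
  next
    case 4
    then have "a \<notin> prims N" using not_prim by blast
    then show ?thesis
      using 4 index_partition far by (auto simp: A_matrix_def kinds[THEN iffD2] partial_d_res_fun)
  qed
qed

text \<open>
  At \<open>y = d(p)\<close> the local residuals assemble to the central KKT residual, whose Jacobian is \<open>A\<close> without
  the penalty term.
\<close>

lemma residual'_dual_part: "residual' \<rho> \<beta> ps (e, dual_part N e) = A_matrix N \<beta> 0 ps *v e"
proof (subst vec_eq_iff, intro allI)
  fix a
  have A0: "A_matrix N \<beta> 0 ps $ a $ b = partial_d b (res_fun \<beta> a) ps
    + (if a \<in> prims N then \<Sum>j\<in>nbrs N (owner N a). partial_d b (partial_d a (lagr_loc N j)) ps else 0)" for b
    unfolding A_matrix_entry by auto
  show "residual' \<rho> \<beta> ps (e, dual_part N e) $ a = (A_matrix N \<beta> 0 ps *v e) $ a"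
  proof (cases "a \<in> prims N")
    case True
    have "(A_matrix N \<beta> 0 ps *v e) $ a = (\<Sum>b\<in>UNIV. e $ b * partial_d b (res_fun \<beta> a) ps)
        + (\<Sum>b\<in>UNIV. \<Sum>j\<in>nbrs N (owner N a). e $ b * partial_d b (partial_d a (lagr_loc N j)) ps)"
      using True by (simp add: matrix_vector_mult_def A0 sum.distrib algebra_simps sum_distrib_left)
    moreover have "(\<Sum>b\<in>UNIV. \<Sum>j\<in>nbrs N (owner N a). e $ b * partial_d b (partial_d a (lagr_loc N j)) ps)
        = (\<Sum>j\<in>nbrs N (owner N a). \<Sum>b\<in>UNIV. e $ b * partial_d b (partial_d a (lagr_loc N j)) ps)"
      by (rule sum.swap)
    moreover have "dual_part N e $ a = 0" using True by (simp add: dual_part_def)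
    ultimately show ?thesis using True by (simp add: residual'_def)
  next
    case False
    then show ?thesis
      by (simp add: residual'_def matrix_vector_mult_def A0 mult.commute)
  qed
qed

end

section \<open>Stability of the Newton-type matrices at a KKT point\<close>

locale kkt_setting = nlp_setting N
  for N :: "('k::finite, 'v::finite) nlp" +
  fixes \<rho> :: "'v \<Rightarrow> real" and \<beta> :: real and ps :: "real ^ 'k"
  assumes kkt: "kkt_point N ps"
    and strict: "strict_complementarity N ps"
    and licq: "licq N ps"
    and sosc: "sosc N ps"
    and convex: "local_convexity N \<rho> ps"
    and compatible: "compatible_decomposition N ps"
    and beta: "\<beta> > 0"
begin

abbreviation "ys \<equiv> dual_part N ps"
abbreviation "binding \<equiv> eqs N \<union> active N ps"
abbreviation "slack \<equiv> ineqs N - active N ps"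

lemma binding_dual: "c \<in> binding \<Longrightarrow> c \<in> duals"
  by (auto simp: active_def)

lemma partition:
  "prims N \<union> binding \<union> slack = UNIV" "prims N \<inter> binding = {}" "prims N \<inter> slack = {}" "binding \<inter> slack = {}"
  using index_partition by (auto simp: active_def)

lemma constr_active: "c \<in> binding \<Longrightarrow> constr N c ps = 0"
  using kkt by (auto simp: kkt_point_def active_def)

lemma multiplier_active: "c \<in> active N ps \<Longrightarrow> ps $ c > 0"
  using strict by (auto simp: strict_complementarity_def)

lemma constr_slack: "c \<in> slack \<Longrightarrow> constr N c ps < 0"
  using kkt by (fastforce simp: kkt_point_def active_def)

lemma multiplier_slack: "c \<in> slack \<Longrightarrow> ps $ c = 0"
  using kkt by (fastforce simp: kkt_point_def active_def)

text \<open>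
  The factor by which a binding row of the Newton-type matrices differs from the negative of the
  corresponding column.
\<close>

definition row_weight :: "'k \<Rightarrow> real" where
  "row_weight c = (if c \<in> eqs N then \<beta> else \<beta> * ps $ c)"

lemma row_weight_pos: "c \<in> binding \<Longrightarrow> row_weight c > 0"
  using beta multiplier_active by (auto simp: row_weight_def)

lemma binding_row:
  assumes "a \<in> binding"
  shows "partial_d b (res_fun \<beta> a) ps
    = (if b \<in> prims N then - row_weight a * partial_d b (constr N a) ps else 0)"
  using constr_active[OF assms] binding_dual[OF assms] partial_d_constr_nonprim[of a b ps]
  by (auto simp: partial_d_res_fun row_weight_def)

lemma slack_row:
  assumes "a \<in> slack"
  shows "partial_d b (res_fun \<beta> a) ps = (if a = b then - \<beta> * constr N a ps else 0)"
  using multiplier_slack[OF assms] assms index_partition by (auto simp: partial_d_res_fun)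

lemma jac_ps:
  "jac \<rho> \<beta> ps ys $ a $ b = (if owner N b = owner N a then
      partial_d b (res_fun \<beta> a) ps + (if a \<in> prims N \<and> a = b then \<rho> (owner N a) else 0) else 0)"
  by (simp add: jac_entry)

text \<open>
  The primal part of \<open>J\<close> is block diagonal with the regularized local Hessians as blocks.
\<close>

lemma jac_pos_def: "pos_def_on (prims N) (jac \<rho> \<beta> ps ys)"
  unfolding pos_def_on_def
proof (intro allI impI)
  fix z :: "real ^ 'k" assume z: "z \<noteq> 0 \<and> (\<forall>k. k \<notin> prims N \<longrightarrow> z $ k = 0)"
  define W where "W i = hessian (lagr_loc N i) ps + \<rho> i *\<^sub>R mat 1" for i
  define r where "r i = restr (owned N i) z" for i
  have W: "0 < r i \<bullet> (W i *v r i)" if "r i \<noteq> 0" for i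
  proof -
    have "\<forall>k. k \<notin> prims N \<inter> owned N i \<longrightarrow> r i $ k = 0" using z by (auto simp: r_def)
    then show ?thesis using convex that unfolding local_convexity_def pos_def_on_def W_def by blast
  qed
  have W0: "0 \<le> r i \<bullet> (W i *v r i)" for i
    using W[of i] by (cases "r i = 0") (auto simp: less_imp_le)
  have row: "z $ a * (jac \<rho> \<beta> ps ys *v z) $ a = z $ a * (W (owner N a) *v r (owner N a)) $ a" for a
  proof (cases "a \<in> prims N")
    case True
    have "(jac \<rho> \<beta> ps ys *v z) $ a = (W (owner N a) *v r (owner N a)) $ a"
      unfolding matrix_vector_mult_def vec_lambda_beta
    proof (rule sum.cong)
      fix b
      show "jac \<rho> \<beta> ps ys $ a $ b * z $ b = W (owner N a) $ a $ b * r (owner N a) $ b"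
        using True
        by (simp add: jac_ps W_def r_def hessian_def mat_def owned_def res_fun_simps partial_d2_commute)
    qed simp
    then show ?thesis by simp
  qed (use z in simp)
  have "z \<bullet> (jac \<rho> \<beta> ps ys *v z) = (\<Sum>a\<in>UNIV. z $ a * (W (owner N a) *v r (owner N a)) $ a)"
    by (simp add: inner_vec_def row)
  also have "\<dots> = (\<Sum>i\<in>UNIV. \<Sum>a | a \<in> UNIV \<and> owner N a = i. z $ a * (W (owner N a) *v r (owner N a)) $ a)"
    by (rule sum.group[symmetric]) auto
  also have "\<dots> = (\<Sum>i\<in>UNIV. r i \<bullet> (W i *v r i))"
    by (rule sum.cong, simp, subst r_def, subst inner_restr) (auto simp: owned_def intro!: sum.cong)
  finally have eq: "z \<bullet> (jac \<rho> \<beta> ps ys *v z) = (\<Sum>i\<in>UNIV. r i \<bullet> (W i *v r i))" .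
  obtain a where "z $ a \<noteq> 0" using z by (auto simp: vec_eq_iff)
  then have "r (owner N a) \<noteq> 0" by (auto simp: r_def vec_eq_iff owned_def)
  then have "0 < (\<Sum>i\<in>UNIV. r i \<bullet> (W i *v r i))"
    by (intro sum_pos2[of UNIV "owner N a"] W W0) auto
  then show "0 < z \<bullet> (jac \<rho> \<beta> ps ys *v z)" by (simp add: eq)
qed

lemma jac_prim_dual:
  assumes "a \<in> prims N" "b \<in> duals"
  shows "jac \<rho> \<beta> ps ys $ a $ b = (if owner N b = owner N a then partial_d a (constr N b) ps else 0)"
  using assms index_partition(2)
  by (auto simp: jac_ps res_fun_simps partial_d2_lagr_loc_dual)

lemma jac_full_rank:
  assumes v: "\<forall>k. k \<notin> binding \<longrightarrow> v $ k = 0" and 0: "\<forall>a\<in>prims N. (jac \<rho> \<beta> ps ys *v v) $ a = 0"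
  shows "v = 0"
proof -
  have r0: "restr (owned N i) v = 0" for i
  proof (rule full_column_rank_injective[of _ "binding \<inter> owned N i"])
    let ?G = "grad_matrix N (prims N \<inter> owned N i) (binding \<inter> owned N i) ps"
    show "rank ?G = card (binding \<inter> owned N i)"
      using compatible by (simp add: compatible_decomposition_def)
    show "b \<notin> binding \<inter> owned N i \<Longrightarrow> ?G $ a $ b = 0" for a b
      by (auto simp: grad_matrix_def)
    show "\<forall>k. k \<notin> binding \<inter> owned N i \<longrightarrow> restr (owned N i) v $ k = 0" using v by auto
    show "?G *v restr (owned N i) v = 0"
    proof (subst vec_eq_iff, intro allI)
      fix a
      show "(?G *v restr (owned N i) v) $ a = 0 $ a"
      proof (cases "a \<in> prims N \<inter> owned N i")
        case True
        then have own: "owner N a = i" by (simp add: owned_def)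
        have "(?G *v restr (owned N i) v) $ a = (jac \<rho> \<beta> ps ys *v v) $ a"
          unfolding matrix_vector_mult_def vec_lambda_beta
        proof (rule sum.cong)
          fix b
          show "?G $ a $ b * restr (owned N i) v $ b = jac \<rho> \<beta> ps ys $ a $ b * v $ b"
          proof (cases "b \<in> binding")
            case True
            then show ?thesis
              using \<open>a \<in> prims N \<inter> owned N i\<close> own jac_prim_dual[of a b] binding_dual[OF True]
              by (auto simp: grad_matrix_def owned_def)
          next
            case False
            then show ?thesis using v by auto
          qed
        qed simp
        then show ?thesis using 0 True by simp
      next
        case False
        then have "?G $ a $ b = 0" for b by (auto simp: grad_matrix_def)
        then show ?thesis by (simp add: matrix_vector_mult_def)
      qed
    qed
  qed
  show "v = 0"
  proof (subst vec_eq_iff, intro allI)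
    fix k
    show "v $ k = 0 $ k" using r0[of "owner N k"] by (auto simp: vec_eq_iff owned_def split: if_splits)
  qed
qed

text \<open>
  The local KKT matrix is a saddle matrix, and a matrix with \<open>v \<bullet> P J v \<ge> c \<bar>v\<bar>\<^sup>2\<close> has trivial kernel.
\<close>

lemma jac_injective:
  assumes "jac \<rho> \<beta> ps ys *v h = 0"
  shows "h = 0"
proof -
  obtain P c where "c > 0" "\<And>v. c * (norm v)\<^sup>2 \<le> v \<bullet> (P *v (jac \<rho> \<beta> ps ys *v v))"
  proof (rule saddle_lyapunov[OF partition, of row_weight "jac \<rho> \<beta> ps ys"])
    show "a \<in> binding \<Longrightarrow> jac \<rho> \<beta> ps ys $ a $ b
        = (if b \<in> prims N then - row_weight a * jac \<rho> \<beta> ps ys $ b $ a else 0)" for a b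
      using binding_row[of a b] jac_prim_dual[of b a] binding_dual[of a] partition(2)
      by (auto simp: jac_ps)
    show "a \<in> slack \<Longrightarrow> a \<noteq> b \<Longrightarrow> jac \<rho> \<beta> ps ys $ a $ b = 0" for a b
      using slack_row[of a b] by (auto simp: jac_ps)
    show "a \<in> slack \<Longrightarrow> jac \<rho> \<beta> ps ys $ a $ a > 0" for a
      using slack_row[of a a] constr_slack[of a] partition(3) beta
      by (auto simp: jac_ps mult_pos_neg)
  qed (use row_weight_pos jac_pos_def jac_full_rank that in auto)
  from this(2)[of h] assms have "c * (norm h)\<^sup>2 \<le> 0" by simp
  with \<open>c > 0\<close> show ?thesis by (simp add: mult_le_0_iff)
qed

definition pen_weight :: "'k \<Rightarrow> real" where
  "pen_weight c = (if c \<in> eqs N then 1 else (ps $ c)\<^sup>2)"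

definition grad :: "'k \<Rightarrow> real ^ 'k" where
  "grad c = (\<chi> b. partial_d b (constr N c) ps)"

lemma A_matrix_penalty:
  "A_matrix N \<beta> \<gamma> ps $ a $ b = A_matrix N \<beta> 0 ps $ a $ b
    + (if a \<in> prims N then \<gamma> * (\<Sum>c\<in>duals. pen_weight c * (grad c $ a * grad c $ b)) else 0)"
proof -
  have "b \<notin> prims N \<Longrightarrow> (\<Sum>c\<in>duals. pen_weight c * (grad c $ a * grad c $ b)) = 0"
    by (intro sum.neutral) (auto simp: grad_def partial_d_constr_nonprim)
  then show ?thesis by (auto simp: A_matrix_entry pen_weight_def grad_def)
qed

text \<open>
  The penalty term is a sum of weighted squares \<open>(grad c \<bullet> z)\<^sup>2\<close>. Its weights are positive exactly on the
  binding constraints, by strict complementarity, so that it vanishes only on the critical directions of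
  SOSC.
\<close>

lemma A_matrix_pos_def:
  obtains \<gamma>0 where "\<And>\<gamma>. \<gamma> > \<gamma>0 \<Longrightarrow> pos_def_on (prims N) (A_matrix N \<beta> \<gamma> ps)"
proof -
  define q where "q z = (\<Sum>c\<in>duals. pen_weight c * (grad c \<bullet> z)\<^sup>2)" for z
  have w0: "pen_weight c \<ge> 0" for c by (simp add: pen_weight_def)
  have "continuous_on UNIV q"
    unfolding q_def by (intro continuous_intros)
  moreover have "q (c *\<^sub>R z) = c\<^sup>2 * q z" for c z
    by (simp add: q_def power_mult_distrib sum_distrib_left mult.left_commute)
  moreover have "q z \<ge> 0" for z
    unfolding q_def by (intro sum_nonneg mult_nonneg_nonneg w0) simp
  moreover have "z \<bullet> (hessian (lagr N) ps *v z) > 0"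
    if z: "z \<noteq> 0" "\<forall>k. k \<notin> prims N \<longrightarrow> z $ k = 0" and "q z = 0" for z
  proof -
    have "\<forall>c\<in>duals. pen_weight c * (grad c \<bullet> z)\<^sup>2 = 0"
      using \<open>q z = 0\<close> w0 unfolding q_def by (subst (asm) sum_nonneg_eq_0_iff) auto
    moreover have "pen_weight c \<noteq> 0" if "c \<in> binding" for c
      using that multiplier_active[of c] by (auto simp: pen_weight_def)
    ultimately have "grad c \<bullet> z = 0" if "c \<in> binding" for c
      using that binding_dual[OF that] by (metis mult_eq_0_iff power_eq_0_iff)
    moreover have "grad c \<bullet> z = (\<Sum>a \<in> prims N. partial_d a (constr N c) ps * z $ a)" for c
      unfolding inner_vec_def using z(2) by (intro sum.mono_neutral_cong_right) (auto simp: grad_def)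
    ultimately show ?thesis using sosc z unfolding sosc_def by auto
  qed
  ultimately obtain \<gamma>0 where \<gamma>0: "\<And>\<gamma> z. \<gamma> > \<gamma>0 \<Longrightarrow> z \<noteq> 0 \<Longrightarrow> \<forall>k. k \<notin> prims N \<longrightarrow> z $ k = 0
      \<Longrightarrow> z \<bullet> (hessian (lagr N) ps *v z) + \<gamma> * q z > 0"
    using pos_def_penalty[of q "prims N" "hessian (lagr N) ps"] by metis
  show thesis
  proof (rule that[of \<gamma>0])
    fix \<gamma> assume "\<gamma> > \<gamma>0"
    show "pos_def_on (prims N) (A_matrix N \<beta> \<gamma> ps)"
      unfolding pos_def_on_def
    proof (intro allI impI)
      fix z :: "real ^ 'k" assume z: "z \<noteq> 0 \<and> (\<forall>k. k \<notin> prims N \<longrightarrow> z $ k = 0)"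
      have "z $ a * A_matrix N \<beta> \<gamma> ps $ a $ b * z $ b = z $ a * hessian (lagr N) ps $ a $ b * z $ b
          + \<gamma> * (\<Sum>c\<in>duals. pen_weight c * ((grad c $ a * z $ a) * (grad c $ b * z $ b)))" for a b
      proof (cases "a \<in> prims N \<and> b \<in> prims N")
        case True
        have "A_matrix N \<beta> \<gamma> ps $ a $ b = hessian (lagr N) ps $ a $ b
            + \<gamma> * (\<Sum>c\<in>duals. pen_weight c * (grad c $ a * grad c $ b))"
          using True by (subst A_matrix_penalty) (simp add: A_matrix_def hessian_def kinds[THEN iffD2])
        then show ?thesis by (simp add: algebra_simps sum_distrib_left)
      next
        case False
        then have "z $ a = 0 \<or> z $ b = 0" using z by auto
        then show ?thesis by auto
      qed
      then have "z \<bullet> (A_matrix N \<beta> \<gamma> ps *v z) = z \<bullet> (hessian (lagr N) ps *v z)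
          + \<gamma> * (\<Sum>a\<in>UNIV. \<Sum>b\<in>UNIV. \<Sum>c\<in>duals. pen_weight c * ((grad c $ a * z $ a) * (grad c $ b * z $ b)))"
        by (simp add: quadratic_form_sum sum.distrib sum_distrib_left)
      also have "(\<Sum>a\<in>UNIV. \<Sum>b\<in>UNIV. \<Sum>c\<in>duals. pen_weight c * ((grad c $ a * z $ a) * (grad c $ b * z $ b)))
          = (\<Sum>a\<in>UNIV. \<Sum>c\<in>duals. \<Sum>b\<in>UNIV. pen_weight c * ((grad c $ a * z $ a) * (grad c $ b * z $ b)))"
        by (intro sum.cong refl sum.swap)
      also have "\<dots> = (\<Sum>c\<in>duals. \<Sum>a\<in>UNIV. \<Sum>b\<in>UNIV. pen_weight c * ((grad c $ a * z $ a) * (grad c $ b * z $ b)))"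
        by (rule sum.swap)
      also have "\<dots> = q z"
      proof -
        have "(grad c \<bullet> z)\<^sup>2 = (\<Sum>a\<in>UNIV. \<Sum>b\<in>UNIV. (grad c $ a * z $ a) * (grad c $ b * z $ b))" for c
          by (simp add: inner_vec_def power2_eq_square sum_product)
        then show ?thesis by (simp add: q_def sum_distrib_left)
      qed
      finally show "0 < z \<bullet> (A_matrix N \<beta> \<gamma> ps *v z)" using \<gamma>0[OF \<open>\<gamma> > \<gamma>0\<close>, of z] z by simp
    qed
  qed
qed

lemma A_prim_dual:
  assumes "a \<in> prims N" "b \<in> duals"
  shows "A_matrix N \<beta> \<gamma> ps $ a $ b = partial_d a (constr N b) ps"
  using assms by (auto simp: A_matrix_def kinds[THEN iffD2])

lemma A_dual: "a \<in> duals \<Longrightarrow> A_matrix N \<beta> \<gamma> ps $ a $ b = partial_d b (res_fun \<beta> a) ps"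
  using not_prim[of a] by (simp add: A_matrix_entry)

lemma A_full_rank:
  assumes v: "\<forall>k. k \<notin> binding \<longrightarrow> v $ k = 0" and 0: "\<forall>a\<in>prims N. (A_matrix N \<beta> \<gamma> ps *v v) $ a = 0"
  shows "v = 0"
proof (rule full_column_rank_injective[OF _ _ v])
  let ?G = "grad_matrix N (prims N) binding ps"
  show "rank ?G = card binding" using licq by (simp add: licq_def)
  show "b \<notin> binding \<Longrightarrow> ?G $ a $ b = 0" for a b by (simp add: grad_matrix_def)
  show "?G *v v = 0"
  proof (subst vec_eq_iff, intro allI)
    fix a
    show "(?G *v v) $ a = 0 $ a"
    proof (cases "a \<in> prims N")
      case True
      have "(?G *v v) $ a = (A_matrix N \<beta> \<gamma> ps *v v) $ a"
        unfolding matrix_vector_mult_def vec_lambda_beta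
      proof (rule sum.cong)
        fix b
        show "?G $ a $ b * v $ b = A_matrix N \<beta> \<gamma> ps $ a $ b * v $ b"
          using v True A_prim_dual[of a b \<gamma>] binding_dual[of b]
          by (cases "b \<in> binding") (auto simp: grad_matrix_def)
      qed simp
      then show ?thesis using 0 True by simp
    next
      case False
      then show ?thesis by (simp add: matrix_vector_mult_def grad_matrix_def)
    qed
  qed
qed

lemma A_lyapunov:
  assumes "pos_def_on (prims N) (A_matrix N \<beta> \<gamma> ps)"
  obtains P c where "transpose P = P" "c > 0" "\<And>v. c * (norm v)\<^sup>2 \<le> v \<bullet> (P *v v)"
    "\<And>v. c * (norm v)\<^sup>2 \<le> v \<bullet> (P *v (A_matrix N \<beta> \<gamma> ps *v v))"
proof (rule saddle_lyapunov[OF partition, of row_weight "A_matrix N \<beta> \<gamma> ps"])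
  show "a \<in> binding \<Longrightarrow> A_matrix N \<beta> \<gamma> ps $ a $ b
      = (if b \<in> prims N then - row_weight a * A_matrix N \<beta> \<gamma> ps $ b $ a else 0)" for a b
    using binding_row[of a b] A_prim_dual[of b a \<gamma>] binding_dual[of a] by (auto simp: A_dual)
  show "a \<in> slack \<Longrightarrow> a \<noteq> b \<Longrightarrow> A_matrix N \<beta> \<gamma> ps $ a $ b = 0" for a b
    using slack_row[of a b] by (auto simp: A_dual)
  show "a \<in> slack \<Longrightarrow> A_matrix N \<beta> \<gamma> ps $ a $ a > 0" for a
    using slack_row[of a a] constr_slack[of a] beta by (auto simp: A_dual mult_pos_neg)
qed (use row_weight_pos assms A_full_rank that in auto)

end

section \<open>Linearization of the algorithm\<close>

text \<open>
  A product rule in which the first factor need only have a limit, because the second one vanishes at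
  the point. Hence the matrices of the algorithm enter the linearization through their limits alone.
\<close>

lemma has_derivative_mult_vanishing:
  fixes m v :: "'a::real_normed_vector \<Rightarrow> real"
  assumes m: "(m \<longlongrightarrow> m0) (at a)" and v: "(v has_derivative v') (at a)" and v0: "v a = 0"
  shows "((\<lambda>p. m p * v p) has_derivative (\<lambda>e. m0 * v' e)) (at a)"
proof -
  have blv: "bounded_linear v'" using v by (rule has_derivative_bounded_linear)
  obtain K where K: "K > 0" "\<And>h. norm (v' h) \<le> norm h * K"
    using bounded_linear.pos_bounded[OF blv] by blast
  have quot: "((\<lambda>p. (v p - v' (p - a)) / norm (p - a)) \<longlongrightarrow> 0) (at a)"
  proof (rule tendsto_norm_zero_cancel)
    show "((\<lambda>p. norm ((v p - v' (p - a)) / norm (p - a))) \<longlongrightarrow> 0) (at a)"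
      using v v0 by (simp add: has_derivative_iff_norm norm_divide)
  qed
  have "((\<lambda>p. m p * ((v p - v' (p - a)) / norm (p - a)) + (m p - m0) * (v' (p - a) / norm (p - a))) \<longlongrightarrow> m0 * 0 + 0) (at a)"
  proof (intro tendsto_add tendsto_mult m quot)
    show "((\<lambda>p. (m p - m0) * (v' (p - a) / norm (p - a))) \<longlongrightarrow> 0) (at a)"
    proof (rule Lim_null_comparison)
      show "\<forall>\<^sub>F p in at a. norm ((m p - m0) * (v' (p - a) / norm (p - a))) \<le> \<bar>m p - m0\<bar> * K"
      proof (rule always_eventually, rule allI)
        fix p
        have "\<bar>v' (p - a)\<bar> / norm (p - a) \<le> K"
          using K(2)[of "p - a"] K(1) by (cases "p = a") (simp_all add: pos_divide_le_eq mult.commute)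
        from mult_left_mono[OF this, of "\<bar>m p - m0\<bar>"]
        show "norm ((m p - m0) * (v' (p - a) / norm (p - a))) \<le> \<bar>m p - m0\<bar> * K"
          by (simp add: abs_mult)
      qed
      have "((\<lambda>p. \<bar>m p - m0\<bar> * K) \<longlongrightarrow> \<bar>m0 - m0\<bar> * K) (at a)" by (intro tendsto_intros m)
      then show "((\<lambda>p. \<bar>m p - m0\<bar> * K) \<longlongrightarrow> 0) (at a)" by simp
    qed
  qed
  moreover have "m p * ((v p - v' (p - a)) / norm (p - a)) + (m p - m0) * (v' (p - a) / norm (p - a))
      = (m p * v p - m a * v a - m0 * v' (p - a)) / norm (p - a)" for p
  proof -
    have "m p * (v p - v' (p - a)) + (m p - m0) * v' (p - a) = m p * v p - m a * v a - m0 * v' (p - a)"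
      by (simp add: v0 algebra_simps)
    from arg_cong[OF this, of "\<lambda>t. t / norm (p - a)"] show ?thesis by (simp add: add_divide_distrib)
  qed
  ultimately have "((\<lambda>p. (m p * v p - m a * v a - m0 * v' (p - a)) / norm (p - a)) \<longlongrightarrow> 0) (at a)"
    by simp
  from tendsto_norm_zero[OF this] show ?thesis
    by (simp add: has_derivative_iff_norm norm_divide bounded_linear_const_mult[OF blv])
qed

lemma has_derivative_matrix_vanishing:
  fixes B :: "'a::real_normed_vector \<Rightarrow> real ^ 'k ^ 'k" and u :: "'a \<Rightarrow> real ^ 'k"
  assumes B: "(B \<longlongrightarrow> B0) (at a)" and u: "(u has_derivative u') (at a)" and u0: "u a = 0"
  shows "((\<lambda>p. B p *v u p) has_derivative (\<lambda>e. B0 *v u' e)) (at a)"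
proof -
  have comp: "((\<lambda>p. u p $ j) has_derivative (\<lambda>e. u' e $ j)) (at a)" for j
    by (rule bounded_linear.has_derivative[OF bounded_linear_vec_nth u])
  have "((\<lambda>p. B p $ k $ j) \<longlongrightarrow> B0 $ k $ j) (at a)" for k j
    by (intro tendsto_vec_nth B)
  then have row: "((\<lambda>p. \<Sum>j\<in>UNIV. B p $ k $ j * u p $ j) has_derivative (\<lambda>e. \<Sum>j\<in>UNIV. B0 $ k $ j * u' e $ j)) (at a)" for k
    by (intro has_derivative_sum has_derivative_mult_vanishing comp) (simp_all add: u0)
  have "((\<lambda>p. \<Sum>k\<in>UNIV. (\<Sum>j\<in>UNIV. B p $ k $ j * u p $ j) *\<^sub>R axis k (1::real)) has_derivative
      (\<lambda>e. \<Sum>k\<in>UNIV. (\<Sum>j\<in>UNIV. B0 $ k $ j * u' e $ j) *\<^sub>R axis k 1)) (at a)"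
    by (rule has_derivative_sum) (rule bounded_linear.has_derivative[OF bounded_linear_scaleR_left row])
  moreover have "(\<Sum>k\<in>UNIV. (\<Sum>j\<in>UNIV. M $ k $ j * v $ j) *\<^sub>R axis k (1::real)) = M *v v"
    for M :: "real ^ 'k ^ 'k" and v
    using basis_expansion[of "M *v v"] by (simp add: scalar_mult_eq_scaleR matrix_vector_mult_def)
  ultimately show ?thesis by simp
qed

lemma tendsto_entries:
  assumes "\<And>a b. ((\<lambda>p. B p $ a $ b) \<longlongrightarrow> B0 $ a $ b) F"
  shows "(B \<longlongrightarrow> (B0 :: real ^ 'n ^ 'm)) F"
  by (intro vec_tendstoI assms)

lemma sum_matrix_vector_mult:
  "(\<Sum>i\<in>I. M i) *v x = (\<Sum>i\<in>I. M i *v (x :: real ^ 'n))" for M :: "'i \<Rightarrow> real ^ 'n ^ 'm"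
  by (induction I rule: infinite_finite_induct) (simp_all add: matrix_vector_mult_add_rdistrib)

context kkt_setting
begin

lemma residual_zero: "residual \<rho> \<beta> (ps, ys) = 0"
proof (subst vec_eq_iff, intro allI)
  fix a
  consider "a \<in> prims N" | "a \<in> eqs N" | "a \<in> ineqs N" using index_partition(1) by blast
  then show "residual \<rho> \<beta> (ps, ys) $ a = 0 $ a"
  proof cases
    case 1
    have "partial_d a (lagr N) ps = 0" using kkt 1 by (simp add: kkt_point_def)
    then have "partial_d a (lagr_loc N (owner N a)) ps + (\<Sum>j\<in>nbrs N (owner N a). partial_d a (lagr_loc N j) ps) = 0"
      using partial_d_lagr_nbrs[OF 1, of ps] by (simp add: nbrs_def)
    moreover have "ys $ a = 0" using 1 by (simp add: dual_part_def)
    ultimately show ?thesis using 1 by (simp add: residual_def res_fun_simps)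
  next
    case 2
    then show ?thesis using kkt index_partition(4) by (auto simp: residual_def res_fun_simps kkt_point_def)
  next
    case 3
    then show ?thesis using kkt index_partition(5) by (auto simp: residual_def res_fun_simps kkt_point_def)
  qed
qed

text \<open>
  Near the KKT point the inequalities of the local KKT systems are decided by strict complementarity:
  multipliers of active constraints stay positive and inactive constraints stay negative, so that the
  systems reduce to equations.
\<close>

lemma local_kkt_iff_residual:
  obtains \<delta> \<epsilon> where "\<delta> > 0" "\<epsilon> > 0"
    "\<And>p y. p \<in> ball ps \<delta> \<Longrightarrow> y \<in> ball ys \<epsilon> \<Longrightarrow> local_kkt N \<rho> p y \<longleftrightarrow> residual \<rho> \<beta> (p, y) = 0"
proof -
  have lin: "((\<lambda>z. mix i z) \<longlongrightarrow> mix i (ps, ys)) (nhds (ps, ys))" for i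
    by (rule bounded_linear.tendsto[OF bounded_linear_mix filterlim_ident])
  have "\<forall>\<^sub>F z in nhds (ps, ys). snd z $ a > 0" if "a \<in> active N ps" for a
  proof -
    have "((\<lambda>z. snd z $ a) \<longlongrightarrow> snd (ps, ys) $ a) (nhds (ps, ys))"
      by (rule bounded_linear.tendsto[OF bounded_linear_compose[OF bounded_linear_vec_nth bounded_linear_snd] filterlim_ident])
    moreover have "ys $ a > 0" using multiplier_active[OF that] that index_partition(5)
      by (auto simp: dual_part_def active_def)
    ultimately show ?thesis using order_tendstoD(1) by fastforce
  qed
  moreover have "\<forall>\<^sub>F z in nhds (ps, ys). constr N a (mix (owner N a) z) < 0" if "a \<in> slack" for a
  proof -
    have "isCont (constr N a) ps" using that C_k_isCont[OF C_k_constr] by blast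
    then have "((\<lambda>z. constr N a (mix (owner N a) z)) \<longlongrightarrow> constr N a ps) (nhds (ps, ys))"
      using isCont_tendsto_compose[OF _ lin[of "owner N a"], of "constr N a"] by simp
    then show ?thesis using constr_slack[OF that] by (rule order_tendstoD(2))
  qed
  ultimately have "\<forall>\<^sub>F z in nhds (ps, ys). (\<forall>a\<in>active N ps. snd z $ a > 0)
      \<and> (\<forall>a\<in>slack. constr N a (mix (owner N a) z) < 0)"
    by (intro eventually_conj eventually_ball_finite) auto
  then obtain d where d: "d > 0" "\<And>z. dist z (ps, ys) < d \<Longrightarrow> (\<forall>a\<in>active N ps. snd z $ a > 0)
      \<and> (\<forall>a\<in>slack. constr N a (mix (owner N a) z) < 0)"
    unfolding eventually_nhds_metric by blast
  show thesis
  proof (rule that[of "d / 2" "d / 2"])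
    fix p y assume py: "p \<in> ball ps (d / 2)" "y \<in> ball ys (d / 2)"
    have "dist (p, y) (ps, ys) \<le> dist p ps + dist y ys"
      by (rule dist_Pair_le)
    also have "\<dots> < d" using py by (simp add: dist_commute)
    finally have near: "\<And>a. a \<in> active N ps \<Longrightarrow> y $ a > 0"
      "\<And>a. a \<in> slack \<Longrightarrow> constr_bar N a p y < 0"
      using d(2)[of "(p, y)"] by (auto simp: constr_bar_mix)
    have ineq: "(constr_bar N a p y \<le> 0 \<and> y $ a \<ge> 0 \<and> y $ a * constr_bar N a p y = 0)
        \<longleftrightarrow> y $ a * constr_bar N a p y = 0" if "a \<in> ineqs N" for a
    proof (cases "a \<in> active N ps")
      case True
      then show ?thesis using near(1)[of a] by auto
    next
      case False
      then show ?thesis using near(2)[of a] that by auto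
    qed
    have "residual \<rho> \<beta> (p, y) = 0 \<longleftrightarrow> (\<forall>a\<in>prims N. residual \<rho> \<beta> (p, y) $ a = 0)
        \<and> (\<forall>a\<in>eqs N. residual \<rho> \<beta> (p, y) $ a = 0) \<and> (\<forall>a\<in>ineqs N. residual \<rho> \<beta> (p, y) $ a = 0)"
      using index_partition(1) by (auto simp: vec_eq_iff)
    then show "local_kkt N \<rho> p y \<longleftrightarrow> residual \<rho> \<beta> (p, y) = 0"
      using ineq beta by (simp add: local_kkt_def residual_simps)
  qed (use d in auto)
qed

text \<open>
  The implicit function theorem, applied to the stacked local KKT equations.
\<close>

lemma differentiable_solution_map:
  obtains \<phi> \<phi>' where "local_solution_map N \<rho> ps \<phi>" "(\<phi> has_derivative \<phi>') (at ps)"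
    "\<And>e. residual' \<rho> \<beta> ps (e, \<phi>' e) = 0"
proof -
  obtain \<delta>1 \<epsilon>1 where 1: "\<delta>1 > 0" "\<epsilon>1 > 0"
    "\<And>p y. p \<in> ball ps \<delta>1 \<Longrightarrow> y \<in> ball ys \<epsilon>1 \<Longrightarrow> local_kkt N \<rho> p y \<longleftrightarrow> residual \<rho> \<beta> (p, y) = 0"
    using local_kkt_iff_residual by metis
  obtain \<phi> \<phi>' \<delta>2 \<epsilon>2 where 2: "\<delta>2 > 0" "\<epsilon>2 > 0" "\<phi> ps = ys" "(\<phi> has_derivative \<phi>') (at ps)"
    "\<And>e. residual' \<rho> \<beta> ps (e, \<phi>' e) = 0"
    "\<And>p y. p \<in> ball ps \<delta>2 \<Longrightarrow> y \<in> ball ys \<epsilon>2 \<Longrightarrow> residual \<rho> \<beta> (p, y) = 0 \<longleftrightarrow> y = \<phi> p"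
  proof (rule implicit_function[OF residual_strict_derivative residual_zero])
    show "residual' \<rho> \<beta> ps (0, h) = 0 \<Longrightarrow> h = 0" for h
      using jac_injective by (simp add: residual'_snd)
  qed (use that in blast)
  define \<epsilon> where "\<epsilon> = min \<epsilon>1 \<epsilon>2"
  have "\<epsilon> > 0" using 1 2 by (simp add: \<epsilon>_def)
  have "isCont \<phi> ps" using has_derivative_continuous[OF 2(4)] .
  then obtain \<delta>3 where 3: "\<delta>3 > 0" "\<And>p. dist p ps < \<delta>3 \<Longrightarrow> dist (\<phi> p) (\<phi> ps) < \<epsilon>"
    using \<open>\<epsilon> > 0\<close> unfolding continuous_at_eps_delta by blast
  have "local_solution_map N \<rho> ps \<phi>"
    unfolding local_solution_map_def
  proof (intro conjI exI ballI)
    show "min \<delta>1 (min \<delta>2 \<delta>3) > 0" using 1 2 3 by simp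
    fix p assume p: "p \<in> ball ps (min \<delta>1 (min \<delta>2 \<delta>3))"
    show "\<phi> p \<in> ball ys \<epsilon>" using 3(2)[of p] 2(3) p by (simp add: dist_commute)
    fix y assume y: "y \<in> ball ys \<epsilon>"
    show "local_kkt N \<rho> p y \<longleftrightarrow> y = \<phi> p"
      using 1(3)[of p y] 2(6)[of p y] p y by (simp add: \<epsilon>_def)
  qed (use 2 \<open>\<epsilon> > 0\<close> in auto)
  then show thesis using 2(4,5) by (rule that)
qed

text \<open>
  Every solution map agrees near the KKT point with the one from the implicit function theorem, by
  local uniqueness of the solutions.
\<close>

lemma local_solution_map_derivative:
  assumes "local_solution_map N \<rho> ps \<Phi>"
  obtains \<Phi>' where "\<Phi> ps = ys" "(\<Phi> has_derivative \<Phi>') (at ps)"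
    "\<And>e. residual' \<rho> \<beta> ps (e, \<Phi>' e) = 0"
proof -
  obtain \<phi> \<phi>' where \<phi>: "local_solution_map N \<rho> ps \<phi>" "(\<phi> has_derivative \<phi>') (at ps)"
    "\<And>e. residual' \<rho> \<beta> ps (e, \<phi>' e) = 0"
    using differentiable_solution_map by blast
  from \<phi>(1) obtain \<delta> \<epsilon> where *: "\<phi> ps = ys" "\<delta> > 0" "\<epsilon> > 0"
    "\<forall>p\<in>ball ps \<delta>. \<phi> p \<in> ball ys \<epsilon> \<and> (\<forall>y\<in>ball ys \<epsilon>. local_kkt N \<rho> p y \<longleftrightarrow> y = \<phi> p)"
    unfolding local_solution_map_def by blast
  from assms obtain \<delta>1 \<epsilon>1 where 1: "\<Phi> ps = ys" "\<delta>1 > 0" "\<epsilon>1 > 0"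
    "\<forall>p\<in>ball ps \<delta>1. \<Phi> p \<in> ball ys \<epsilon>1 \<and> (\<forall>y\<in>ball ys \<epsilon>1. local_kkt N \<rho> p y \<longleftrightarrow> y = \<Phi> p)"
    unfolding local_solution_map_def by blast
  \<comment> \<open>Where \<open>\<phi>\<close> takes values in the uniqueness region of \<open>\<Phi>\<close>, the two branches coincide.\<close>
  have "isCont \<phi> ps" using has_derivative_continuous[OF \<phi>(2)] .
  then obtain \<delta>3 where 3: "\<delta>3 > 0" "\<And>p. dist p ps < \<delta>3 \<Longrightarrow> dist (\<phi> p) (\<phi> ps) < \<epsilon>1"
    using \<open>\<epsilon>1 > 0\<close> unfolding continuous_at_eps_delta by blast
  define d where "d = min \<delta> (min \<delta>1 \<delta>3)"
  have same: "\<phi> p = \<Phi> p" if "p \<in> ball ps d" for p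
  proof -
    have p: "p \<in> ball ps \<delta>" "p \<in> ball ps \<delta>1" using that by (auto simp: d_def)
    have "\<phi> p \<in> ball ys \<epsilon>1" using 3(2)[of p] that *(1) by (simp add: dist_commute d_def)
    moreover have "local_kkt N \<rho> p (\<phi> p)" using *(4) p by blast
    ultimately show ?thesis using 1(4) p by blast
  qed
  have "(\<Phi> has_derivative \<phi>') (at ps)"
    by (rule has_derivative_transform_within_open[OF \<phi>(2), of "ball ps d"])
      (use same * 1 3 in \<open>auto simp: d_def\<close>)
  then show thesis using that 1(1) \<phi>(3) by blast
qed

definition coup :: "real \<Rightarrow> real ^ 'k \<Rightarrow> real ^ 'k \<Rightarrow> real ^ 'k ^ 'k" where
  "coup \<gamma> p y = (\<Sum>i\<in>UNIV. \<Sum>j\<in>insert i (nbrs N i). P_coup N \<gamma> i j p y)"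

lemma coup_entry:
  "coup \<gamma> p y $ a $ b = (if a \<in> prims N \<and> b \<in> prims N \<and> owner N b \<in> insert (owner N a) (nbrs N (owner N a)) then
     \<gamma> * (\<Sum>c \<in> duals \<inter> owned N (owner N b). (if c \<in> eqs N then 1 else (y $ c)\<^sup>2)
        * (partial_d a (constr N c) (shift N (owner N b) p y) * partial_d b (constr N c) (shift N (owner N b) p y)))
   else 0)"
proof -
  let ?i = "owner N a" and ?j = "owner N b"
  have "coup \<gamma> p y $ a $ b = (\<Sum>i\<in>UNIV. \<Sum>j\<in>insert i (nbrs N i). P_coup N \<gamma> i j p y $ a $ b)"
    by (simp add: coup_def del: sum.insert)
  also have "\<dots> = (\<Sum>i\<in>UNIV. if i = ?i then \<Sum>j\<in>insert ?i (nbrs N ?i). P_coup N \<gamma> ?i j p y $ a $ b else 0)"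
    by (intro sum.cong refl) (auto simp: P_coup_def owned_def simp del: sum.insert intro!: sum.neutral)
  also have "\<dots> = (\<Sum>j\<in>insert ?i (nbrs N ?i). P_coup N \<gamma> ?i j p y $ a $ b)" by simp
  also have "\<dots> = (\<Sum>j\<in>insert ?i (nbrs N ?i). if j = ?j then P_coup N \<gamma> ?i ?j p y $ a $ b else 0)"
    by (intro sum.cong refl) (auto simp: P_coup_def owned_def)
  also have "\<dots> = (if ?j \<in> insert ?i (nbrs N ?i) then P_coup N \<gamma> ?i ?j p y $ a $ b else 0)"
    by (simp only: sum.delta finite)
  also have "P_coup N \<gamma> ?i ?j p y $ a $ b = (if a \<in> prims N \<and> b \<in> prims N then
     \<gamma> * (\<Sum>c \<in> duals \<inter> owned N ?j. (if c \<in> eqs N then 1 else (y $ c)\<^sup>2)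
        * (partial_d a (constr N c) (shift N ?j p y) * partial_d b (constr N c) (shift N ?j p y))) else 0)"
  proof -
    have "duals \<inter> owned N ?j = (eqs N \<inter> owned N ?j) \<union> (ineqs N \<inter> owned N ?j)" by auto
    moreover have "(eqs N \<inter> owned N ?j) \<inter> (ineqs N \<inter> owned N ?j) = {}" using index_partition by blast
    moreover have "c \<in> ineqs N \<Longrightarrow> c \<notin> eqs N" for c using index_partition by blast
    ultimately show ?thesis
      by (auto simp: P_coup_def owned_def sum.union_disjoint ac_simps intro!: sum.cong)
  qed
  finally show ?thesis by auto
qed

text \<open>
  The direction of a step. The coupling matrices act on the primal part of \<open>\<Phi> p\<close> only, and writing this
  out makes both vectors vanish at the KKT point.
\<close>

definition direction :: "real \<Rightarrow> (real ^ 'k \<Rightarrow> real ^ 'k) \<Rightarrow> real ^ 'k \<Rightarrow> real ^ 'k" where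
  "direction \<gamma> \<Phi> p = jac \<rho> \<beta> p (\<Phi> p) *v (\<Phi> p - dual_part N p) + coup \<gamma> p (\<Phi> p) *v restr (prims N) (\<Phi> p)"

lemma sbdp_step_direction: "sbdp_step N \<rho> \<Phi> \<alpha> \<beta> \<gamma> p = p + \<alpha> *\<^sub>R direction \<gamma> \<Phi> p"
proof -
  have "coup \<gamma> p (\<Phi> p) *v restr (prims N) (\<Phi> p) = coup \<gamma> p (\<Phi> p) *v \<Phi> p"
    unfolding matrix_vector_mult_def vec_eq_iff vec_lambda_beta
    by (intro allI sum.cong refl) (auto simp: coup_entry)
  then show ?thesis
    by (simp add: sbdp_step_def direction_def jac_def coup_def sum_matrix_vector_mult sum.distrib del: sum.insert)
qed

lemma direction_zero: "\<Phi> ps = ys \<Longrightarrow> direction \<gamma> \<Phi> ps = 0"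
proof -
  have "restr (prims N) ys = 0" by (simp add: vec_eq_iff dual_part_def)
  then show "\<Phi> ps = ys \<Longrightarrow> direction \<gamma> \<Phi> ps = 0" by (simp add: direction_def)
qed

text \<open>
  The linearized local constraints: the primal step of agent \<open>owner N c\<close> cancels the first-order change
  of each of its constraints with positive penalty weight.
\<close>

lemma linearized_constraint:
  assumes "c \<in> duals" "residual' \<rho> \<beta> ps (e, h) = 0"
  shows "pen_weight c * (\<Sum>b\<in>UNIV. if b \<in> prims N \<and> owner N b = owner N c then grad c $ b * h $ b else 0)
    = - (pen_weight c * (grad c \<bullet> e))"
proof -
  let ?S = "\<Sum>b\<in>UNIV. if b \<in> prims N \<and> owner N b = owner N c then grad c $ b * h $ b else 0"
  have mixsum: "(\<Sum>b\<in>UNIV. mix (owner N c) (e, h) $ b * grad c $ b) = grad c \<bullet> e + ?S"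
    unfolding inner_vec_def sum.distrib[symmetric]
  proof (intro sum.cong refl)
    fix b
    have "b \<notin> prims N \<Longrightarrow> grad c $ b = 0" using assms(1) by (simp add: grad_def partial_d_constr_nonprim)
    then show "mix (owner N c) (e, h) $ b * grad c $ b = grad c $ b \<bullet> e $ b
        + (if b \<in> prims N \<and> owner N b = owner N c then grad c $ b * h $ b else 0)"
      by (auto simp: mix_def owned_def algebra_simps)
  qed
  have nprim: "c \<notin> prims N" using assms(1) not_prim by blast
  have "residual' \<rho> \<beta> ps (e, h) $ c = 0" using assms(2) by simp
  then have row: "(\<Sum>b\<in>UNIV. mix (owner N c) (e, h) $ b * partial_d b (res_fun \<beta> c) ps) = 0"
    using nprim by (simp add: residual'_def)
  show ?thesis
  proof (cases "c \<in> binding")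
    case True
    have "mix (owner N c) (e, h) $ b * partial_d b (res_fun \<beta> c) ps
        = - row_weight c * (mix (owner N c) (e, h) $ b * grad c $ b)" for b
      using binding_row[OF True, of b] partial_d_constr_nonprim[OF assms(1), of b ps]
      by (auto simp: grad_def)
    with row have "- row_weight c * (grad c \<bullet> e + ?S) = 0"
      unfolding mixsum[symmetric] by (simp add: sum_distrib_left)
    then have "grad c \<bullet> e + ?S = 0" using row_weight_pos[OF True] by simp
    then have "?S = - (grad c \<bullet> e)" by linarith
    then show ?thesis by simp
  next
    case False
    then have "c \<in> slack" "c \<notin> eqs N" using assms(1) by auto
    then show ?thesis using multiplier_slack by (simp add: pen_weight_def)
  qed
qed

text \<open>
  For a constraint with positive penalty weight, the gradient in its owner's variables, applied to the
  owner's step, is \<open>- (grad c \<bullet> e)\<close> to first order, so that the coupling terms assemble to \<open>- \<gamma> R e\<close>. Agents that are not adjacent can be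
  included in the sums, since their constraints have zero gradient in the agent's variables.
\<close>

lemma coup_linearized:
  assumes "residual' \<rho> \<beta> ps (e, h) = 0"
  shows "(coup \<gamma> ps ys *v restr (prims N) h) $ a
    = - (if a \<in> prims N then \<gamma> * (\<Sum>c\<in>duals. pen_weight c * (grad c $ a * (grad c \<bullet> e))) else 0)"
proof (cases "a \<in> prims N")
  case False
  then show ?thesis by (simp add: matrix_vector_mult_def coup_entry)
next
  case True
  have shift_ps: "shift N j ps ys = ps" for j
    by (auto simp: shift_def dual_part_def vec_eq_iff)
  have weight: "(if c \<in> eqs N then 1 else (ys $ c)\<^sup>2) = pen_weight c" if "c \<in> duals" for c
    using that not_prim[of c] by (simp add: pen_weight_def dual_part_def)
  have entry: "coup \<gamma> ps ys $ a $ b * restr (prims N) h $ b = \<gamma> * (\<Sum>c\<in>duals. pen_weight c * (grad c $ a *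
      (if b \<in> prims N \<and> owner N b = owner N c then grad c $ b * h $ b else 0)))" for b
  proof (cases "b \<in> prims N")
    case b: True
    have "(\<Sum>c\<in>duals. pen_weight c * (grad c $ a *
        (if b \<in> prims N \<and> owner N b = owner N c then grad c $ b * h $ b else 0)))
      = (\<Sum>c\<in>duals \<inter> owned N (owner N b). pen_weight c * (grad c $ a * (grad c $ b * h $ b)))"
      using b by (intro sum.mono_neutral_cong_right) (auto simp: owned_def)
    also have "\<dots> = (\<Sum>c\<in>duals \<inter> owned N (owner N b). pen_weight c * (grad c $ a * grad c $ b)) * h $ b"
      by (simp add: sum_distrib_right mult.assoc)
    finally have rhs: "(\<Sum>c\<in>duals. pen_weight c * (grad c $ a *
        (if b \<in> prims N \<and> owner N b = owner N c then grad c $ b * h $ b else 0)))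
      = (\<Sum>c\<in>duals \<inter> owned N (owner N b). pen_weight c * (grad c $ a * grad c $ b)) * h $ b" .
    have "coup \<gamma> ps ys $ a $ b = \<gamma> * (\<Sum>c\<in>duals \<inter> owned N (owner N b). pen_weight c * (grad c $ a * grad c $ b))"
    proof (cases "owner N b \<in> insert (owner N a) (nbrs N (owner N a))")
      case near: True
      have "(\<Sum>c\<in>duals \<inter> owned N (owner N b). (if c \<in> eqs N then 1 else (ys $ c)\<^sup>2) *
          (partial_d a (constr N c) ps * partial_d b (constr N c) ps))
        = (\<Sum>c\<in>duals \<inter> owned N (owner N b). pen_weight c * (grad c $ a * grad c $ b))"
        by (rule sum.cong) (simp_all add: weight grad_def)
      then show ?thesis using True b near by (simp add: coup_entry shift_ps)
    next
      case far: False
      have "grad c $ a = 0" if "c \<in> duals \<inter> owned N (owner N b)" for c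
        using that far nbrs_sym[of "owner N a" "owner N b"]
        by (auto simp: grad_def owned_def intro!: partial_d_constr_far)
      then show ?thesis using far by (simp add: coup_entry)
    qed
    then show ?thesis using b unfolding rhs by simp
  qed simp
  have "(coup \<gamma> ps ys *v restr (prims N) h) $ a = (\<Sum>b\<in>UNIV. \<gamma> * (\<Sum>c\<in>duals. pen_weight c * (grad c $ a *
      (if b \<in> prims N \<and> owner N b = owner N c then grad c $ b * h $ b else 0))))"
    unfolding matrix_vector_mult_def vec_lambda_beta entry ..
  also have "\<dots> = \<gamma> * (\<Sum>b\<in>UNIV. \<Sum>c\<in>duals. pen_weight c * (grad c $ a *
      (if b \<in> prims N \<and> owner N b = owner N c then grad c $ b * h $ b else 0)))"
    by (simp only: sum_distrib_left)
  also have "\<dots> = \<gamma> * (\<Sum>c\<in>duals. \<Sum>b\<in>UNIV. pen_weight c * (grad c $ a *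
      (if b \<in> prims N \<and> owner N b = owner N c then grad c $ b * h $ b else 0)))"
    by (subst sum.swap) (rule refl)
  also have "\<dots> = \<gamma> * (\<Sum>c\<in>duals. grad c $ a * (pen_weight c *
      (\<Sum>b\<in>UNIV. if b \<in> prims N \<and> owner N b = owner N c then grad c $ b * h $ b else 0)))"
    by (simp only: sum_distrib_left mult.left_commute[of "pen_weight _"])
  also have "\<dots> = \<gamma> * (\<Sum>c\<in>duals. grad c $ a * - (pen_weight c * (grad c \<bullet> e)))"
    by (intro arg_cong2[where f = "(*)"] sum.cong refl) (simp only: linearized_constraint[OF _ assms])
  also have "\<dots> = - (\<gamma> * (\<Sum>c\<in>duals. pen_weight c * (grad c $ a * (grad c \<bullet> e))))"
    by (simp add: sum_negf mult.left_commute)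
  finally show ?thesis using True by simp
qed

lemma A_matrix_mult:
  "(A_matrix N \<beta> \<gamma> ps *v e) $ a = (A_matrix N \<beta> 0 ps *v e) $ a
    + (if a \<in> prims N then \<gamma> * (\<Sum>c\<in>duals. pen_weight c * (grad c $ a * (grad c \<bullet> e))) else 0)"
proof -
  have "(A_matrix N \<beta> \<gamma> ps *v e) $ a = (\<Sum>b\<in>UNIV. A_matrix N \<beta> 0 ps $ a $ b * e $ b
    + (if a \<in> prims N then \<gamma> * (\<Sum>c\<in>duals. pen_weight c * (grad c $ a * grad c $ b)) else 0) * e $ b)"
    unfolding matrix_vector_mult_def vec_lambda_beta
    by (intro sum.cong refl) (subst A_matrix_penalty, simp add: algebra_simps)
  moreover have "(\<Sum>b\<in>UNIV. \<gamma> * (\<Sum>c\<in>duals. pen_weight c * (grad c $ a * grad c $ b)) * e $ b)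
      = \<gamma> * (\<Sum>c\<in>duals. pen_weight c * (grad c $ a * (grad c \<bullet> e)))"
  proof -
    have "(\<Sum>b\<in>UNIV. \<gamma> * (\<Sum>c\<in>duals. pen_weight c * (grad c $ a * grad c $ b)) * e $ b)
        = \<gamma> * (\<Sum>b\<in>UNIV. \<Sum>c\<in>duals. pen_weight c * (grad c $ a * (grad c $ b * e $ b)))"
      by (simp add: sum_distrib_left sum_distrib_right mult.assoc)
    also have "\<dots> = \<gamma> * (\<Sum>c\<in>duals. \<Sum>b\<in>UNIV. pen_weight c * (grad c $ a * (grad c $ b * e $ b)))"
      by (subst sum.swap) (rule refl)
    finally show ?thesis by (simp add: inner_vec_def sum_distrib_left)
  qed
  ultimately show ?thesis
    by (simp add: sum.distrib matrix_vector_mult_def)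
qed

lemma direction_derivative:
  assumes "local_solution_map N \<rho> ps \<Phi>"
  shows "(direction \<gamma> \<Phi> has_derivative (\<lambda>e. - (A_matrix N \<beta> \<gamma> ps *v e))) (at ps)"
proof -
  obtain \<Phi>' where \<Phi>: "\<Phi> ps = ys" "(\<Phi> has_derivative \<Phi>') (at ps)"
    "\<And>e. residual' \<rho> \<beta> ps (e, \<Phi>' e) = 0"
    using local_solution_map_derivative[OF assms] by blast
  have lim\<Phi>: "(\<Phi> \<longlongrightarrow> ys) (at ps)"
    using has_derivative_continuous[OF \<Phi>(2)] \<Phi>(1) by (simp add: isCont_def)
  have linD: "bounded_linear (dual_part N)"
    unfolding linear_conv_bounded_linear[symmetric]
    by (rule linearI) (auto simp: dual_part_def vec_eq_iff)
  have limmix: "((\<lambda>p. mix i (p, \<Phi> p)) \<longlongrightarrow> ps) (at ps)" for i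
    using bounded_linear.tendsto[OF bounded_linear_mix tendsto_Pair[OF tendsto_ident_at lim\<Phi>], of i] by simp
  have C0: "C_k 1 (res_fun \<beta> a)" for a by (rule C_k_mono[OF C_k_res_fun]) simp
  have contC: "isCont (partial_d b (constr N c)) x" if "c \<in> duals" for b c x
    using C_k_isCont[of 2 "partial_d b (constr N c)"] C_k_constr[OF that]
    by (simp add: numeral_3_eq_3 numeral_2_eq_2)
  have limjac: "((\<lambda>p. jac \<rho> \<beta> p (\<Phi> p)) \<longlongrightarrow> jac \<rho> \<beta> ps ys) (at ps)"
  proof (rule tendsto_entries)
    fix a b
    have "isCont (partial_d b (res_fun \<beta> a)) ps"
      using C_k_isCont[of 0 "partial_d b (res_fun \<beta> a)" ps] C0[of a] by simp
    then have "((\<lambda>p. partial_d b (res_fun \<beta> a) (mix (owner N a) (p, \<Phi> p))) \<longlongrightarrow> partial_d b (res_fun \<beta> a) ps) (at ps)"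
      by (rule isCont_tendsto_compose[OF _ limmix])
    then show "((\<lambda>p. jac \<rho> \<beta> p (\<Phi> p) $ a $ b) \<longlongrightarrow> jac \<rho> \<beta> ps ys $ a $ b) (at ps)"
      unfolding jac_entry mix_dual_part by (auto intro: tendsto_intros)
  qed
  have limshift: "((\<lambda>p. shift N j p (\<Phi> p)) \<longlongrightarrow> ps) (at ps)" for j
  proof (rule vec_tendstoI)
    fix k
    have "((\<lambda>p. shift N j p (\<Phi> p) $ k) \<longlongrightarrow> shift N j ps ys $ k) (at ps)"
      unfolding shift_def vec_lambda_beta
      by (auto intro!: tendsto_intros tendsto_vec_nth[OF lim\<Phi>] tendsto_vec_nth[OF tendsto_ident_at])
    moreover have "shift N j ps ys $ k = ps $ k" by (simp add: shift_def dual_part_def)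
    ultimately show "((\<lambda>p. shift N j p (\<Phi> p) $ k) \<longlongrightarrow> ps $ k) (at ps)" by simp
  qed
  have limcoup: "((\<lambda>p. coup \<gamma> p (\<Phi> p)) \<longlongrightarrow> coup \<gamma> ps ys) (at ps)"
  proof (rule tendsto_entries)
    fix a b
    have shift_ps: "shift N j ps ys = ps" for j
      by (auto simp: shift_def dual_part_def vec_eq_iff)
    have 1: "((\<lambda>p. partial_d b (constr N c) (shift N j p (\<Phi> p))) \<longlongrightarrow> partial_d b (constr N c) ps) (at ps)"
      if "c \<in> duals" for b c j
      by (rule isCont_tendsto_compose[OF contC[OF that] limshift])
    have 2: "((\<lambda>p. if c \<in> eqs N then 1 else (\<Phi> p $ c)\<^sup>2) \<longlongrightarrow> (if c \<in> eqs N then 1 else (ys $ c)\<^sup>2)) (at ps)" for c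
      by (auto intro!: tendsto_intros tendsto_vec_nth[OF lim\<Phi>])
    have "((\<lambda>p. \<gamma> * (\<Sum>c \<in> duals \<inter> owned N (owner N b). (if c \<in> eqs N then 1 else (\<Phi> p $ c)\<^sup>2)
        * (partial_d a (constr N c) (shift N (owner N b) p (\<Phi> p)) * partial_d b (constr N c) (shift N (owner N b) p (\<Phi> p)))))
      \<longlongrightarrow> \<gamma> * (\<Sum>c \<in> duals \<inter> owned N (owner N b). (if c \<in> eqs N then 1 else (ys $ c)\<^sup>2)
        * (partial_d a (constr N c) ps * partial_d b (constr N c) ps))) (at ps)"
      by (intro tendsto_mult tendsto_sum tendsto_const 1 2) auto
    then show "((\<lambda>p. coup \<gamma> p (\<Phi> p) $ a $ b) \<longlongrightarrow> coup \<gamma> ps ys $ a $ b) (at ps)"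
      unfolding coup_entry shift_ps by (simp only: if_distrib) (auto intro: tendsto_intros)
  qed
  have ys0: "restr (prims N) ys = 0" by (simp add: vec_eq_iff dual_part_def)
  have "((\<lambda>p. jac \<rho> \<beta> p (\<Phi> p) *v (\<Phi> p - dual_part N p)) has_derivative
      (\<lambda>e. jac \<rho> \<beta> ps ys *v (\<Phi>' e - dual_part N e))) (at ps)"
    by (rule has_derivative_matrix_vanishing[OF limjac])
      (auto simp: \<Phi>(1) intro!: has_derivative_diff \<Phi>(2) bounded_linear_imp_has_derivative linD)
  moreover have "((\<lambda>p. coup \<gamma> p (\<Phi> p) *v restr (prims N) (\<Phi> p)) has_derivative
      (\<lambda>e. coup \<gamma> ps ys *v restr (prims N) (\<Phi>' e))) (at ps)"
    by (rule has_derivative_matrix_vanishing[OF limcoup bounded_linear.has_derivative[OF bounded_linear_restr \<Phi>(2)]])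
      (simp add: \<Phi>(1) ys0)
  ultimately have D: "(direction \<gamma> \<Phi> has_derivative (\<lambda>e. jac \<rho> \<beta> ps ys *v (\<Phi>' e - dual_part N e)
      + coup \<gamma> ps ys *v restr (prims N) (\<Phi>' e))) (at ps)"
    unfolding direction_def[abs_def] by (rule has_derivative_add)
  have "jac \<rho> \<beta> ps ys *v (\<Phi>' e - dual_part N e) + coup \<gamma> ps ys *v restr (prims N) (\<Phi>' e)
      = - (A_matrix N \<beta> \<gamma> ps *v e)" for e
  proof -
    have bl: "bounded_linear (residual' \<rho> \<beta> ps)"
      using residual_strict_derivative by (simp add: strict_derivative_def)
    \<comment> \<open>The Newton step maps the residual at \<open>(p, d(p))\<close> to the one at \<open>(p, \<Phi> p)\<close>, which vanishes.\<close>
    have "jac \<rho> \<beta> ps ys *v (\<Phi>' e - dual_part N e) = residual' \<rho> \<beta> ps ((e, \<Phi>' e) - (e, dual_part N e))"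
      by (simp add: residual'_snd)
    also have "\<dots> = - (A_matrix N \<beta> 0 ps *v e)"
      by (subst linear_simps(2)[OF bl]) (simp add: \<Phi>(3) residual'_dual_part)
    finally have newton: "jac \<rho> \<beta> ps ys *v (\<Phi>' e - dual_part N e) = - (A_matrix N \<beta> 0 ps *v e)" .
    show ?thesis
    proof (subst vec_eq_iff, intro allI)
      fix a
      show "(jac \<rho> \<beta> ps ys *v (\<Phi>' e - dual_part N e) + coup \<gamma> ps ys *v restr (prims N) (\<Phi>' e)) $ a
          = (- (A_matrix N \<beta> \<gamma> ps *v e)) $ a"
        unfolding newton using coup_linearized[OF \<Phi>(3), of \<gamma> e a] A_matrix_mult[of \<gamma> e a] by simp
    qed
  qed
  then show ?thesis using D by simp
qed

end

section \<open>Convergence\<close>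

context kkt_setting
begin

text \<open>
  One set of constants serves all small step sizes, because \<open>euler_step\<close> measures the error of the
  direction against \<open>\<eta>\<close>, which does not depend on \<open>\<alpha>\<close>.
\<close>

lemma sbdp_contraction:
  assumes map: "local_solution_map N \<rho> ps \<Phi>"
    and pd: "pos_def_on (prims N) (A_matrix N \<beta> \<gamma> ps)"
  obtains P \<alpha>0 r k c where "transpose P = P" "c > 0" "\<And>v. c * (norm v)\<^sup>2 \<le> v \<bullet> (P *v v)"
    "\<alpha>0 > 0" "r > 0" "k > 0" "\<And>\<alpha>. \<alpha> < \<alpha>0 \<Longrightarrow> 0 < 1 - \<alpha> * k"
    "\<And>\<alpha> p. 0 < \<alpha> \<Longrightarrow> \<alpha> < \<alpha>0 \<Longrightarrow> norm (p - ps) < r \<Longrightarrow>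
      (sbdp_step N \<rho> \<Phi> \<alpha> \<beta> \<gamma> p - ps) \<bullet> (P *v (sbdp_step N \<rho> \<Phi> \<alpha> \<beta> \<gamma> p - ps))
        \<le> (1 - \<alpha> * k) * ((p - ps) \<bullet> (P *v (p - ps)))"
    "\<And>\<alpha> e. 0 < \<alpha> \<Longrightarrow> \<alpha> < \<alpha>0 \<Longrightarrow>
      ((mat 1 - \<alpha> *\<^sub>R A_matrix N \<beta> \<gamma> ps) *v e) \<bullet> (P *v ((mat 1 - \<alpha> *\<^sub>R A_matrix N \<beta> \<gamma> ps) *v e))
        \<le> (1 - \<alpha> * k) * (e \<bullet> (P *v e))"
proof -
  let ?A = "A_matrix N \<beta> \<gamma> ps"
  obtain P c where P: "transpose P = P" "c > 0" "\<And>v. c * (norm v)\<^sup>2 \<le> v \<bullet> (P *v v)"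
    "\<And>v. c * (norm v)\<^sup>2 \<le> v \<bullet> (P *v (?A *v v))"
    using A_lyapunov[OF pd] by metis
  obtain \<alpha>0 \<eta> k where e: "\<alpha>0 > 0" "\<eta> > 0" "k > 0" "\<And>\<alpha>. \<alpha> < \<alpha>0 \<Longrightarrow> 0 < 1 - \<alpha> * k"
    "\<And>\<alpha> e f. 0 < \<alpha> \<Longrightarrow> \<alpha> < \<alpha>0 \<Longrightarrow> norm (f + ?A *v e) \<le> \<eta> * norm e \<Longrightarrow>
      (e + \<alpha> *\<^sub>R f) \<bullet> (P *v (e + \<alpha> *\<^sub>R f)) \<le> (1 - \<alpha> * k) * (e \<bullet> (P *v e))"
    using euler_step[OF P] by metis
  have D: "(direction \<gamma> \<Phi> has_derivative (\<lambda>e. - (?A *v e))) (at ps)"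
    by (rule direction_derivative[OF map])
  have D0: "direction \<gamma> \<Phi> ps = 0"
    using map by (intro direction_zero) (simp add: local_solution_map_def)
  obtain r where r: "r > 0" "\<And>p. norm (p - ps) < r \<Longrightarrow>
      norm (direction \<gamma> \<Phi> p - direction \<gamma> \<Phi> ps - - (?A *v (p - ps))) \<le> \<eta> * norm (p - ps)"
    using D \<open>\<eta> > 0\<close> unfolding has_derivative_at_alt by blast
  show thesis
  proof (rule that[OF P(1,2,3) e(1) r(1) e(3,4)])
    fix \<alpha> :: real and p :: "real ^ 'k"
    assume \<alpha>: "0 < \<alpha>" "\<alpha> < \<alpha>0" and p: "norm (p - ps) < r"
    have dir: "norm (direction \<gamma> \<Phi> p + ?A *v (p - ps)) \<le> \<eta> * norm (p - ps)"
      using r(2)[OF p] by (simp add: D0)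
    have eq: "sbdp_step N \<rho> \<Phi> \<alpha> \<beta> \<gamma> p - ps = (p - ps) + \<alpha> *\<^sub>R direction \<gamma> \<Phi> p"
      by (simp add: sbdp_step_direction)
    show "(sbdp_step N \<rho> \<Phi> \<alpha> \<beta> \<gamma> p - ps) \<bullet> (P *v (sbdp_step N \<rho> \<Phi> \<alpha> \<beta> \<gamma> p - ps))
        \<le> (1 - \<alpha> * k) * ((p - ps) \<bullet> (P *v (p - ps)))"
      unfolding eq by (rule e(5)[OF \<alpha> dir])
  next
    fix \<alpha> :: real and e' :: "real ^ 'k"
    assume \<alpha>: "0 < \<alpha>" "\<alpha> < \<alpha>0"
    have "(mat 1 - \<alpha> *\<^sub>R ?A) *v e' = e' + \<alpha> *\<^sub>R (- (?A *v e'))"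
      by (simp add: matrix_vector_mult_diff_rdistrib scaleR_matrix_vector_assoc)
    then show "((mat 1 - \<alpha> *\<^sub>R ?A) *v e') \<bullet> (P *v ((mat 1 - \<alpha> *\<^sub>R ?A) *v e'))
        \<le> (1 - \<alpha> * k) * (e' \<bullet> (P *v e'))"
      using e(5)[OF \<alpha>, of "- (?A *v e')" e'] e(2) by simp
  qed
qed

end

text \<open>
  An iteration that contracts a quadratic form by a fixed factor on a ball stays in the ball, if it
  starts in a smaller one that accounts for the equivalence constants of the two norms.
\<close>

lemma local_linear_convergence:
  fixes step :: "real ^ 'k \<Rightarrow> real ^ 'k"
  assumes c: "c > 0" "\<And>v. c * (norm v)\<^sup>2 \<le> v \<bullet> (P *v v)"
    and L: "L > 0" "\<And>v. v \<bullet> (P *v v) \<le> L * (norm v)\<^sup>2"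
    and \<theta>: "0 < \<theta>" "\<theta> < 1"
    and contr: "\<And>p. norm (p - ps) < r \<Longrightarrow>
      (step p - ps) \<bullet> (P *v (step p - ps)) \<le> \<theta> * ((p - ps) \<bullet> (P *v (p - ps)))"
    and p0: "norm (p0 - ps) < r / sqrt (L / c)" and r: "r > 0"
  shows "norm ((step ^^ q) p0 - ps) \<le> sqrt (L / c) * sqrt \<theta> ^ q * norm (p0 - ps)"
proof -
  let ?V = "\<lambda>v. v \<bullet> (P *v v)"
  have s: "sqrt (L / c) > 0" using c L by simp
  have to_norm: "norm v \<le> sqrt (L / c) * sqrt \<theta> ^ q * norm (p0 - ps)" if "?V v \<le> \<theta> ^ q * ?V (p0 - ps)" for v q
  proof -
    have "c * (norm v)\<^sup>2 \<le> \<theta> ^ q * (L * (norm (p0 - ps))\<^sup>2)"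
    proof -
      have "\<theta> ^ q * ?V (p0 - ps) \<le> \<theta> ^ q * (L * (norm (p0 - ps))\<^sup>2)"
        using \<theta> by (intro mult_left_mono L) simp
      then show ?thesis using c(2)[of v] that by linarith
    qed
    then have "(norm v)\<^sup>2 \<le> L / c * \<theta> ^ q * (norm (p0 - ps))\<^sup>2"
      using c(1) by (simp add: field_simps)
    then have "sqrt ((norm v)\<^sup>2) \<le> sqrt (L / c * \<theta> ^ q * (norm (p0 - ps))\<^sup>2)"
      by (rule real_sqrt_le_mono)
    then show ?thesis by (simp only: real_sqrt_mult real_sqrt_power[of \<theta>] real_sqrt_abs abs_norm_cancel)
  qed
  have "?V ((step ^^ q) p0 - ps) \<le> \<theta> ^ q * ?V (p0 - ps)"
  proof (induction q)
    case (Suc q)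
    have "norm ((step ^^ q) p0 - ps) \<le> sqrt (L / c) * sqrt \<theta> ^ q * norm (p0 - ps)"
      by (rule to_norm[OF Suc.IH])
    also have "\<dots> \<le> sqrt (L / c) * 1 * norm (p0 - ps)"
      using \<theta> s by (intro mult_right_mono mult_left_mono power_le_one) auto
    also have "\<dots> < r" using p0 s by (simp add: pos_less_divide_eq mult.commute)
    finally have "?V (step ((step ^^ q) p0) - ps) \<le> \<theta> * ?V ((step ^^ q) p0 - ps)" by (rule contr)
    also have "\<dots> \<le> \<theta> * (\<theta> ^ q * ?V (p0 - ps))" using Suc.IH \<theta> by (intro mult_left_mono) auto
    finally show ?case by simp
  qed simp
  then show ?thesis by (rule to_norm)
qed

lemma funpow_tendsto_zero:
  fixes M :: "real ^ 'k ^ 'k"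
  assumes c: "c > 0" "\<And>v. c * (norm v)\<^sup>2 \<le> v \<bullet> (P *v v)"
    and L: "L > 0" "\<And>v. v \<bullet> (P *v v) \<le> L * (norm v)\<^sup>2"
    and \<theta>: "0 < \<theta>" "\<theta> < 1"
    and contr: "\<And>v. (M *v v) \<bullet> (P *v (M *v v)) \<le> \<theta> * (v \<bullet> (P *v v))"
  shows "(\<lambda>n. ((\<lambda>x. M *v x) ^^ n) v) \<longlonglongrightarrow> 0"
proof (rule tendsto_norm_zero_cancel, rule tendsto_sandwich[of "\<lambda>_. 0"])
  define r where "r = (norm v + 1) * sqrt (L / c)"
  have s: "sqrt (L / c) > 0" using c L by simp
  then have r: "r > 0" "norm v < r / sqrt (L / c)"
    by (auto simp: r_def intro!: mult_pos_pos add_nonneg_pos)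
  have "norm (((\<lambda>x. M *v x) ^^ n) v - 0) \<le> sqrt (L / c) * sqrt \<theta> ^ n * norm (v - 0)" for n
    by (rule local_linear_convergence[where r = r and P = P]) (use assms r in auto)
  then show "\<forall>\<^sub>F n in sequentially. norm (((\<lambda>x. M *v x) ^^ n) v) \<le> sqrt (L / c) * sqrt \<theta> ^ n * norm v"
    by simp
  have lim: "(\<lambda>n. sqrt \<theta> ^ n) \<longlonglongrightarrow> 0" using \<theta> by (intro LIMSEQ_realpow_zero) auto
  have "(\<lambda>n. sqrt (L / c) * sqrt \<theta> ^ n * norm v) \<longlonglongrightarrow> sqrt (L / c) * 0 * norm v"
    by (intro tendsto_mult tendsto_const lim)
  then show "(\<lambda>n. sqrt (L / c) * sqrt \<theta> ^ n * norm v) \<longlonglongrightarrow> 0" by simp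
qed auto

text \<open>
  The induced norm of \<open>I - \<alpha> A\<close> is required to be positive; for small \<open>\<alpha>\<close> a diagonal entry of this
  matrix is nonzero.
\<close>

lemma step_matrix_nonzero:
  fixes A :: "real ^ 'k ^ 'k"
  obtains \<alpha>1 where "\<alpha>1 > 0" "\<And>\<alpha>. 0 < \<alpha> \<Longrightarrow> \<alpha> < \<alpha>1 \<Longrightarrow> mat 1 - \<alpha> *\<^sub>R A \<noteq> 0"
proof
  let ?k = "undefined :: 'k"
  show "1 / (1 + \<bar>A $ ?k $ ?k\<bar>) > 0" by simp
  fix \<alpha> :: real assume \<alpha>: "0 < \<alpha>" "\<alpha> < 1 / (1 + \<bar>A $ ?k $ ?k\<bar>)"
  then have "\<alpha> * (1 + \<bar>A $ ?k $ ?k\<bar>) < 1" by (simp add: field_simps)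
  moreover have "\<alpha> * A $ ?k $ ?k \<le> \<alpha> * (1 + \<bar>A $ ?k $ ?k\<bar>)" using \<alpha> by (intro mult_left_mono) auto
  ultimately have "(mat 1 - \<alpha> *\<^sub>R A) $ ?k $ ?k \<noteq> 0" by (simp add: mat_def)
  then show "mat 1 - \<alpha> *\<^sub>R A \<noteq> 0" by (metis zero_index)
qed

text \<open>
  The norms of the form \<open>P\<close> and the Euclidean norm are equivalent with constant \<open>sqrt (L / c)\<close>; this
  is the factor in the rate estimate and the factor by which the ball of starting points is smaller
  than the ball on which a step contracts.
\<close>

lemma (in kkt_setting) sbdp_linear_convergence:
  assumes "local_solution_map N \<rho> ps \<Phi>" "pos_def_on (prims N) (A_matrix N \<beta> \<gamma> ps)"
  shows "\<exists>\<alpha>bar>0. \<exists>r>0. \<forall>\<alpha>. 0 < \<alpha> \<and> \<alpha> < 1 \<and> \<alpha> < \<alpha>bar \<longrightarrow>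
      (\<forall>p0 \<in> ball ps r. bounded (range (sbdp N \<rho> \<Phi> \<alpha> \<beta> \<gamma> p0)) \<and> sbdp N \<rho> \<Phi> \<alpha> \<beta> \<gamma> p0 \<longlonglongrightarrow> ps) \<and>
      (\<forall>Q. sym_pos_def Q \<longrightarrow> (\<exists>Pbar. sym_pos_def Pbar \<and>
          transpose (mat 1 - \<alpha> *\<^sub>R A_matrix N \<beta> \<gamma> ps) ** Pbar ** (mat 1 - \<alpha> *\<^sub>R A_matrix N \<beta> \<gamma> ps) - Pbar = - Q \<and>
          0 < wnorm_mat Pbar (mat 1 - \<alpha> *\<^sub>R A_matrix N \<beta> \<gamma> ps) \<and>
          wnorm_mat Pbar (mat 1 - \<alpha> *\<^sub>R A_matrix N \<beta> \<gamma> ps) < 1)) \<and>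
      (\<exists>C0>0. \<exists>C1. 0 < C1 \<and> C1 < 1 \<and> (\<forall>p0 \<in> ball ps r. \<forall>q\<ge>1.
          norm (sbdp N \<rho> \<Phi> \<alpha> \<beta> \<gamma> p0 q - ps) \<le> C0 * C1 ^ q * norm (p0 - ps)))"
proof -
  obtain P \<alpha>0 r k c where P: "transpose P = P" "c > 0" "\<And>v. c * (norm v)\<^sup>2 \<le> v \<bullet> (P *v v)"
    and pos: "\<alpha>0 > 0" "r > 0" "k > 0" "\<And>\<alpha>. \<alpha> < \<alpha>0 \<Longrightarrow> 0 < 1 - \<alpha> * k"
    and step: "\<And>\<alpha> p. 0 < \<alpha> \<Longrightarrow> \<alpha> < \<alpha>0 \<Longrightarrow> norm (p - ps) < r \<Longrightarrow>
      (sbdp_step N \<rho> \<Phi> \<alpha> \<beta> \<gamma> p - ps) \<bullet> (P *v (sbdp_step N \<rho> \<Phi> \<alpha> \<beta> \<gamma> p - ps))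
        \<le> (1 - \<alpha> * k) * ((p - ps) \<bullet> (P *v (p - ps)))"
    and lin: "\<And>\<alpha> e. 0 < \<alpha> \<Longrightarrow> \<alpha> < \<alpha>0 \<Longrightarrow>
      ((mat 1 - \<alpha> *\<^sub>R A_matrix N \<beta> \<gamma> ps) *v e) \<bullet> (P *v ((mat 1 - \<alpha> *\<^sub>R A_matrix N \<beta> \<gamma> ps) *v e))
        \<le> (1 - \<alpha> * k) * (e \<bullet> (P *v e))"
    using sbdp_contraction[OF assms] by metis
  obtain \<alpha>1 where \<alpha>1: "\<alpha>1 > 0" "\<And>\<alpha>. 0 < \<alpha> \<Longrightarrow> \<alpha> < \<alpha>1 \<Longrightarrow> mat 1 - \<alpha> *\<^sub>R A_matrix N \<beta> \<gamma> ps \<noteq> 0"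
    using step_matrix_nonzero by blast
  obtain L where L: "L > 0" "\<And>x. norm (P *v x) \<le> norm x * L"
    using bounded_linear.pos_bounded[OF matrix_vector_mul_bounded_linear[of P]] by blast
  have up: "v \<bullet> (P *v v) \<le> L * (norm v)\<^sup>2" for v
  proof -
    have "v \<bullet> (P *v v) \<le> norm v * norm (P *v v)" by (rule norm_cauchy_schwarz)
    also have "\<dots> \<le> norm v * (norm v * L)" by (intro mult_left_mono L) simp
    finally show ?thesis by (simp add: power2_eq_square ac_simps)
  qed
  have s: "sqrt (L / c) > 0" using L P by simp
  have "min \<alpha>0 \<alpha>1 > 0" "r / sqrt (L / c) > 0" using pos \<alpha>1 s by auto
  show ?thesis
  proof (rule exI[of _ "min \<alpha>0 \<alpha>1"], rule conjI, fact, rule exI[of _ "r / sqrt (L / c)"], rule conjI, fact,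
      rule allI, rule impI, rule conjI[OF _ conjI])
    fix \<alpha> assume "0 < \<alpha> \<and> \<alpha> < 1 \<and> \<alpha> < min \<alpha>0 \<alpha>1"
    then have \<alpha>: "0 < \<alpha>" "\<alpha> < \<alpha>0" "\<alpha> < \<alpha>1" by auto
    let ?M = "mat 1 - \<alpha> *\<^sub>R A_matrix N \<beta> \<gamma> ps"
    let ?p = "sbdp N \<rho> \<Phi> \<alpha> \<beta> \<gamma>"
    have \<theta>: "0 < 1 - \<alpha> * k" "1 - \<alpha> * k < 1" using pos(3) pos(4)[OF \<alpha>(2)] \<alpha>(1) by auto
    have rate: "\<forall>p0 \<in> ball ps (r / sqrt (L / c)). \<forall>q.
        norm (?p p0 q - ps) \<le> sqrt (L / c) * sqrt (1 - \<alpha> * k) ^ q * norm (p0 - ps)"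
    proof (intro ballI allI)
      fix p0 q assume "p0 \<in> ball ps (r / sqrt (L / c))"
      then have "norm (p0 - ps) < r / sqrt (L / c)" by (simp add: dist_norm norm_minus_commute)
      then show "norm (?p p0 q - ps) \<le> sqrt (L / c) * sqrt (1 - \<alpha> * k) ^ q * norm (p0 - ps)"
        unfolding sbdp_def
        by (intro local_linear_convergence[OF P(2,3) L(1) up \<theta> step[OF \<alpha>(1,2)] _ pos(2)])
    qed
    show "\<forall>p0 \<in> ball ps (r / sqrt (L / c)). bounded (range (?p p0)) \<and> ?p p0 \<longlonglongrightarrow> ps"
    proof
      fix p0 assume p0: "p0 \<in> ball ps (r / sqrt (L / c))"
      have lim: "(\<lambda>q. sqrt (1 - \<alpha> * k) ^ q) \<longlonglongrightarrow> 0" using \<theta> by (intro LIMSEQ_realpow_zero) auto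
      have "(\<lambda>q. sqrt (L / c) * sqrt (1 - \<alpha> * k) ^ q * norm (p0 - ps)) \<longlonglongrightarrow> sqrt (L / c) * 0 * norm (p0 - ps)"
        by (intro tendsto_mult tendsto_const lim)
      then have zero: "(\<lambda>q. sqrt (L / c) * sqrt (1 - \<alpha> * k) ^ q * norm (p0 - ps)) \<longlonglongrightarrow> 0" by simp
      have "(\<lambda>q. ?p p0 q - ps) \<longlonglongrightarrow> 0"
        by (rule Lim_null_comparison[OF always_eventually zero]) (rule bspec[OF rate p0])
      then have "?p p0 \<longlonglongrightarrow> ps" by (rule LIM_zero_cancel)
      then show "bounded (range (?p p0)) \<and> ?p p0 \<longlonglongrightarrow> ps"
        using convergent_imp_bounded by blast
    qed
    show "\<exists>C0>0. \<exists>C1. 0 < C1 \<and> C1 < 1 \<and> (\<forall>p0 \<in> ball ps (r / sqrt (L / c)). \<forall>q\<ge>1.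
        norm (?p p0 q - ps) \<le> C0 * C1 ^ q * norm (p0 - ps))"
      by (rule exI[of _ "sqrt (L / c)"], rule conjI[OF s], rule exI[of _ "sqrt (1 - \<alpha> * k)"])
        (use \<theta> rate in simp)
    have "\<exists>Pbar. sym_pos_def Pbar \<and> transpose ?M ** Pbar ** ?M - Pbar = - Q \<and>
        0 < wnorm_mat Pbar ?M \<and> wnorm_mat Pbar ?M < 1" if Q: "sym_pos_def Q" for Q
    proof -
      have "(\<lambda>n. ((\<lambda>x. ?M *v x) ^^ n) v) \<longlonglongrightarrow> 0" for v
        by (rule funpow_tendsto_zero[OF P(2,3) L(1) up \<theta> lin[OF \<alpha>(1,2)]])
      from discrete_lyapunov[OF this Q] obtain Pbar where
        Pbar: "sym_pos_def Pbar" "transpose ?M ** Pbar ** ?M - Pbar = - Q" by blast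
      then show ?thesis
        using wnorm_mat_lyapunov[OF Pbar(1) Q Pbar(2) \<alpha>1(2)[OF \<alpha>(1,3)]] by blast
    qed
    then show "\<forall>Q. sym_pos_def Q \<longrightarrow> (\<exists>Pbar. sym_pos_def Pbar \<and>
        transpose ?M ** Pbar ** ?M - Pbar = - Q \<and> 0 < wnorm_mat Pbar ?M \<and> wnorm_mat Pbar ?M < 1)"
      by blast
  qed
qed

theorem theorem2:
  fixes N :: "('k::finite, 'v::finite) nlp"
    and \<rho> :: "'v \<Rightarrow> real"
    and \<beta> :: real
    and ps :: "real ^ 'k"
  assumes "nlp_wf N"
    and "kkt_point N ps"
    and "strict_complementarity N ps"
    and "licq N ps"
    and "sosc N ps"
    and "local_convexity N \<rho> ps"
    and "compatible_decomposition N ps"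
    and "\<beta> > 0"
  shows "(\<exists>\<Phi>. local_solution_map N \<rho> ps \<Phi>) \<and>
    (\<forall>\<Phi>. local_solution_map N \<rho> ps \<Phi> \<longrightarrow>
      (\<exists>\<gamma>bar::real. \<forall>\<gamma>. \<gamma> \<ge> 0 \<and> \<gamma> > \<gamma>bar \<longrightarrow>
        (\<exists>\<alpha>bar>0. \<exists>r>0. \<forall>\<alpha>. 0 < \<alpha> \<and> \<alpha> < 1 \<and> \<alpha> < \<alpha>bar \<longrightarrow>
          (let M = mat 1 - \<alpha> *\<^sub>R A_matrix N \<beta> \<gamma> ps;
               P = sbdp N \<rho> \<Phi> \<alpha> \<beta> \<gamma>;
               lyap = (\<lambda>Q Pbar. sym_pos_def Pbar \<and>
                         transpose M ** Pbar ** M - Pbar = - Q \<and>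
                         0 < wnorm_mat Pbar M \<and> wnorm_mat Pbar M < 1)
           in
            (\<forall>p0 \<in> ball ps r. bounded (range (P p0)) \<and> P p0 \<longlonglongrightarrow> ps) \<and>
            (\<forall>Q. sym_pos_def Q \<longrightarrow> (\<exists>Pbar. lyap Q Pbar)) \<and>
            ((\<forall>Q. sym_pos_def Q \<longrightarrow>
                (\<exists>Pbar. lyap Q Pbar \<and>
                  (\<forall>p0 \<in> ball ps r. \<forall>q\<ge>1.
                     wnorm Pbar (P p0 q - ps)
                       \<le> wnorm_mat Pbar M * wnorm Pbar (P p0 (q - 1) - ps)))) \<or>
             (\<exists>C0>0. \<exists>C1. 0 < C1 \<and> C1 < 1 \<and>
                (\<forall>p0 \<in> ball ps r. \<forall>q\<ge>1.
                   norm (P p0 q - ps) \<le> C0 * C1 ^ q * norm (p0 - ps))))))))"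
proof -
  interpret kkt_setting N \<rho> \<beta> ps by unfold_locales (fact assms)+
  obtain \<gamma>0 where \<gamma>0: "\<And>\<gamma>. \<gamma> > \<gamma>0 \<Longrightarrow> pos_def_on (prims N) (A_matrix N \<beta> \<gamma> ps)"
    using A_matrix_pos_def by blast
  have ex: "\<exists>\<Phi>. local_solution_map N \<rho> ps \<Phi>" using differentiable_solution_map by blast
  \<comment> \<open>Of the two equivalent forms of linear convergence, the estimate in the Euclidean norm is proved.\<close>
  have weaken: "\<exists>\<alpha>bar>0. \<exists>r>0. \<forall>\<alpha>. X \<alpha> \<alpha>bar \<longrightarrow> A \<alpha> r \<and> B \<alpha> r \<and> C \<alpha> r \<Longrightarrow>
      \<exists>\<alpha>bar>0. \<exists>r>0. \<forall>\<alpha>. X \<alpha> \<alpha>bar \<longrightarrow> A \<alpha> r \<and> B \<alpha> r \<and> (D \<alpha> r \<or> C \<alpha> r)"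
    for X A B C D :: "real \<Rightarrow> real \<Rightarrow> bool"
    by blast
  show ?thesis
    unfolding Let_def
    by (rule conjI[OF ex], rule allI, rule impI, rule exI[of _ \<gamma>0], rule allI, rule impI, rule weaken,
        rule sbdp_linear_convergence, assumption, rule \<gamma>0, erule conjunct2)
qed

end
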